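(* Let $k$ be a field of characteristic $p>0$, $r\ge0$, assume $p>n$, and let $\lambda$ be a partition of $n$. Then $$\mathrm{H}^*_{\mathcal P}(\mathrm{GL},S^\lambda(g\ell^{(r)}))\ \cong\ s^\lambda\big(\mathrm{H}^*_{\mathcal P}(\mathrm{GL},(g\ell^{(r)})^{\otimes n})\big).$$ In particular, $$\mathrm{H}^*_{\mathcal P}(\mathrm{GL},S^n(g\ell^{(r)}))\cong s^{(n)}\big(\mathrm{H}^*_{\mathcal P}(\mathrm{GL},(g\ell^{(r)})^{\otimes n})\big)\cong k\otimes_{k\mathfrak S_n}\mathrm{H}^*_{\mathcal P}(\mathrm{GL},(g\ell^{(r)})^{\otimes n}),$$ $$\mathrm{H}^*_{\mathcal P}(\mathrm{GL},\Lambda^n(g\ell^{(r)}))\cong s^{(1,\dots,1)}\big(\mathrm{H}^*_{\mathcal P}(\mathrm{GL},(g\ell^{(r)})^{\otimes n})\big)\cong k_{sgn}\otimes_{k\mathfrak S_n}\mathrm{H}^*_{\mathcal P}(\mathrm{GL},(g\ell^{(r)})^{\otimes n}).$$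
   Context: A polynomial map $V\to W$ of finite dimensional $k$-vector spaces is an element of $S^*(V^\#)\otimes W$. A strict polynomial bifunctor (contravariant in the first variable, covariant in the second) assigns to each pair $V,W$ of finite dimensional $k$-vector spaces a finite dimensional space $T(V,W)$ and to each $V,W,V',W'$ a polynomial map $\mathrm{Hom}_k(V,V')\times \mathrm{Hom}_k(W,W')\to \mathrm{Hom}_k(T(V',W),T(V,W'))$, compatibly with identities and composition. $\mathcal P^{op}\times\mathcal P$ is the abelian category of strict polynomial bifunctors of bounded degree; $\mathrm{Ext}$ denotes derived functors of $\mathrm{Hom}$ in it. $g\ell(V,W)=\mathrm{Hom}_k(V,W)$; $g\ell^{(r)}=I^{(r)}\circ g\ell$ with $I^{(r)}$ the $r$-th Frobenius twist functor; $\Gamma^m(V)=(V^{\otimes m})^{\mathfrak S_m}$. For a strict polynomial bifunctor $T$ homogeneous of bidegree $(m,m)$ write $\mathrm{H}^*_{\mathcal P}(\mathrm{GL},T)=\mathrm{Ext}^*_{\mathcal P^{op}\times\mathcal P}(\Gamma^m\circ g\ell,T)$; here $m=np^r$. The group $\mathfrak S_n$ acts on $\mathrm{H}^*_{\mathcal P}(\mathrm{GL},(g\ell^{(r)})^{\otimes n})$ through permutation of the tensor factors of $(g\ell^{(r)})^{\otimes n}$. For a partition $\lambda=(\lambda_1,\dots,\lambda_j)$ of $n$ choose a Young tableau of shape $\lambda$; let $a_\lambda\in k\mathfrak S_n$ be the sum of the permutations preserving the rows, $b_\lambda$ the alternating (signed) sum of the permutations preserving the columns, and $c_\lambda=a_\lambda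 b_\lambda$ (some nonzero multiple of which is idempotent as $p>n$). For a left $k\mathfrak S_n$-module $W$ put $s^\lambda(W)=(k\mathfrak S_n\cdot c_\lambda)\otimes_{k\mathfrak S_n}W$, where the left ideal $k\mathfrak S_n c_\lambda$ is regarded as a right module through $\sigma\mapsto\sigma^{-1}$. For a vector space $V$, $S^\lambda(V)=s^\lambda(V^{\otimes n})$ with $\mathfrak S_n$ permuting tensor factors, and likewise $S^\lambda(g\ell^{(r)})=s^\lambda((g\ell^{(r)})^{\otimes n})$; in particular $S^{(n)}=S^n$ and $S^{(1,\dots,1)}=\Lambda^n$. $k$ and $k_{sgn}$ are the trivial and sign representations of $\mathfrak S_n$. *)

theory Defs
  imports
    "HOL-Computational_Algebra.Computational_Algebra"
    "HOL-Combinatorics.Permutations"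
    "HOL-Library.Poly_Mapping"
    "HOL-Library.FuncSet"
    "HOL-Algebra.Module"
    "HOL-Algebra.AbelCoset"
begin

section \<open>Vector spaces\<close>

text \<open>A vector space over the field of type \<open>'k\<close> is a HOL-Algebra module over \<open>scalars\<close>.
  The fields \<open>mult\<close> and \<open>one\<close> of the module record are irrelevant and left undefined.\<close>

definition scalars :: "'k::field ring" where
  "scalars = \<lparr>carrier = UNIV, mult = (*), one = 1, zero = 0, add = (+)\<rparr>"

abbreviation vspace :: "('k::field, 'a) module \<Rightarrow> bool" where
  "vspace M \<equiv> Module.module scalars M"

definition gen_subspace :: "('k::field, 'a) module \<Rightarrow> 'a set \<Rightarrow> 'a set" where
  "gen_subspace M S = \<Inter> {N. submodule N scalars M \<and> S \<subseteq> N}"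

definition fd_vspace :: "('k::field, 'a) module \<Rightarrow> bool" where
  "fd_vspace M \<longleftrightarrow> vspace M \<and>
     (\<exists>S. finite S \<and> S \<subseteq> carrier M \<and> gen_subspace M S = carrier M)"

definition linear_map :: "('k, 'a) module \<Rightarrow> ('k, 'b) module \<Rightarrow> ('a \<Rightarrow> 'b) \<Rightarrow> bool" where
  "linear_map M N f \<longleftrightarrow> f \<in> carrier M \<rightarrow> carrier N \<and>
     (\<forall>x\<in>carrier M. \<forall>y\<in>carrier M. f (x \<oplus>\<^bsub>M\<^esub> y) = f x \<oplus>\<^bsub>N\<^esub> f y) \<and>
     (\<forall>c. \<forall>x\<in>carrier M. f (c \<odot>\<^bsub>M\<^esub> x) = c \<odot>\<^bsub>N\<^esub> f x)"

definition vs_iso :: "('k, 'a) module \<Rightarrow> ('k, 'b) module \<Rightarrow> bool" (infix \<open>\<cong>\<^sub>k\<close> 50) where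
  "M \<cong>\<^sub>k N \<longleftrightarrow> (\<exists>f. linear_map M N f \<and> bij_betw f (carrier M) (carrier N))"

definition ker :: "('k, 'a) module \<Rightarrow> ('k, 'b) module \<Rightarrow> ('a \<Rightarrow> 'b) \<Rightarrow> 'a set" where
  "ker M N f = {x \<in> carrier M. f x = \<zero>\<^bsub>N\<^esub>}"

definition quot_space :: "('k, 'a) module \<Rightarrow> 'a set \<Rightarrow> ('k, 'a set) module" where
  "quot_space M N = \<lparr>carrier = a_rcosets\<^bsub>M\<^esub> N, mult = undefined, one = undefined,
     zero = N, add = set_add M, smult = (\<lambda>c X. \<Union>x\<in>X. N +>\<^bsub>M\<^esub> (c \<odot>\<^bsub>M\<^esub> x))\<rparr>"

text \<open>For a linear map \<open>f\<close> into \<open>M'\<close>, the map it induces from a quotient space into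
  \<open>M' / N'\<close>.\<close>

definition quot_map :: "('k, 'b) module \<Rightarrow> 'b set \<Rightarrow> ('a \<Rightarrow> 'b) \<Rightarrow> 'a set \<Rightarrow> 'b set" where
  "quot_map M' N' f X = (\<Union>x\<in>X. N' +>\<^bsub>M'\<^esub> f x)"

text \<open>The coordinate space with basis \<open>X\<close>, realised as the functions vanishing off \<open>X\<close>.\<close>

definition fun_space :: "'x set \<Rightarrow> ('k::field, 'x \<Rightarrow> 'k) module" where
  "fun_space X = \<lparr>carrier = {f. \<forall>x. x \<notin> X \<longrightarrow> f x = 0}, mult = undefined, one = undefined,
     zero = (\<lambda>_. 0), add = (\<lambda>f g x. f x + g x), smult = (\<lambda>c f x. c * f x)\<rparr>"

definition line :: "('k::field, 'k) module" where
  "line = \<lparr>carrier = UNIV, mult = undefined, one = undefined, zero = 0, add = (+), smult = (*)\<rparr>"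

definition free_space :: "'x set \<Rightarrow> ('k::field, 'x \<Rightarrow>\<^sub>0 'k) module" where
  "free_space X = \<lparr>carrier = {f. Poly_Mapping.keys f \<subseteq> X}, mult = undefined, one = undefined,
     zero = 0, add = (+), smult = (\<lambda>c. Poly_Mapping.map ((*) c))\<rparr>"


section \<open>Strict polynomial bifunctors\<close>

text \<open>The category of finite dimensional vector spaces is replaced by its skeleton with
  objects \<open>k^a\<close> and matrices as morphisms; a pair \<open>(a, b)\<close> of natural numbers stands for the
  pair of spaces \<open>V = k^a\<close>, \<open>W = k^b\<close>. A morphism from \<open>s = (a, b)\<close> to \<open>s' = (a', b')\<close> in
  (spaces)\<open>^op \<times>\<close> (spaces) is a pair of a matrix \<open>A : k^a' \<rightarrow> k^a\<close> of size \<open>a \<times> a'\<close> and a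
  matrix \<open>B : k^b \<rightarrow> k^b'\<close> of size \<open>b' \<times> b\<close>. \<open>CV i j\<close> and \<open>WV i j\<close> are the coordinate
  functions giving the \<open>(i, j)\<close> entry of \<open>A\<close> and of \<open>B\<close>.\<close>

type_synonym obj = "nat \<times> nat"

datatype coord = CV nat nat | WV nat nat

definition coords :: "obj \<Rightarrow> obj \<Rightarrow> coord set" where
  "coords s s' = {CV i j | i j. i < fst s \<and> j < fst s'} \<union> {WV i j | i j. i < snd s' \<and> j < snd s}"

type_synonym monomial = "coord \<Rightarrow>\<^sub>0 nat"

text \<open>Polynomials in variables of type \<open>'v\<close> are finitely supported functions from monomials to
  coefficients; these form a commutative ring in Poly-Mapping.\<close>

definition pvar :: "'v \<Rightarrow> ('v \<Rightarrow>\<^sub>0 nat) \<Rightarrow>\<^sub>0 'k::field" where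
  "pvar v = Poly_Mapping.single (Poly_Mapping.single v 1) 1"

definition mono_eval :: "('v \<Rightarrow> 'r::comm_semiring_1) \<Rightarrow> ('v \<Rightarrow>\<^sub>0 nat) \<Rightarrow> 'r" where
  "mono_eval \<phi> \<mu> = (\<Prod>v\<in>Poly_Mapping.keys \<mu>. \<phi> v ^ Poly_Mapping.lookup \<mu> v)"

definition mono_deg :: "('v \<Rightarrow>\<^sub>0 nat) \<Rightarrow> nat" where
  "mono_deg \<mu> = (\<Sum>v\<in>Poly_Mapping.keys \<mu>. Poly_Mapping.lookup \<mu> v)"

text \<open>An element of \<open>S^*(X^#) \<otimes> Y\<close>, for \<open>X\<close> a coordinate space, is a finitely
  supported family of elements of \<open>Y\<close> indexed by the monomials in the coordinates of \<open>X\<close>.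
  Accordingly \<open>act T s s' \<mu>\<close> is the coefficient, at the monomial \<open>\<mu>\<close>, of the polynomial map
  \<open>Hom(k^a', k^a) \<times> Hom(k^b, k^b') \<rightarrow> Hom(T(k^a, k^b), T(k^a', k^b'))\<close>.\<close>

record ('k, 'a) bifun =
  val :: "obj \<Rightarrow> ('k, 'a) module"
  act :: "obj \<Rightarrow> obj \<Rightarrow> monomial \<Rightarrow> 'a \<Rightarrow> 'a"

definition act_supp :: "('k, 'a) bifun \<Rightarrow> obj \<Rightarrow> obj \<Rightarrow> monomial set" where
  "act_supp T s s' = {\<mu>. \<exists>x\<in>carrier (val T s). act T s s' \<mu> x \<noteq> \<zero>\<^bsub>val T s'\<^esub>}"

text \<open>The entries of the identity morphism, and the entries of the composite of a generic
  morphism \<open>f = (A, B)\<close> out of \<open>s\<close> into \<open>s'\<close> (variables \<open>Inl\<close>) with a generic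
  morphism \<open>g = (A', B')\<close> out of \<open>s'\<close> (variables \<open>Inr\<close>), which is
  \<open>(A A', B' B)\<close>.\<close>

fun id_entry :: "coord \<Rightarrow> 'k::field" where
  "id_entry (CV i j) = (if i = j then 1 else 0)"
| "id_entry (WV i j) = (if i = j then 1 else 0)"

fun comp_entry :: "obj \<Rightarrow> coord \<Rightarrow> ((coord + coord) \<Rightarrow>\<^sub>0 nat) \<Rightarrow>\<^sub>0 'k::field" where
  "comp_entry s' (CV i j) = (\<Sum>h<fst s'. pvar (Inl (CV i h)) * pvar (Inr (CV h j)))"
| "comp_entry s' (WV i j) = (\<Sum>h<snd s'. pvar (Inr (WV i h)) * pvar (Inl (WV h j)))"

text \<open>The last two conjuncts are \<open>T(id) = id\<close> and the polynomial identity
  \<open>T(g \<circ> f) = T(g) \<circ> T(f)\<close>, the latter compared at each monomial \<open>\<kappa>\<close> in the entries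
  of \<open>f\<close> and \<open>g\<close>.\<close>

definition strict_poly_bifun :: "('k::field, 'a) bifun \<Rightarrow> bool" where
  "strict_poly_bifun T \<longleftrightarrow>
     (\<forall>s. fd_vspace (val T s)) \<and>
     (\<forall>s s' \<mu>. linear_map (val T s) (val T s') (act T s s' \<mu>)) \<and>
     (\<forall>s s'. finite (act_supp T s s') \<and>
        (\<forall>\<mu>\<in>act_supp T s s'. Poly_Mapping.keys \<mu> \<subseteq> coords s s')) \<and>
     (\<forall>s. \<forall>x\<in>carrier (val T s).
        (\<Oplus>\<^bsub>val T s\<^esub>\<mu>\<in>act_supp T s s. mono_eval id_entry \<mu> \<odot>\<^bsub>val T s\<^esub> act T s s \<mu> x) = x) \<and>
     (\<forall>s s' s'' \<kappa>. \<forall>x\<in>carrier (val T s).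
        (\<Oplus>\<^bsub>val T s''\<^esub>\<nu>\<in>act_supp T s s''.
            Poly_Mapping.lookup (mono_eval (comp_entry s') \<nu>) \<kappa> \<odot>\<^bsub>val T s''\<^esub> act T s s'' \<nu> x) =
        act T s' s'' (Poly_Mapping.map_key Inr \<kappa>)
          (act T s s' (Poly_Mapping.map_key Inl \<kappa>) x))"

definition bounded_degree :: "('k, 'a) bifun \<Rightarrow> bool" where
  "bounded_degree T \<longleftrightarrow> (\<exists>D. \<forall>s s'. \<forall>\<mu>\<in>act_supp T s s'. mono_deg \<mu> \<le> D)"

definition PopP :: "('k::field, 'a) bifun \<Rightarrow> bool" where
  "PopP T \<longleftrightarrow> strict_poly_bifun T \<and> bounded_degree T"

text \<open>Natural transformations are made extensional so that equality of morphisms is equality of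
  functions.\<close>

definition nat_trans :: "('k, 'a) bifun \<Rightarrow> ('k, 'b) bifun \<Rightarrow> (obj \<Rightarrow> 'a \<Rightarrow> 'b) set" where
  "nat_trans T U = {\<eta>.
     (\<forall>s. \<eta> s \<in> extensional (carrier (val T s)) \<and> linear_map (val T s) (val U s) (\<eta> s)) \<and>
     (\<forall>s s' \<mu>. \<forall>x\<in>carrier (val T s). \<eta> s' (act T s s' \<mu> x) = act U s s' \<mu> (\<eta> s x))}"

definition nt_comp ::
    "('k, 'a) bifun \<Rightarrow> (obj \<Rightarrow> 'b \<Rightarrow> 'c) \<Rightarrow> (obj \<Rightarrow> 'a \<Rightarrow> 'b) \<Rightarrow> obj \<Rightarrow> 'a \<Rightarrow> 'c" where
  "nt_comp T \<psi> \<eta> = (\<lambda>s. compose (carrier (val T s)) (\<psi> s) (\<eta> s))"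

definition Hom_space :: "('k, 'a) bifun \<Rightarrow> ('k, 'b) bifun \<Rightarrow> ('k, obj \<Rightarrow> 'a \<Rightarrow> 'b) module" where
  "Hom_space T U = \<lparr>carrier = nat_trans T U, mult = undefined, one = undefined,
     zero = (\<lambda>s. \<lambda>x\<in>carrier (val T s). \<zero>\<^bsub>val U s\<^esub>),
     add = (\<lambda>\<eta> \<theta> s. \<lambda>x\<in>carrier (val T s). \<eta> s x \<oplus>\<^bsub>val U s\<^esub> \<theta> s x),
     smult = (\<lambda>c \<eta> s. \<lambda>x\<in>carrier (val T s). c \<odot>\<^bsub>val U s\<^esub> \<eta> s x)\<rparr>"


section \<open>Ext as derived functors of Hom\<close>

text \<open>Kernels, images and epimorphisms in the abelian category of strict polynomial bifunctors of
  bounded degree are computed objectwise. Every finite dimensional space is isomorphic to one whose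
  carrier consists of elements of \<open>nat \<Rightarrow> 'k\<close>, so every bifunctor is isomorphic to one with
  values of this type, and it is enough to test lifting against these.\<close>

definition projective_bifun :: "('k::field, 'a) bifun \<Rightarrow> bool" where
  "projective_bifun P \<longleftrightarrow> PopP P \<and>
     (\<forall>(B :: ('k, nat \<Rightarrow> 'k) bifun) (C :: ('k, nat \<Rightarrow> 'k) bifun).
        \<forall>\<pi>\<in>nat_trans B C. \<forall>g\<in>nat_trans P C.
          PopP B \<and> PopP C \<and> (\<forall>s. \<pi> s ` carrier (val B s) = carrier (val C s)) \<longrightarrow>
          (\<exists>h\<in>nat_trans P B. nt_comp P \<pi> h = g))"

definition projective_resolution ::
    "(nat \<Rightarrow> ('k::field, nat \<Rightarrow> 'k) bifun) \<Rightarrow> (nat \<Rightarrow> obj \<Rightarrow> (nat \<Rightarrow> 'k) \<Rightarrow> (nat \<Rightarrow> 'k)) \<Rightarrow>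
     ('k, 'a) bifun \<Rightarrow> bool" where
  "projective_resolution P d A \<longleftrightarrow>
     (\<forall>i. projective_bifun (P i)) \<and>
     (\<forall>i. d i \<in> nat_trans (P (Suc i)) (P i)) \<and>
     (\<forall>i s. ker (val (P (Suc i)) s) (val (P i) s) (d i s) =
              d (Suc i) s ` carrier (val (P (Suc (Suc i))) s)) \<and>
     (\<exists>\<epsilon>\<in>nat_trans (P 0) A. \<forall>s.
        \<epsilon> s ` carrier (val (P 0) s) = carrier (val A s) \<and>
        ker (val (P 0) s) (val A s) (\<epsilon> s) = d 0 s ` carrier (val (P (Suc 0)) s))"

definition cocycles :: "(nat \<Rightarrow> ('k, 'c) bifun) \<Rightarrow> (nat \<Rightarrow> obj \<Rightarrow> 'c \<Rightarrow> 'c) \<Rightarrow> ('k, 'b) bifun \<Rightarrow>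
    nat \<Rightarrow> (obj \<Rightarrow> 'c \<Rightarrow> 'b) set" where
  "cocycles P d B i = {\<eta> \<in> nat_trans (P i) B.
     nt_comp (P (Suc i)) \<eta> (d i) = \<zero>\<^bsub>Hom_space (P (Suc i)) B\<^esub>}"

fun coboundaries :: "(nat \<Rightarrow> ('k, 'c) bifun) \<Rightarrow> (nat \<Rightarrow> obj \<Rightarrow> 'c \<Rightarrow> 'c) \<Rightarrow> ('k, 'b) bifun \<Rightarrow>
    nat \<Rightarrow> (obj \<Rightarrow> 'c \<Rightarrow> 'b) set" where
  "coboundaries P d B 0 = {\<zero>\<^bsub>Hom_space (P 0) B\<^esub>}"
| "coboundaries P d B (Suc i) = (\<lambda>\<eta>. nt_comp (P (Suc i)) \<eta> (d i)) ` nat_trans (P i) B"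

definition cocycle_space :: "(nat \<Rightarrow> ('k, 'c) bifun) \<Rightarrow> (nat \<Rightarrow> obj \<Rightarrow> 'c \<Rightarrow> 'c) \<Rightarrow>
    ('k, 'b) bifun \<Rightarrow> nat \<Rightarrow> ('k, obj \<Rightarrow> 'c \<Rightarrow> 'b) module" where
  "cocycle_space P d B i = (Hom_space (P i) B)\<lparr>carrier := cocycles P d B i\<rparr>"

text \<open>\<open>Ext P d B i\<close> is \<open>Ext^i(A, B)\<close> for every \<open>A\<close> of which \<open>(P, d)\<close> is a projective
  resolution: the \<open>i\<close>-th cohomology of the complex \<open>Hom(P, B)\<close>.\<close>

definition Ext :: "(nat \<Rightarrow> ('k, 'c) bifun) \<Rightarrow> (nat \<Rightarrow> obj \<Rightarrow> 'c \<Rightarrow> 'c) \<Rightarrow>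
    ('k, 'b) bifun \<Rightarrow> nat \<Rightarrow> ('k, (obj \<Rightarrow> 'c \<Rightarrow> 'b) set) module" where
  "Ext P d B i = quot_space (cocycle_space P d B i) (coboundaries P d B i)"

text \<open>The map \<open>Ext^i(A, B) \<rightarrow> Ext^i(A, B')\<close> induced by a natural transformation
  \<open>\<phi> : B \<rightarrow> B'\<close>.\<close>

definition Ext_map :: "(nat \<Rightarrow> ('k, 'c) bifun) \<Rightarrow> (nat \<Rightarrow> obj \<Rightarrow> 'c \<Rightarrow> 'c) \<Rightarrow>
    ('k, 'b') bifun \<Rightarrow> nat \<Rightarrow> (obj \<Rightarrow> 'b \<Rightarrow> 'b') \<Rightarrow>
    (obj \<Rightarrow> 'c \<Rightarrow> 'b) set \<Rightarrow> (obj \<Rightarrow> 'c \<Rightarrow> 'b') set" where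
  "Ext_map P d B' i \<phi> =
     quot_map (cocycle_space P d B' i) (coboundaries P d B' i) (nt_comp (P i) \<phi>)"


section \<open>Modules over the group algebra of the symmetric group\<close>

text \<open>The symmetric group on \<open>n\<close> letters is realised on \<open>{0, ..., n - 1}\<close>. A (left or right)
  module over its group algebra is given by a vector space and the action of the permutations.\<close>

abbreviation perms :: "nat \<Rightarrow> (nat \<Rightarrow> nat) set" where
  "perms n \<equiv> {\<sigma>. \<sigma> permutes {..<n}}"

abbreviation pinv :: "(nat \<Rightarrow> nat) \<Rightarrow> nat \<Rightarrow> nat" where
  "pinv \<sigma> \<equiv> inv_into UNIV \<sigma>"

abbreviation group_algebra :: "nat \<Rightarrow> ('k::field, (nat \<Rightarrow> nat) \<Rightarrow> 'k) module" where
  "group_algebra n \<equiv> fun_space (perms n)"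

definition ga_elem :: "(nat \<Rightarrow> nat) \<Rightarrow> (nat \<Rightarrow> nat) \<Rightarrow> 'k::field" where
  "ga_elem \<sigma> = (\<lambda>\<pi>. if \<pi> = \<sigma> then 1 else 0)"

definition ga_mult :: "nat \<Rightarrow> ((nat \<Rightarrow> nat) \<Rightarrow> 'k::field) \<Rightarrow> ((nat \<Rightarrow> nat) \<Rightarrow> 'k) \<Rightarrow>
    (nat \<Rightarrow> nat) \<Rightarrow> 'k" where
  "ga_mult n x y = (\<lambda>\<pi>. if \<pi> \<in> perms n then \<Sum>\<sigma>\<in>perms n. x \<sigma> * y (pinv \<sigma> \<circ> \<pi>) else 0)"

text \<open>The subspace of relations presenting \<open>M \<otimes> W\<close> (over the group algebra of the symmetric
  group) as a quotient of the free vector space on \<open>M \<times> W\<close>. Here \<open>\<rho> \<sigma>\<close> is the right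
  action of \<open>\<sigma>\<close> on \<open>M\<close> and \<open>\<tau> \<sigma>\<close> is its left action on \<open>W\<close>.\<close>

definition tensor_rel :: "nat \<Rightarrow> ('k::field, 'm) module \<Rightarrow> ((nat \<Rightarrow> nat) \<Rightarrow> 'm \<Rightarrow> 'm) \<Rightarrow>
    ('k, 'w) module \<Rightarrow> ((nat \<Rightarrow> nat) \<Rightarrow> 'w \<Rightarrow> 'w) \<Rightarrow> (('m \<times> 'w) \<Rightarrow>\<^sub>0 'k) set" where
  "tensor_rel n M \<rho> W \<tau> =
    (let e = (\<lambda>m w. Poly_Mapping.single (m, w) (1::'k)) in
     gen_subspace (free_space (carrier M \<times> carrier W))
      ({e (m \<oplus>\<^bsub>M\<^esub> m') w - e m w - e m' w | m m' w.
          m \<in> carrier M \<and> m' \<in> carrier M \<and> w \<in> carrier W} \<union>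
       {e m (w \<oplus>\<^bsub>W\<^esub> w') - e m w - e m w' | m w w'.
          m \<in> carrier M \<and> w \<in> carrier W \<and> w' \<in> carrier W} \<union>
       {e (c \<odot>\<^bsub>M\<^esub> m) w - Poly_Mapping.single (m, w) c | c m w.
          m \<in> carrier M \<and> w \<in> carrier W} \<union>
       {e m (c \<odot>\<^bsub>W\<^esub> w) - Poly_Mapping.single (m, w) c | c m w.
          m \<in> carrier M \<and> w \<in> carrier W} \<union>
       {e (\<rho> \<sigma> m) w - e m (\<tau> \<sigma> w) | \<sigma> m w.
          \<sigma> \<in> perms n \<and> m \<in> carrier M \<and> w \<in> carrier W}))"

definition tensor_kS :: "nat \<Rightarrow> ('k::field, 'm) module \<Rightarrow> ((nat \<Rightarrow> nat) \<Rightarrow> 'm \<Rightarrow> 'm) \<Rightarrow>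
    ('k, 'w) module \<Rightarrow> ((nat \<Rightarrow> nat) \<Rightarrow> 'w \<Rightarrow> 'w) \<Rightarrow> ('k, (('m \<times> 'w) \<Rightarrow>\<^sub>0 'k) set) module" where
  "tensor_kS n M \<rho> W \<tau> =
     quot_space (free_space (carrier M \<times> carrier W)) (tensor_rel n M \<rho> W \<tau>)"

definition free_map :: "('w \<Rightarrow> 'w') \<Rightarrow> (('m \<times> 'w) \<Rightarrow>\<^sub>0 'k::field) \<Rightarrow> (('m \<times> 'w') \<Rightarrow>\<^sub>0 'k)" where
  "free_map h x = (\<Sum>k\<in>Poly_Mapping.keys x.
     Poly_Mapping.single (fst k, h (snd k)) (Poly_Mapping.lookup x k))"

text \<open>The bifunctor \<open>M \<otimes> T\<close>, for a bifunctor \<open>T\<close> on whose values the symmetric group acts by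
  \<open>\<tau>\<close>.\<close>

definition tensor_kS_bifun :: "nat \<Rightarrow> ('k::field, 'm) module \<Rightarrow> ((nat \<Rightarrow> nat) \<Rightarrow> 'm \<Rightarrow> 'm) \<Rightarrow>
    ('k, 'w) bifun \<Rightarrow> ((nat \<Rightarrow> nat) \<Rightarrow> 'w \<Rightarrow> 'w) \<Rightarrow> ('k, (('m \<times> 'w) \<Rightarrow>\<^sub>0 'k) set) bifun" where
  "tensor_kS_bifun n M \<rho> T \<tau> = \<lparr>
     val = (\<lambda>s. tensor_kS n M \<rho> (val T s) \<tau>),
     act = (\<lambda>s s' \<mu>. quot_map (free_space (carrier M \<times> carrier (val T s')))
              (tensor_rel n M \<rho> (val T s') \<tau>) (free_map (act T s s' \<mu>)))\<rparr>"


section \<open>Young symmetrizers and the functors \<open>s^\<lambda>\<close>\<close>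

definition is_partition :: "nat list \<Rightarrow> nat \<Rightarrow> bool" where
  "is_partition lam n \<longleftrightarrow> sorted_wrt (\<ge>) lam \<and> (\<forall>x\<in>set lam. 0 < x) \<and> sum_list lam = n"

definition cells :: "nat list \<Rightarrow> (nat \<times> nat) set" where
  "cells lam = {(i, j). i < length lam \<and> j < lam ! i}"

definition young_tableau :: "nat list \<Rightarrow> (nat \<times> nat \<Rightarrow> nat) \<Rightarrow> bool" where
  "young_tableau lam t \<longleftrightarrow> bij_betw t (cells lam) {..<sum_list lam}"

definition row_perms :: "nat list \<Rightarrow> (nat \<times> nat \<Rightarrow> nat) \<Rightarrow> (nat \<Rightarrow> nat) set" where
  "row_perms lam t = {\<sigma> \<in> perms (sum_list lam).
     \<forall>i. \<sigma> ` t ` {c \<in> cells lam. fst c = i} = t ` {c \<in> cells lam. fst c = i}}"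

definition col_perms :: "nat list \<Rightarrow> (nat \<times> nat \<Rightarrow> nat) \<Rightarrow> (nat \<Rightarrow> nat) set" where
  "col_perms lam t = {\<sigma> \<in> perms (sum_list lam).
     \<forall>j. \<sigma> ` t ` {c \<in> cells lam. snd c = j} = t ` {c \<in> cells lam. snd c = j}}"

definition young_a :: "nat list \<Rightarrow> (nat \<times> nat \<Rightarrow> nat) \<Rightarrow> (nat \<Rightarrow> nat) \<Rightarrow> 'k::field" where
  "young_a lam t = (\<lambda>\<sigma>. if \<sigma> \<in> row_perms lam t then 1 else 0)"

definition young_b :: "nat list \<Rightarrow> (nat \<times> nat \<Rightarrow> nat) \<Rightarrow> (nat \<Rightarrow> nat) \<Rightarrow> 'k::field" where
  "young_b lam t = (\<lambda>\<sigma>. if \<sigma> \<in> col_perms lam t then of_int (sign \<sigma>) else 0)"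

definition young_c :: "nat list \<Rightarrow> (nat \<times> nat \<Rightarrow> nat) \<Rightarrow> (nat \<Rightarrow> nat) \<Rightarrow> 'k::field" where
  "young_c lam t = ga_mult (sum_list lam) (young_a lam t) (young_b lam t)"

definition young_ideal ::
    "nat list \<Rightarrow> (nat \<times> nat \<Rightarrow> nat) \<Rightarrow> ('k::field, (nat \<Rightarrow> nat) \<Rightarrow> 'k) module" where
  "young_ideal lam t = (group_algebra (sum_list lam))\<lparr>carrier :=
     (\<lambda>x. ga_mult (sum_list lam) x (young_c lam t)) ` carrier (group_algebra (sum_list lam))\<rparr>"

definition young_ract :: "nat list \<Rightarrow> (nat \<Rightarrow> nat) \<Rightarrow>
    ((nat \<Rightarrow> nat) \<Rightarrow> 'k::field) \<Rightarrow> ((nat \<Rightarrow> nat) \<Rightarrow> 'k)" where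
  "young_ract lam \<sigma> x = ga_mult (sum_list lam) (ga_elem (pinv \<sigma>)) x"

definition s_mod :: "nat list \<Rightarrow> (nat \<times> nat \<Rightarrow> nat) \<Rightarrow> ('k::field, 'w) module \<Rightarrow>
    ((nat \<Rightarrow> nat) \<Rightarrow> 'w \<Rightarrow> 'w) \<Rightarrow> ('k, ((((nat \<Rightarrow> nat) \<Rightarrow> 'k) \<times> 'w) \<Rightarrow>\<^sub>0 'k) set) module" where
  "s_mod lam t W \<tau> = tensor_kS (sum_list lam) (young_ideal lam t) (young_ract lam) W \<tau>"

definition s_bifun :: "nat list \<Rightarrow> (nat \<times> nat \<Rightarrow> nat) \<Rightarrow> ('k::field, 'w) bifun \<Rightarrow>
    ((nat \<Rightarrow> nat) \<Rightarrow> 'w \<Rightarrow> 'w) \<Rightarrow> ('k, ((((nat \<Rightarrow> nat) \<Rightarrow> 'k) \<times> 'w) \<Rightarrow>\<^sub>0 'k) set) bifun" where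
  "s_bifun lam t T \<tau> = tensor_kS_bifun (sum_list lam) (young_ideal lam t) (young_ract lam) T \<tau>"

definition triv_ract :: "(nat \<Rightarrow> nat) \<Rightarrow> 'k::field \<Rightarrow> 'k" where
  "triv_ract \<sigma> x = x"

definition sgn_ract :: "(nat \<Rightarrow> nat) \<Rightarrow> 'k::field \<Rightarrow> 'k" where
  "sgn_ract \<sigma> x = of_int (sign \<sigma>) * x"


section \<open>Functors of \<open>gl\<close>\<close>

text \<open>At \<open>(a, b)\<close> the bifunctor \<open>gl\<close> has value \<open>Hom(k^a, k^b)\<close>, with coordinates \<open>(i, j)\<close> for
  \<open>i < b\<close> and \<open>j < a\<close>. The \<open>n\<close>-th tensor power of this space has coordinates indexed by
  the \<open>n\<close>-tuples of such pairs.\<close>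

definition tens_idx :: "nat \<Rightarrow> obj \<Rightarrow> (nat \<Rightarrow> nat \<times> nat) set" where
  "tens_idx n s = {..<n} \<rightarrow>\<^sub>E ({..<snd s} \<times> {..<fst s})"

type_synonym 'k tens = "(nat \<Rightarrow> nat \<times> nat) \<Rightarrow> 'k"

text \<open>The morphism \<open>(A, B)\<close> acts on \<open>gl\<close> by \<open>X \<mapsto> B X A\<close>, so the matrix of this linear map has
  entry \<open>B_ik A_lj\<close> at \<open>((i, j), (k, l))\<close>; the Frobenius twist raises the matrix entries to the
  power \<open>q = p^r\<close>.\<close>

fun gl_entry :: "nat \<Rightarrow> nat \<times> nat \<Rightarrow> nat \<times> nat \<Rightarrow> monomial \<Rightarrow>\<^sub>0 'k::field" where
  "gl_entry q (i, j) (k, l) = (pvar (WV i k) * pvar (CV l j)) ^ q"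

text \<open>The bifunctor \<open>(gl^(r))^{\<otimes> n}\<close> with \<open>q = p^r\<close>. The power \<open>q\<close> defines a bifunctor only
  for \<open>q = p^r\<close>, \<open>p\<close> being the characteristic.\<close>

definition gl_tensor :: "nat \<Rightarrow> nat \<Rightarrow> ('k::field, 'k tens) bifun" where
  "gl_tensor q n = \<lparr>
     val = (\<lambda>s. fun_space (tens_idx n s)),
     act = (\<lambda>s s' \<mu> f I. if I \<in> tens_idx n s'
        then \<Sum>K\<in>tens_idx n s. Poly_Mapping.lookup (\<Prod>t<n. gl_entry q (I t) (K t)) \<mu> * f K
        else 0)\<rparr>"

text \<open>The left action moving the tensor factor at position \<open>i\<close> to position \<open>\<sigma> i\<close>.\<close>

definition perm_tens :: "(nat \<Rightarrow> nat) \<Rightarrow> 'k tens \<Rightarrow> 'k tens" where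
  "perm_tens \<sigma> f = (\<lambda>I. f (I \<circ> \<sigma>))"

definition Gamma_gl :: "nat \<Rightarrow> ('k::field, 'k tens) bifun" where
  "Gamma_gl m = \<lparr>
     val = (\<lambda>s. (val (gl_tensor 1 m) s)\<lparr>carrier :=
        {f \<in> carrier (val (gl_tensor 1 m) s). \<forall>\<sigma>\<in>perms m. perm_tens \<sigma> f = f}\<rparr>),
     act = act (gl_tensor 1 m)\<rparr>"

definition quot_bifun :: "('k, 'a) bifun \<Rightarrow> (obj \<Rightarrow> 'a set) \<Rightarrow> ('k, 'a set) bifun" where
  "quot_bifun T N = \<lparr>
     val = (\<lambda>s. quot_space (val T s) (N s)),
     act = (\<lambda>s s' \<mu>. quot_map (val T s') (N s') (act T s s' \<mu>))\<rparr>"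

definition pure_tensor :: "nat \<Rightarrow> obj \<Rightarrow> (nat \<Rightarrow> nat \<times> nat \<Rightarrow> 'k::field) \<Rightarrow> 'k tens" where
  "pure_tensor n s v = (\<lambda>I. if I \<in> tens_idx n s then \<Prod>t<n. v t (I t) else 0)"

text \<open>\<open>S^n(V)\<close> and \<open>\<Lambda>^n(V)\<close> are the usual quotients of the \<open>n\<close>-th tensor power, applied to
  \<open>V = gl^(r)\<close>.\<close>

definition Sym_gl :: "nat \<Rightarrow> nat \<Rightarrow> ('k::field, 'k tens set) bifun" where
  "Sym_gl q n = quot_bifun (gl_tensor q n) (\<lambda>s. gen_subspace (val (gl_tensor q n) s)
     {\<lambda>I. pure_tensor n s (v \<circ> \<sigma>) I - pure_tensor n s v I | v \<sigma>. \<sigma> \<in> perms n})"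

definition Lambda_gl :: "nat \<Rightarrow> nat \<Rightarrow> ('k::field, 'k tens set) bifun" where
  "Lambda_gl q n = quot_bifun (gl_tensor q n) (\<lambda>s. gen_subspace (val (gl_tensor q n) s)
     {pure_tensor n s v | v. \<exists>i j. i < j \<and> j < n \<and>
        (\<forall>x\<in>{..<snd s} \<times> {..<fst s}. v i x = v j x)})"

text \<open>The action of the symmetric group on \<open>Ext^i(A, (gl^(r))^{\<otimes> n})\<close>.\<close>

definition Ext_perm :: "(nat \<Rightarrow> ('k::field, 'c) bifun) \<Rightarrow> (nat \<Rightarrow> obj \<Rightarrow> 'c \<Rightarrow> 'c) \<Rightarrow>
    nat \<Rightarrow> nat \<Rightarrow> nat \<Rightarrow> (nat \<Rightarrow> nat) \<Rightarrow>
    (obj \<Rightarrow> 'c \<Rightarrow> 'k tens) set \<Rightarrow> (obj \<Rightarrow> 'c \<Rightarrow> 'k tens) set" where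
  "Ext_perm P d q n i \<sigma> = Ext_map P d (gl_tensor q n) i
     (\<lambda>s. restrict (perm_tens \<sigma>) (carrier (val (gl_tensor q n) s)))"

end

theory Submission
  imports Defs "HOL-Library.Function_Algebras"
begin

text \<open>Since \<open>p > n\<close>, the order of the symmetric group is invertible in \<open>k\<close>, so by Maschke's
  theorem the right modules \<open>M\<close> in question (Young ideals, the trivial and the sign module) are
  cyclic and projective: \<open>M\<close> is the right ideal generated by an idempotent \<open>\<epsilon>\<close> of the group
  algebra. Tensoring with \<open>M\<close> therefore amounts to taking the image of \<open>\<epsilon>\<close>, naturally in the
  left module. In particular the bifunctor \<open>M \<otimes> T\<close> is a retract of \<open>T\<close> with idempotent
  \<open>\<epsilon>\<close>, and any additive functor, such as Ext, carries it to the image of \<open>\<epsilon>\<close> on the value at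
  \<open>T\<close>. The quotients \<open>S^n\<close> and \<open>\<Lambda>^n\<close> are retracts of the tensor power with the
  idempotents belonging to the trivial and the sign character.\<close>

section \<open>Linear algebra over the field of scalars\<close>

text \<open>Both sides of each isomorphism are compared with one subspace of the Ext of the tensor
  power, the image of an element \<open>x\<close> of the group algebra; no direct map from one side
  to the other is built. What has to be matched is therefore a family of coefficients: modules whose
  sections agree at their generators have isomorphic tensor products. For general \<lambda> the
  scalar that makes the Young symmetrizer idempotent is not computed. Averaging a projection yields
  some \<open>e\<close> in the left ideal that is a right unit on it, and this is enough because the
  same \<open>e\<close> acts on both sides. For one row and one column the element must be known
  explicitly, since it is compared with the projections that define symmetric and exterior powers;
  there it is the symmetrizer times \<open>c\<close>, the inverse of n!. The inversion that turns
  the left ideal into a right module returns as \<open>x (pinv \<sigma>)\<close> in the section. On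
  the functor side, idempotency is carried by the two retract equations: \<pi> after \<iota> is the
  identity, and \<iota> after \<pi> is the action of \<open>x\<close>.\<close>

lemma scalars_simps [simp]:
  "carrier scalars = UNIV" "a \<otimes>\<^bsub>scalars\<^esub> b = a * b" "\<one>\<^bsub>scalars\<^esub> = 1"
  "\<zero>\<^bsub>scalars\<^esub> = 0" "a \<oplus>\<^bsub>scalars\<^esub> b = a + b"
  by (simp_all add: scalars_def)

lemma cring_scalars: "cring (scalars :: 'k::field ring)"
proof (intro cringI abelian_groupI comm_monoidI)
  fix x :: 'k
  show "\<exists>y\<in>carrier scalars. y \<oplus>\<^bsub>scalars\<^esub> x = \<zero>\<^bsub>scalars\<^esub>"
    by (auto intro: exI[of _ "- x"])
qed (auto simp: algebra_simps)

text \<open>The scalar multiple by -1 serves as the additive inverse, so instances need no existence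
  proof for negatives.\<close>

lemma vspaceI:
  fixes M :: "('k::field, 'a) module"
  assumes "\<And>x y. x \<in> carrier M \<Longrightarrow> y \<in> carrier M \<Longrightarrow> x \<oplus>\<^bsub>M\<^esub> y \<in> carrier M"
    and "\<zero>\<^bsub>M\<^esub> \<in> carrier M"
    and smult: "\<And>a x. x \<in> carrier M \<Longrightarrow> a \<odot>\<^bsub>M\<^esub> x \<in> carrier M"
    and "\<And>x y z. x \<in> carrier M \<Longrightarrow> y \<in> carrier M \<Longrightarrow> z \<in> carrier M \<Longrightarrow>
      (x \<oplus>\<^bsub>M\<^esub> y) \<oplus>\<^bsub>M\<^esub> z = x \<oplus>\<^bsub>M\<^esub> (y \<oplus>\<^bsub>M\<^esub> z)"
    and "\<And>x y. x \<in> carrier M \<Longrightarrow> y \<in> carrier M \<Longrightarrow> x \<oplus>\<^bsub>M\<^esub> y = y \<oplus>\<^bsub>M\<^esub> x"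
    and "\<And>x. x \<in> carrier M \<Longrightarrow> \<zero>\<^bsub>M\<^esub> \<oplus>\<^bsub>M\<^esub> x = x"
    and inv: "\<And>x. x \<in> carrier M \<Longrightarrow> ((-1) \<odot>\<^bsub>M\<^esub> x) \<oplus>\<^bsub>M\<^esub> x = \<zero>\<^bsub>M\<^esub>"
    and "\<And>a b x. x \<in> carrier M \<Longrightarrow> (a + b) \<odot>\<^bsub>M\<^esub> x = a \<odot>\<^bsub>M\<^esub> x \<oplus>\<^bsub>M\<^esub> b \<odot>\<^bsub>M\<^esub> x"
    and "\<And>a x y. x \<in> carrier M \<Longrightarrow> y \<in> carrier M \<Longrightarrow>
      a \<odot>\<^bsub>M\<^esub> (x \<oplus>\<^bsub>M\<^esub> y) = a \<odot>\<^bsub>M\<^esub> x \<oplus>\<^bsub>M\<^esub> a \<odot>\<^bsub>M\<^esub> y"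
    and "\<And>a b x. x \<in> carrier M \<Longrightarrow> (a * b) \<odot>\<^bsub>M\<^esub> x = a \<odot>\<^bsub>M\<^esub> (b \<odot>\<^bsub>M\<^esub> x)"
    and "\<And>x. x \<in> carrier M \<Longrightarrow> 1 \<odot>\<^bsub>M\<^esub> x = x"
  shows "vspace M"
proof (intro moduleI cring_scalars abelian_groupI)
  fix x assume "x \<in> carrier M"
  then show "\<exists>y\<in>carrier M. y \<oplus>\<^bsub>M\<^esub> x = \<zero>\<^bsub>M\<^esub>"
    using inv smult by blast
qed (use assms in auto)

lemma linear_mapI:
  assumes "\<And>x. x \<in> carrier M \<Longrightarrow> f x \<in> carrier N"
    and "\<And>x y. x \<in> carrier M \<Longrightarrow> y \<in> carrier M \<Longrightarrow> f (x \<oplus>\<^bsub>M\<^esub> y) = f x \<oplus>\<^bsub>N\<^esub> f y"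
    and "\<And>c x. x \<in> carrier M \<Longrightarrow> f (c \<odot>\<^bsub>M\<^esub> x) = c \<odot>\<^bsub>N\<^esub> f x"
  shows "linear_map M N f"
  using assms unfolding linear_map_def by auto

lemma linear_map_closed: "linear_map M N f \<Longrightarrow> x \<in> carrier M \<Longrightarrow> f x \<in> carrier N"
  and linear_map_add: "linear_map M N f \<Longrightarrow> x \<in> carrier M \<Longrightarrow> y \<in> carrier M \<Longrightarrow>
    f (x \<oplus>\<^bsub>M\<^esub> y) = f x \<oplus>\<^bsub>N\<^esub> f y"
  and linear_map_smult: "linear_map M N f \<Longrightarrow> x \<in> carrier M \<Longrightarrow> f (c \<odot>\<^bsub>M\<^esub> x) = c \<odot>\<^bsub>N\<^esub> f x"
  unfolding linear_map_def by auto

lemma linear_map_cong: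
  assumes "linear_map M N f" "vspace M" "\<And>x. x \<in> carrier M \<Longrightarrow> g x = f x"
  shows "linear_map M N g"
proof -
  interpret M: module scalars M by fact
  show ?thesis using assms(1,3) by (auto simp: linear_map_def)
qed

lemma linear_map_comp:
  "linear_map M N f \<Longrightarrow> linear_map N L g \<Longrightarrow> linear_map M L (\<lambda>x. g (f x))"
  unfolding linear_map_def by (auto simp: Pi_iff)

lemma vspace_smult_zero: "vspace M \<Longrightarrow> x \<in> carrier M \<Longrightarrow> 0 \<odot>\<^bsub>M\<^esub> x = \<zero>\<^bsub>M\<^esub>"
  using module.smult_l_null[of scalars M x] by simp

lemma vspace_smult_minus: "vspace M \<Longrightarrow> x \<in> carrier M \<Longrightarrow> (-1) \<odot>\<^bsub>M\<^esub> x = \<ominus>\<^bsub>M\<^esub> x"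
proof -
  assume a: "vspace M" "x \<in> carrier M"
  interpret M: module scalars M by fact
  have "((-1) \<odot>\<^bsub>M\<^esub> x) \<oplus>\<^bsub>M\<^esub> x = ((-1) + 1) \<odot>\<^bsub>M\<^esub> x"
    using a M.smult_l_distr[of "-1" 1 x] M.smult_one[of x] by simp
  also have "\<dots> = \<zero>\<^bsub>M\<^esub>" using a by (simp add: vspace_smult_zero)
  finally show ?thesis using a M.M.minus_equality M.smult_closed[of "-1" x] by simp
qed

lemma vspace_diff_add: "vspace M \<Longrightarrow> x \<in> carrier M \<Longrightarrow> y \<in> carrier M \<Longrightarrow> (x \<ominus>\<^bsub>M\<^esub> y) \<oplus>\<^bsub>M\<^esub> y = x"
proof -
  assume a: "vspace M" "x \<in> carrier M" "y \<in> carrier M"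
  interpret M: module scalars M by fact
  show ?thesis using a by (simp add: a_minus_def M.M.a_assoc M.M.l_neg)
qed

lemma vspace_diff_zero:
  assumes "vspace M" "x \<in> carrier M" "y \<in> carrier M" "x \<ominus>\<^bsub>M\<^esub> y = \<zero>\<^bsub>M\<^esub>"
  shows "x = y"
proof -
  interpret M: module scalars M by fact
  show ?thesis using vspace_diff_add[OF assms(1-3)] assms(3,4) by simp
qed

lemma linear_map_zero:
  assumes "linear_map M N f" "vspace M" "vspace N"
  shows "f \<zero>\<^bsub>M\<^esub> = \<zero>\<^bsub>N\<^esub>"
proof -
  interpret M: module scalars M by fact
  show ?thesis
    using linear_map_smult[OF assms(1) M.M.zero_closed, of 0] linear_map_closed[OF assms(1) M.M.zero_closed]
    by (simp add: vspace_smult_zero assms)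
qed

lemma linear_map_finsum:
  assumes "linear_map M N f" "vspace M" "vspace N" "finite A" "\<And>a. a \<in> A \<Longrightarrow> g a \<in> carrier M"
  shows "f (\<Oplus>\<^bsub>M\<^esub>a\<in>A. g a) = (\<Oplus>\<^bsub>N\<^esub>a\<in>A. f (g a))"
proof -
  interpret M: module scalars M by fact
  interpret N: module scalars N by fact
  show ?thesis using assms(4,5)
  proof (induction A rule: finite_induct)
    case empty
    then show ?case by (simp add: linear_map_zero[OF assms(1-3)])
  next
    case (insert a A)
    then show ?case
      by (simp add: Pi_iff linear_map_add[OF assms(1)] linear_map_closed[OF assms(1)])
  qed
qed

lemma linear_map_minus:
  assumes "linear_map M N f" "vspace M" "vspace N" "x \<in> carrier M" "y \<in> carrier M"
  shows "f (x \<ominus>\<^bsub>M\<^esub> y) = f x \<ominus>\<^bsub>N\<^esub> f y"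
proof -
  interpret M: module scalars M by fact
  interpret N: module scalars N by fact
  have "f (\<ominus>\<^bsub>M\<^esub> y) = \<ominus>\<^bsub>N\<^esub> f y"
    using linear_map_smult[OF assms(1,5), of "-1"] vspace_smult_minus assms linear_map_closed[OF assms(1,5)]
    by metis
  then show ?thesis
    using assms by (simp add: a_minus_def linear_map_add[OF assms(1)])
qed


subsection \<open>Isomorphisms\<close>

text \<open>Closure of \<open>M\<close> under its operations puts the sum or multiple of preimages
  back into the carrier, where \<open>inv_into\<close> inverts \<open>f\<close>; this is what
  \<open>vspace M\<close> supplies.\<close>

lemma vs_iso_sym:
  assumes "M \<cong>\<^sub>k N" "vspace M" shows "N \<cong>\<^sub>k M"
proof -
  interpret M: module scalars M by fact
  obtain f where f: "linear_map M N f" "bij_betw f (carrier M) (carrier N)"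
    using assms(1) unfolding vs_iso_def by blast
  let ?g = "inv_into (carrier M) f"
  have bij: "bij_betw ?g (carrier N) (carrier M)" by (rule bij_betw_inv_into[OF f(2)])
  have gf: "\<And>x. x \<in> carrier M \<Longrightarrow> ?g (f x) = x" using f(2) by (rule bij_betw_inv_into_left)
  have fg: "\<And>x. x \<in> carrier N \<Longrightarrow> f (?g x) = x" using f(2) by (rule bij_betw_inv_into_right)
  have g: "\<And>x. x \<in> carrier N \<Longrightarrow> ?g x \<in> carrier M" using bij by (auto simp: bij_betw_def)
  have "linear_map N M ?g"
  proof (rule linear_mapI)
    fix x y assume xy: "x \<in> carrier N" "y \<in> carrier N"
    have "f (?g x \<oplus>\<^bsub>M\<^esub> ?g y) = x \<oplus>\<^bsub>N\<^esub> y"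
      using xy by (simp add: linear_map_add[OF f(1)] g fg)
    then show "?g (x \<oplus>\<^bsub>N\<^esub> y) = ?g x \<oplus>\<^bsub>M\<^esub> ?g y"
      using gf[of "?g x \<oplus>\<^bsub>M\<^esub> ?g y"] g xy by simp
  next
    fix c x assume x: "x \<in> carrier N"
    have "f (c \<odot>\<^bsub>M\<^esub> ?g x) = c \<odot>\<^bsub>N\<^esub> x"
      using x by (simp add: linear_map_smult[OF f(1)] g fg)
    then show "?g (c \<odot>\<^bsub>N\<^esub> x) = c \<odot>\<^bsub>M\<^esub> ?g x"
      using gf[of "c \<odot>\<^bsub>M\<^esub> ?g x"] g x by simp
  qed (use g in auto)
  then show ?thesis using bij unfolding vs_iso_def by blast
qed

lemma vs_iso_trans: "L \<cong>\<^sub>k M \<Longrightarrow> M \<cong>\<^sub>k N \<Longrightarrow> L \<cong>\<^sub>k N"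
  unfolding vs_iso_def by (meson linear_map_comp bij_betw_trans[unfolded comp_def])

lemma vs_iso_image:
  assumes "linear_map U W f" and "\<And>w. w \<in> carrier W \<Longrightarrow> g w \<in> carrier U"
    and gf: "\<And>u. u \<in> carrier U \<Longrightarrow> g (f u) = u"
    and fg: "\<And>w. w \<in> carrier W \<Longrightarrow> f (g w) = E w"
  shows "U \<cong>\<^sub>k W\<lparr>carrier := E ` carrier W\<rparr>"
proof -
  have f: "f u \<in> carrier W" if "u \<in> carrier U" for u
    using that linear_map_closed[OF assms(1)] by blast
  have "f u = E (f u)" if "u \<in> carrier U" for u
    using that gf fg[OF f[OF that]] by simp
  then have im: "f ` carrier U = E ` carrier W"
    using fg assms(2) f by (smt (verit, ccfv_SIG) image_iff subsetI subset_antisym)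
  then have "linear_map U (W\<lparr>carrier := E ` carrier W\<rparr>) f"
    using assms(1) by (auto simp: linear_map_def)
  moreover have "inj_on f (carrier U)" using gf by (metis inj_onI)
  ultimately show ?thesis using im unfolding vs_iso_def bij_betw_def by auto
qed


subsection \<open>Subspaces and quotients\<close>

lemma submodule_carrier: "submodule N scalars M \<Longrightarrow> x \<in> N \<Longrightarrow> x \<in> carrier M"
  using subgroup.subset[OF submodule.axioms(1)] by fastforce

lemma submodule_zero: "submodule N scalars M \<Longrightarrow> \<zero>\<^bsub>M\<^esub> \<in> N"
  using subgroup.one_closed[OF submodule.axioms(1)] by fastforce

lemma submodule_smult: "submodule N scalars M \<Longrightarrow> x \<in> N \<Longrightarrow> c \<odot>\<^bsub>M\<^esub> x \<in> N"
  by (simp add: submodule.smult_closed)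

lemma submodule_add: "submodule N scalars M \<Longrightarrow> x \<in> N \<Longrightarrow> y \<in> N \<Longrightarrow> x \<oplus>\<^bsub>M\<^esub> y \<in> N"
  using subgroup.m_closed[OF submodule.axioms(1)] by fastforce

lemma vspace_submoduleI:
  assumes "vspace M" and sub: "N \<subseteq> carrier M" and "\<zero>\<^bsub>M\<^esub> \<in> N"
    and "\<And>a b. a \<in> N \<Longrightarrow> b \<in> N \<Longrightarrow> a \<oplus>\<^bsub>M\<^esub> b \<in> N"
    and sm: "\<And>c a. a \<in> N \<Longrightarrow> c \<odot>\<^bsub>M\<^esub> a \<in> N"
  shows "submodule N scalars M"
proof (rule module.submoduleI[OF assms(1)])
  fix a assume "a \<in> N"
  then show "\<ominus>\<^bsub>M\<^esub> a \<in> N"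
    using vspace_smult_minus[OF assms(1)] sm[of a "-1"] sub by (metis subsetD)
qed (use assms in auto)

lemma submodule_preimage:
  assumes "vspace M" "vspace M'" "linear_map M M' f" "submodule N' scalars M'"
  shows "submodule {x \<in> carrier M. f x \<in> N'} scalars M"
proof -
  interpret M: module scalars M by fact
  show ?thesis
    by (rule vspace_submoduleI[OF assms(1)])
      (auto simp: linear_map_zero[OF assms(3,1,2)] submodule_zero[OF assms(4)]
        linear_map_add[OF assms(3)] linear_map_smult[OF assms(3)] submodule_add[OF assms(4)]
        submodule_smult[OF assms(4)])
qed

lemma submodule_image:
  assumes "vspace M" "vspace M'" "linear_map M M' f"
  shows "submodule (f ` carrier M) scalars M'"
proof -
  interpret M: module scalars M by fact
  have "f \<zero>\<^bsub>M\<^esub> \<in> f ` carrier M" by blast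
  then show ?thesis
    by (intro vspace_submoduleI[OF assms(2)])
      (auto simp: linear_map_zero[OF assms(3,1,2)] linear_map_closed[OF assms(3)]
        simp flip: linear_map_add[OF assms(3)] linear_map_smult[OF assms(3)])
qed

lemma submodule_null: "vspace M \<Longrightarrow> submodule {\<zero>\<^bsub>M\<^esub>} scalars M"
proof -
  assume a: "vspace M"
  interpret M: module scalars M by fact
  show ?thesis
    using M.smult_r_null by (intro vspace_submoduleI[OF a]) auto
qed

lemma vspace_submodule: "vspace M \<Longrightarrow> submodule N scalars M \<Longrightarrow> vspace (M\<lparr>carrier := N\<rparr>)"
  by (rule submodule.submodule_is_module)

lemma submodule_restrict_carrier:
  assumes "vspace M" "submodule Z scalars M" "submodule N scalars M" "N \<subseteq> Z"
  shows "submodule N scalars (M\<lparr>carrier := Z\<rparr>)"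
  by (rule vspace_submoduleI[OF vspace_submodule[OF assms(1,2)]])
    (use assms(4) in \<open>auto simp: submodule_zero[OF assms(3)] submodule_add[OF assms(3)]
      submodule_smult[OF assms(3)]\<close>)

lemma gen_subspace_least: "submodule N scalars M \<Longrightarrow> S \<subseteq> N \<Longrightarrow> gen_subspace M S \<subseteq> N"
  unfolding gen_subspace_def by blast

lemma gen_subspace_incl: "x \<in> S \<Longrightarrow> x \<in> gen_subspace M S"
  unfolding gen_subspace_def by blast

lemma submodule_gen_subspace:
  assumes "vspace M" "S \<subseteq> carrier M"
  shows "submodule (gen_subspace M S) scalars M"
proof -
  interpret M: module scalars M by fact
  have "gen_subspace M S \<subseteq> carrier M"
    using M.carrier_is_submodule assms(2) by (rule gen_subspace_least)
  then show ?thesis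
    by (intro vspace_submoduleI[OF assms(1)])
      (auto simp: gen_subspace_def submodule_zero submodule_add submodule_smult)
qed

text \<open>The preimage of \<open>N'\<close> is a subspace, so it contains the span as soon as it
  contains \<open>S\<close>. This reduces all statements about relation spaces to their
  generators.\<close>

lemma linear_map_gen_subspace:
  assumes "vspace M" "vspace M'" "linear_map M M' f" "submodule N' scalars M'"
    and "S \<subseteq> carrier M" "\<And>x. x \<in> S \<Longrightarrow> f x \<in> N'" "x \<in> gen_subspace M S"
  shows "f x \<in> N'"
  using gen_subspace_least[OF submodule_preimage[OF assms(1-4)], of S] assms(5-7) by blast

lemma abelian_subgroup_submodule:
  assumes "vspace M" "submodule N scalars M" shows "abelian_subgroup N M"
proof -
  interpret M: module scalars M by fact
  show ?thesis
    using submodule.axioms(1)[OF assms(2)]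
    by (intro abelian_subgroupI3 additive_subgroup.intro) (auto intro: M.M.abelian_group_axioms)
qed

context
  fixes M :: "('k::field, 'a) module" and N :: "'a set"
  assumes M: "vspace M" and N: "submodule N scalars M"
begin

interpretation M: module scalars M by (rule M)
interpretation abelian_subgroup N M by (rule abelian_subgroup_submodule[OF M N])

lemma carrier_quot_space: "carrier (quot_space M N) = (\<lambda>x. N +>\<^bsub>M\<^esub> x) ` carrier M"
  by (auto simp: quot_space_def A_RCOSETS_def')

lemma coset_eq_iff:
  assumes "x \<in> carrier M" "y \<in> carrier M"
  shows "N +>\<^bsub>M\<^esub> x = N +>\<^bsub>M\<^esub> y \<longleftrightarrow> x \<ominus>\<^bsub>M\<^esub> y \<in> N"
proof -
  have "N +>\<^bsub>M\<^esub> x = N +>\<^bsub>M\<^esub> y \<longleftrightarrow> x \<in> N +>\<^bsub>M\<^esub> y"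
    using a_rcos_self[OF assms(1)] a_repr_independence'[of x y] assms(2) by metis
  also have "\<dots> \<longleftrightarrow> x \<ominus>\<^bsub>M\<^esub> y \<in> N"
    unfolding a_minus_def by (rule a_rcos_module[OF assms(2,1)])
  finally show ?thesis .
qed

lemma coset_mem_diff:
  assumes "x \<in> carrier M" "y \<in> N +>\<^bsub>M\<^esub> x"
  shows "y \<in> carrier M" "N +>\<^bsub>M\<^esub> y = N +>\<^bsub>M\<^esub> x"
  using a_elemrcos_carrier[OF assms] a_repr_independence'[OF assms(2,1)] by simp_all

lemma quot_space_add:
  "x \<in> carrier M \<Longrightarrow> y \<in> carrier M \<Longrightarrow>
    (N +>\<^bsub>M\<^esub> x) \<oplus>\<^bsub>quot_space M N\<^esub> (N +>\<^bsub>M\<^esub> y) = N +>\<^bsub>M\<^esub> (x \<oplus>\<^bsub>M\<^esub> y)"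
  by (simp add: quot_space_def a_rcos_sum)

lemma coset_self: "x \<in> carrier M \<Longrightarrow> x \<in> N +>\<^bsub>M\<^esub> x"
  by (rule a_rcos_self)

text \<open>Maps and scalar multiplication on quotients are defined as unions over all
  representatives of a coset; such a union collapses once its terms depend only on the
  coset.\<close>

lemma Union_coset:
  assumes "x \<in> carrier M" "\<And>y. y \<in> carrier M \<Longrightarrow> N +>\<^bsub>M\<^esub> y = N +>\<^bsub>M\<^esub> x \<Longrightarrow> h y = h x"
  shows "(\<Union>y\<in>N +>\<^bsub>M\<^esub> x. h y) = h x"
proof -
  have "h y = h x" if "y \<in> N +>\<^bsub>M\<^esub> x" for y
    using assms(2) coset_mem_diff[OF assms(1) that] by blast
  then show ?thesis using coset_self[OF assms(1)] by blast
qed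

lemma quot_space_smult:
  assumes "x \<in> carrier M"
  shows "c \<odot>\<^bsub>quot_space M N\<^esub> (N +>\<^bsub>M\<^esub> x) = N +>\<^bsub>M\<^esub> (c \<odot>\<^bsub>M\<^esub> x)"
proof -
  have "N +>\<^bsub>M\<^esub> (c \<odot>\<^bsub>M\<^esub> y) = N +>\<^bsub>M\<^esub> (c \<odot>\<^bsub>M\<^esub> x)"
    if y: "y \<in> carrier M" "N +>\<^bsub>M\<^esub> y = N +>\<^bsub>M\<^esub> x" for y
  proof -
    have lin: "linear_map M M (\<lambda>x. c \<odot>\<^bsub>M\<^esub> x)"
      by (rule linear_mapI) (auto simp: M.smult_r_distr simp flip: M.smult_assoc1[simplified]
          simp: mult.commute)
    have "c \<odot>\<^bsub>M\<^esub> (y \<ominus>\<^bsub>M\<^esub> x) \<in> N"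
      using y assms by (simp add: submodule_smult[OF N] flip: coset_eq_iff)
    then show ?thesis
      using y assms by (simp add: coset_eq_iff linear_map_minus[OF lin M M])
  qed
  from Union_coset[of x "\<lambda>y. N +>\<^bsub>M\<^esub> (c \<odot>\<^bsub>M\<^esub> y)", OF assms this]
  show ?thesis by (simp add: quot_space_def)
qed

lemma quot_space_zero: "\<zero>\<^bsub>quot_space M N\<^esub> = N +>\<^bsub>M\<^esub> \<zero>\<^bsub>M\<^esub>"
  using a_rcos_const[OF submodule_zero[OF N]] by (simp add: quot_space_def)

lemma vspace_quot_space: "vspace (quot_space M N)"
proof (rule vspaceI)
  fix x assume x: "x \<in> carrier (quot_space M N)"
  then obtain u where u: "u \<in> carrier M" "x = N +>\<^bsub>M\<^esub> u" by (auto simp: carrier_quot_space)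
  show "((-1) \<odot>\<^bsub>quot_space M N\<^esub> x) \<oplus>\<^bsub>quot_space M N\<^esub> x = \<zero>\<^bsub>quot_space M N\<^esub>"
    using u(1) by (simp add: u(2) quot_space_smult quot_space_add quot_space_zero
        vspace_smult_minus[OF M] M.M.l_neg del: M.M.a_coset_add_zero)
  show "1 \<odot>\<^bsub>quot_space M N\<^esub> x = x"
    using u M.smult_one[of u] by (simp add: quot_space_smult)
qed (auto simp: carrier_quot_space quot_space_add quot_space_smult quot_space_zero
    M.M.a_assoc M.M.a_comm M.M.a_lcomm M.smult_r_distr M.smult_l_distr[simplified] M.smult_assoc1[simplified]
    simp del: M.M.a_coset_add_zero)

lemma linear_map_coset: "linear_map M (quot_space M N) (\<lambda>x. N +>\<^bsub>M\<^esub> x)"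
  by (rule linear_mapI) (auto simp: carrier_quot_space quot_space_add quot_space_smult)

text \<open>A linear map that vanishes on \<open>N\<close> is constant on each coset, so the image
  of a coset is a singleton. Its element is the value of the induced map on the quotient.\<close>

lemma the_elem_coset:
  assumes "vspace W" "linear_map M W f" "\<And>x. x \<in> N \<Longrightarrow> f x = \<zero>\<^bsub>W\<^esub>" "x \<in> carrier M"
  shows "the_elem (f ` (N +>\<^bsub>M\<^esub> x)) = f x"
proof -
  interpret W: module scalars W by fact
  have "f y = f x" if "y \<in> N +>\<^bsub>M\<^esub> x" for y
  proof -
    have y: "y \<in> carrier M" "N +>\<^bsub>M\<^esub> y = N +>\<^bsub>M\<^esub> x" using coset_mem_diff[OF assms(4) that] by auto
    then have "f (y \<ominus>\<^bsub>M\<^esub> x) = \<zero>\<^bsub>W\<^esub>" using assms(3,4) by (simp add: coset_eq_iff)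
    then show ?thesis
      using linear_map_minus[OF assms(2) M assms(1) y(1) assms(4)] linear_map_closed[OF assms(2)]
        assms(4) y(1) vspace_diff_zero[OF assms(1)] by metis
  qed
  then have "f ` (N +>\<^bsub>M\<^esub> x) = {f x}" using coset_self[OF assms(4)] by blast
  then show ?thesis by simp
qed

lemma linear_map_the_elem:
  assumes "vspace W" "linear_map M W f" "\<And>x. x \<in> N \<Longrightarrow> f x = \<zero>\<^bsub>W\<^esub>"
  shows "linear_map (quot_space M N) W (\<lambda>X. the_elem (f ` X))"
  by (rule linear_mapI)
    (auto simp: carrier_quot_space quot_space_add quot_space_smult the_elem_coset[OF assms]
      linear_map_add[OF assms(2)] linear_map_smult[OF assms(2)] linear_map_closed[OF assms(2)])

end

lemma quot_map_coset:
  assumes "vspace M" "submodule N scalars M" "vspace M'" "submodule N' scalars M'"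
    "linear_map M M' f" "\<And>x. x \<in> N \<Longrightarrow> f x \<in> N'" "x \<in> carrier M"
  shows "quot_map M' N' f (N +>\<^bsub>M\<^esub> x) = N' +>\<^bsub>M'\<^esub> f x"
  unfolding quot_map_def
proof (rule Union_coset[OF assms(1,2,7)])
  fix y assume "y \<in> carrier M" "N +>\<^bsub>M\<^esub> y = N +>\<^bsub>M\<^esub> x"
  then show "N' +>\<^bsub>M'\<^esub> f y = N' +>\<^bsub>M'\<^esub> f x"
    using assms(6,7) linear_map_minus[OF assms(5,1,3), of y x]
    by (metis coset_eq_iff[OF assms(1,2)] coset_eq_iff[OF assms(3,4)] linear_map_closed[OF assms(5)])
qed

lemma linear_map_quot_map:
  assumes "vspace M" "submodule N scalars M" "vspace M'" "submodule N' scalars M'"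
    "linear_map M M' f" "\<And>x. x \<in> N \<Longrightarrow> f x \<in> N'"
  shows "linear_map (quot_space M N) (quot_space M' N') (quot_map M' N' f)"
proof -
  interpret M: module scalars M by fact
  show ?thesis
    by (rule linear_mapI)
      (auto simp: carrier_quot_space[OF assms(1,2)] carrier_quot_space[OF assms(3,4)]
        quot_map_coset[OF assms] linear_map_closed[OF assms(5)] linear_map_add[OF assms(5)]
        linear_map_smult[OF assms(5)] quot_space_add[OF assms(1,2)] quot_space_add[OF assms(3,4)]
        quot_space_smult[OF assms(1,2)] quot_space_smult[OF assms(3,4)])
qed

subsection \<open>Coordinate spaces and free spaces\<close>

lemma fun_space_simps [simp]:
  "\<zero>\<^bsub>fun_space X\<^esub> = (\<lambda>_. 0)" "f \<oplus>\<^bsub>fun_space X\<^esub> g = (\<lambda>x. f x + g x)"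
  "c \<odot>\<^bsub>fun_space X\<^esub> f = (\<lambda>x. c * f x)"
  by (simp_all add: fun_space_def)

lemma carrier_fun_space: "f \<in> carrier (fun_space X) \<longleftrightarrow> (\<forall>x. x \<notin> X \<longrightarrow> f x = 0)"
  by (simp add: fun_space_def)

lemma vspace_fun_space: "vspace (fun_space X)"
  by (rule vspaceI) (auto simp: carrier_fun_space fun_eq_iff algebra_simps)

lemma finsum_fun_space:
  assumes "finite A" "\<And>a. a \<in> A \<Longrightarrow> g a \<in> carrier (fun_space X)"
  shows "(\<Oplus>\<^bsub>fun_space X\<^esub>a\<in>A. g a) = (\<lambda>x. \<Sum>a\<in>A. g a x)"
proof -
  interpret module scalars "fun_space X" by (rule vspace_fun_space)
  show ?thesis using assms
    by (induction A rule: finite_induct) (auto simp: Pi_iff)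
qed

lemma free_space_simps [simp]:
  "\<zero>\<^bsub>free_space X\<^esub> = 0" "x \<oplus>\<^bsub>free_space X\<^esub> y = x + y"
  "c \<odot>\<^bsub>free_space X\<^esub> x = Poly_Mapping.map ((*) c) x"
  by (simp_all add: free_space_def)

lemma carrier_free_space: "x \<in> carrier (free_space X) \<longleftrightarrow> Poly_Mapping.keys x \<subseteq> X"
  by (simp add: free_space_def)

lemma lookup_map_times:
  "Poly_Mapping.lookup (Poly_Mapping.map ((*) c) x) k = c * Poly_Mapping.lookup x k"
  for c :: "'k::field"
  by (simp add: Poly_Mapping.map.rep_eq when_def)

lemma map_times_single:
  "Poly_Mapping.map ((*) c) (Poly_Mapping.single k a) = Poly_Mapping.single k (c * a)"
  for c :: "'k::field"
  by (rule poly_mapping_eqI) (simp add: lookup_map_times lookup_single when_def)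

lemma vspace_free_space: "vspace (free_space X :: ('k::field, 'x \<Rightarrow>\<^sub>0 'k) module)"
proof (rule vspaceI)
  fix x y :: "'x \<Rightarrow>\<^sub>0 'k"
  assume "x \<in> carrier (free_space X)" "y \<in> carrier (free_space X)"
  then show "x \<oplus>\<^bsub>free_space X\<^esub> y \<in> carrier (free_space X)"
    using keys_add[of x y] by (auto simp: carrier_free_space)
qed (auto simp: carrier_free_space lookup_map_times lookup_add algebra_simps in_keys_iff
    intro!: poly_mapping_eqI)

lemma single_in_free_space [simp]:
  "k \<in> X \<Longrightarrow> Poly_Mapping.single k a \<in> carrier (free_space X)"
  by (simp add: carrier_free_space)

lemma minus_free_space:
  assumes "x \<in> carrier (free_space X)" "y \<in> carrier (free_space X)"
  shows "x \<ominus>\<^bsub>free_space X\<^esub> y = x - y"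
proof -
  interpret F: module scalars "free_space X" by (rule vspace_free_space)
  have "\<ominus>\<^bsub>free_space X\<^esub> y = - y"
    using vspace_smult_minus[OF vspace_free_space assms(2)]
    by (auto intro!: poly_mapping_eqI simp: lookup_map_times simp flip: \<open>_ = \<ominus>\<^bsub>free_space X\<^esub> y\<close>)
  then show ?thesis by (simp add: a_minus_def)
qed

lemma finsum_free_space:
  assumes "finite A" "\<And>a. a \<in> A \<Longrightarrow> g a \<in> carrier (free_space X)"
  shows "(\<Oplus>\<^bsub>free_space X\<^esub>a\<in>A. g a) = (\<Sum>a\<in>A. g a)"
proof -
  interpret module scalars "free_space X" by (rule vspace_free_space)
  show ?thesis using assms
    by (induction A rule: finite_induct) (auto simp: Pi_iff)
qed

lemma free_space_induct [consumes 1, case_names zero single add]: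
  assumes "x \<in> carrier (free_space X)"
    and "P 0" and "\<And>k a. k \<in> X \<Longrightarrow> P (Poly_Mapping.single k a)"
    and "\<And>y z. y \<in> carrier (free_space X) \<Longrightarrow> z \<in> carrier (free_space X) \<Longrightarrow> P y \<Longrightarrow> P z \<Longrightarrow> P (y + z)"
  shows "P x"
  using assms(1)
proof (induction x rule: update_induct)
  case const
  show ?case by (rule assms(2))
next
  case (update x k a)
  \<comment> \<open>The key \<open>k\<close> is new to \<open>x\<close>, so the update overwrites
    nothing and is an addition.\<close>
  have eq: "Poly_Mapping.update k a x = Poly_Mapping.single k a + x"
    using update(1) by (intro poly_mapping_eqI)
      (auto simp: lookup_update lookup_add lookup_single when_def in_keys_iff)
  have "Poly_Mapping.keys (Poly_Mapping.update k a x) = insert k (Poly_Mapping.keys x)"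
    using update(2) by (auto simp: in_keys_iff lookup_update split: if_splits)
  then show ?case
    using update(3,4) unfolding eq by (intro assms(4) assms(3)) (auto simp: carrier_free_space)
qed

lemma linear_map_free_space_eqI:
  assumes "vspace W" "linear_map (free_space X) W f" "linear_map (free_space X) W g"
    and "\<And>k. k \<in> X \<Longrightarrow> f (Poly_Mapping.single k 1) = g (Poly_Mapping.single k 1)"
    and "x \<in> carrier (free_space X)"
  shows "f x = g x"
  using assms(5)
proof (induction rule: free_space_induct)
  case zero
  show ?case
    using linear_map_zero[OF assms(2) vspace_free_space assms(1)]
      linear_map_zero[OF assms(3) vspace_free_space assms(1)] by simp
next
  case (single k a)
  then show ?case
    using linear_map_smult[OF assms(2), of "Poly_Mapping.single k 1" a]
      linear_map_smult[OF assms(3), of "Poly_Mapping.single k 1" a] assms(4)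
    by (simp add: map_times_single)
next
  case (add y z)
  then show ?case
    using linear_map_add[OF assms(2), of y z] linear_map_add[OF assms(3), of y z] by simp
qed

definition lin_ext :: "('k::field, 'w) module \<Rightarrow> ('x \<Rightarrow> 'w) \<Rightarrow> ('x \<Rightarrow>\<^sub>0 'k) \<Rightarrow> 'w" where
  "lin_ext W h x = (\<Oplus>\<^bsub>W\<^esub>k\<in>Poly_Mapping.keys x. Poly_Mapping.lookup x k \<odot>\<^bsub>W\<^esub> h k)"

text \<open>Extra keys contribute zero summands. Enlarging the index set gives \<open>x\<close>,
  \<open>y\<close> and \<open>x + y\<close> a common one, which is what additivity of
  \<open>lin_ext\<close> needs.\<close>

lemma lin_ext_superset:
  assumes "vspace W" "finite K" "Poly_Mapping.keys x \<subseteq> K" "\<And>k. k \<in> K \<Longrightarrow> h k \<in> carrier W"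
  shows "lin_ext W h x = (\<Oplus>\<^bsub>W\<^esub>k\<in>K. Poly_Mapping.lookup x k \<odot>\<^bsub>W\<^esub> h k)"
proof -
  interpret W: module scalars W by fact
  show ?thesis unfolding lin_ext_def
    by (rule W.M.add.finprod_mono_neutral_cong_left[OF assms(2,3)])
      (use assms(3,4) in \<open>auto simp: in_keys_iff vspace_smult_zero[OF assms(1)]\<close>)
qed

lemma lin_ext_single:
  assumes "vspace W" "h k \<in> carrier W"
  shows "lin_ext W h (Poly_Mapping.single k a) = a \<odot>\<^bsub>W\<^esub> h k"
proof -
  interpret W: module scalars W by fact
  show ?thesis using assms(2) by (subst lin_ext_superset[OF assms(1), of "{k}"]) auto
qed

lemma linear_map_lin_ext:
  fixes W :: "('k::field, 'w) module" and X :: "'x set"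
  assumes "vspace W" "\<And>k. k \<in> X \<Longrightarrow> h k \<in> carrier W"
  shows "linear_map (free_space X) W (lin_ext W h)"
proof -
  interpret W: module scalars W by fact
  show ?thesis
  proof (rule linear_mapI)
    fix x :: "'x \<Rightarrow>\<^sub>0 'k" assume x: "x \<in> carrier (free_space X)"
    then show "lin_ext W h x \<in> carrier W"
      using assms(2) unfolding lin_ext_def
      by (intro W.M.finsum_closed) (auto simp: carrier_free_space)
    fix c
    have "lin_ext W h (Poly_Mapping.map ((*) c) x) =
        (\<Oplus>\<^bsub>W\<^esub>k\<in>Poly_Mapping.keys x. c \<odot>\<^bsub>W\<^esub> (Poly_Mapping.lookup x k \<odot>\<^bsub>W\<^esub> h k))"
      using x assms(2)
      by (subst lin_ext_superset[OF assms(1), of "Poly_Mapping.keys x"])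
        (auto simp: carrier_free_space in_keys_iff lookup_map_times subset_iff
          W.smult_assoc1[simplified] intro!: W.M.finsum_cong')
    also have "\<dots> = c \<odot>\<^bsub>W\<^esub> lin_ext W h x"
      unfolding lin_ext_def using x assms(2)
      by (intro W.finsum_smult_ldistr[symmetric]) (auto simp: carrier_free_space)
    finally show "lin_ext W h (c \<odot>\<^bsub>free_space X\<^esub> x) = c \<odot>\<^bsub>W\<^esub> lin_ext W h x" by simp
  next
    fix x y :: "'x \<Rightarrow>\<^sub>0 'k" assume xy: "x \<in> carrier (free_space X)" "y \<in> carrier (free_space X)"
    let ?K = "Poly_Mapping.keys x \<union> Poly_Mapping.keys y"
    have h: "h k \<in> carrier W" if "k \<in> ?K" for k
      using that xy assms(2) by (auto simp: carrier_free_space)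
    note sup = lin_ext_superset[OF assms(1), of ?K _ h, OF _ _ h]
    have "lin_ext W h (x + y) = (\<Oplus>\<^bsub>W\<^esub>k\<in>?K. Poly_Mapping.lookup (x + y) k \<odot>\<^bsub>W\<^esub> h k)"
      using keys_add[of x y] by (intro sup) auto
    also have "\<dots> = (\<Oplus>\<^bsub>W\<^esub>k\<in>?K. Poly_Mapping.lookup x k \<odot>\<^bsub>W\<^esub> h k \<oplus>\<^bsub>W\<^esub>
        Poly_Mapping.lookup y k \<odot>\<^bsub>W\<^esub> h k)"
      using h by (intro W.M.finsum_cong'[OF refl]) (simp_all add: lookup_add W.smult_l_distr[simplified])
    also have "\<dots> = lin_ext W h x \<oplus>\<^bsub>W\<^esub> lin_ext W h y"
      using h by (subst (1 2) sup) (auto intro!: W.M.finsum_addf)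
    finally show "lin_ext W h (x \<oplus>\<^bsub>free_space X\<^esub> y) = lin_ext W h x \<oplus>\<^bsub>W\<^esub> lin_ext W h y" by simp
  qed
qed

text \<open>Linearity of \<open>free_map\<close> is obtained by recognising it as a linear extension
  from basis elements.\<close>

lemma free_map_eq_lin_ext:
  assumes "\<And>w. w \<in> carrier W \<Longrightarrow> h w \<in> carrier W'" "x \<in> carrier (free_space (A \<times> carrier W))"
  shows "free_map h x =
    lin_ext (free_space (A \<times> carrier W')) (\<lambda>k. Poly_Mapping.single (fst k, h (snd k)) 1) x"
  using assms unfolding free_map_def lin_ext_def
  by (subst finsum_free_space) (auto simp: map_times_single carrier_free_space subset_iff)

lemma linear_map_free_map:
  assumes "\<And>w. w \<in> carrier W \<Longrightarrow> h w \<in> carrier W'"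
  shows "linear_map (free_space (A \<times> carrier W)) (free_space (A \<times> carrier W')) (free_map h)"
  by (rule linear_map_cong[OF linear_map_lin_ext[OF vspace_free_space] vspace_free_space
        free_map_eq_lin_ext[OF assms]])
    (use assms in auto)

lemma free_map_single: "free_map h (Poly_Mapping.single (m, w) 1) = Poly_Mapping.single (m, h w) 1"
  by (simp add: free_map_def)

section \<open>Tensor products over the group algebra\<close>

lemma finite_perms: "finite (perms n)"
  by (rule finite_permutations) simp

lemma perms_comp: "\<sigma> \<in> perms n \<Longrightarrow> \<pi> \<in> perms n \<Longrightarrow> \<sigma> \<circ> \<pi> \<in> perms n"
  by (simp add: permutes_compose)

lemma perms_pinv: "\<sigma> \<in> perms n \<Longrightarrow> pinv \<sigma> \<in> perms n"
  by (simp add: permutes_inv)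

lemma bij_betw_perms_comp: "\<sigma> \<in> perms n \<Longrightarrow> bij_betw (\<lambda>\<alpha>. \<alpha> \<circ> \<sigma>) (perms n) (perms n)"
  by (rule bij_betw_byWitness[of _ "\<lambda>\<alpha>. \<alpha> \<circ> pinv \<sigma>"])
    (auto simp: comp_assoc permutes_inv_o permutes_compose permutes_inv)

definition ga_act :: "nat \<Rightarrow> ('k::field, 'w) module \<Rightarrow> ((nat \<Rightarrow> nat) \<Rightarrow> 'w \<Rightarrow> 'w) \<Rightarrow>
    ((nat \<Rightarrow> nat) \<Rightarrow> 'k) \<Rightarrow> 'w \<Rightarrow> 'w" where
  "ga_act n W \<tau> x w = (\<Oplus>\<^bsub>W\<^esub>\<sigma>\<in>perms n. x \<sigma> \<odot>\<^bsub>W\<^esub> \<tau> \<sigma> w)"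

locale perm_action =
  fixes n :: nat and W :: "('k::field, 'w) module" and \<tau> :: "(nat \<Rightarrow> nat) \<Rightarrow> 'w \<Rightarrow> 'w"
  assumes vspace_W: "vspace W"
    and linear: "\<sigma> \<in> perms n \<Longrightarrow> linear_map W W (\<tau> \<sigma>)"
    and comp: "\<sigma> \<in> perms n \<Longrightarrow> \<pi> \<in> perms n \<Longrightarrow> w \<in> carrier W \<Longrightarrow> \<tau> (\<sigma> \<circ> \<pi>) w = \<tau> \<sigma> (\<tau> \<pi> w)"
begin

sublocale W: module scalars W by (rule vspace_W)

lemma closed: "\<sigma> \<in> perms n \<Longrightarrow> w \<in> carrier W \<Longrightarrow> \<tau> \<sigma> w \<in> carrier W"
  by (rule linear_map_closed[OF linear])

lemma ga_act_closed: "w \<in> carrier W \<Longrightarrow> ga_act n W \<tau> x w \<in> carrier W"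
  unfolding ga_act_def by (intro W.M.finsum_closed) (auto simp: closed)

lemma linear_ga_act: "linear_map W W (ga_act n W \<tau> x)"
proof (rule linear_mapI)
  fix w w' c assume w: "w \<in> carrier W" and w': "w' \<in> carrier W"
  show "ga_act n W \<tau> x w \<in> carrier W" by (rule ga_act_closed[OF w])
  have "ga_act n W \<tau> x (w \<oplus>\<^bsub>W\<^esub> w') =
      (\<Oplus>\<^bsub>W\<^esub>\<sigma>\<in>perms n. x \<sigma> \<odot>\<^bsub>W\<^esub> \<tau> \<sigma> w \<oplus>\<^bsub>W\<^esub> x \<sigma> \<odot>\<^bsub>W\<^esub> \<tau> \<sigma> w')"
    unfolding ga_act_def using w w'
    by (intro W.M.finsum_cong'[OF refl])
      (simp_all add: linear_map_add[OF linear] W.smult_r_distr closed)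
  also have "\<dots> = ga_act n W \<tau> x w \<oplus>\<^bsub>W\<^esub> ga_act n W \<tau> x w'"
    unfolding ga_act_def using w w' by (intro W.M.finsum_addf) (auto simp: closed)
  finally show "ga_act n W \<tau> x (w \<oplus>\<^bsub>W\<^esub> w') = ga_act n W \<tau> x w \<oplus>\<^bsub>W\<^esub> ga_act n W \<tau> x w'" .
  have "ga_act n W \<tau> x (c \<odot>\<^bsub>W\<^esub> w) = (\<Oplus>\<^bsub>W\<^esub>\<sigma>\<in>perms n. c \<odot>\<^bsub>W\<^esub> (x \<sigma> \<odot>\<^bsub>W\<^esub> \<tau> \<sigma> w))"
    unfolding ga_act_def using w
    by (intro W.M.finsum_cong'[OF refl])
      (simp_all add: linear_map_smult[OF linear] closed mult.commute flip: W.smult_assoc1[simplified])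
  also have "\<dots> = c \<odot>\<^bsub>W\<^esub> ga_act n W \<tau> x w"
    unfolding ga_act_def using w
    by (intro W.finsum_smult_ldistr[symmetric]) (auto simp: closed finite_perms)
  finally show "ga_act n W \<tau> x (c \<odot>\<^bsub>W\<^esub> w) = c \<odot>\<^bsub>W\<^esub> ga_act n W \<tau> x w" .
qed

lemma ga_act_cong: "w \<in> carrier W \<Longrightarrow> (\<And>\<sigma>. \<sigma> \<in> perms n \<Longrightarrow> x \<sigma> = y \<sigma>) \<Longrightarrow>
    ga_act n W \<tau> x w = ga_act n W \<tau> y w"
  unfolding ga_act_def by (rule W.M.finsum_cong'[OF refl]) (auto simp: closed)

lemma ga_act_add: "w \<in> carrier W \<Longrightarrow>
    ga_act n W \<tau> (\<lambda>\<sigma>. x \<sigma> + y \<sigma>) w = ga_act n W \<tau> x w \<oplus>\<^bsub>W\<^esub> ga_act n W \<tau> y w"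
proof -
  assume w: "w \<in> carrier W"
  have "ga_act n W \<tau> (\<lambda>\<sigma>. x \<sigma> + y \<sigma>) w = (\<Oplus>\<^bsub>W\<^esub>\<sigma>\<in>perms n. x \<sigma> \<odot>\<^bsub>W\<^esub> \<tau> \<sigma> w \<oplus>\<^bsub>W\<^esub> y \<sigma> \<odot>\<^bsub>W\<^esub> \<tau> \<sigma> w)"
    unfolding ga_act_def using w
    by (intro W.M.finsum_cong'[OF refl]) (simp_all add: W.smult_l_distr[simplified] closed)
  also have "\<dots> = ga_act n W \<tau> x w \<oplus>\<^bsub>W\<^esub> ga_act n W \<tau> y w"
    unfolding ga_act_def using w by (intro W.M.finsum_addf) (auto simp: closed)
  finally show ?thesis .
qed

lemma ga_act_smult:
  assumes w: "w \<in> carrier W"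
  shows "ga_act n W \<tau> (\<lambda>\<sigma>. c * x \<sigma>) w = c \<odot>\<^bsub>W\<^esub> ga_act n W \<tau> x w"
proof -
  have "ga_act n W \<tau> (\<lambda>\<sigma>. c * x \<sigma>) w = (\<Oplus>\<^bsub>W\<^esub>\<sigma>\<in>perms n. c \<odot>\<^bsub>W\<^esub> (x \<sigma> \<odot>\<^bsub>W\<^esub> \<tau> \<sigma> w))"
    unfolding ga_act_def using w
    by (intro W.M.finsum_cong'[OF refl]) (simp_all add: W.smult_assoc1[simplified] closed)
  also have "\<dots> = c \<odot>\<^bsub>W\<^esub> ga_act n W \<tau> x w"
    unfolding ga_act_def using w
    by (intro W.finsum_smult_ldistr[symmetric]) (auto simp: closed finite_perms)
  finally show ?thesis .
qed

text \<open>The condition on \<open>y\<close> says that \<open>y\<close> is the product of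
  \<open>x\<close> and \<sigma> in the group algebra, so this is associativity of the action,
  obtained by right translation of the summation index.\<close>

lemma ga_act_perm:
  assumes "\<sigma> \<in> perms n" "w \<in> carrier W" "\<And>\<alpha>. \<alpha> \<in> perms n \<Longrightarrow> y (\<alpha> \<circ> \<sigma>) = x \<alpha>"
  shows "ga_act n W \<tau> y w = ga_act n W \<tau> x (\<tau> \<sigma> w)"
proof -
  have "ga_act n W \<tau> x (\<tau> \<sigma> w) = (\<Oplus>\<^bsub>W\<^esub>\<alpha>\<in>perms n. y (\<alpha> \<circ> \<sigma>) \<odot>\<^bsub>W\<^esub> \<tau> (\<alpha> \<circ> \<sigma>) w)"
    unfolding ga_act_def using assms
    by (intro W.M.finsum_cong'[OF refl]) (simp_all add: comp closed perms_comp)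
  also have "\<dots> = (\<Oplus>\<^bsub>W\<^esub>\<alpha>\<in>(\<lambda>\<alpha>. \<alpha> \<circ> \<sigma>) ` perms n. y \<alpha> \<odot>\<^bsub>W\<^esub> \<tau> \<alpha> w)"
  proof (rule W.M.finsum_reindex[symmetric])
    show "inj_on (\<lambda>\<alpha>. \<alpha> \<circ> \<sigma>) (perms n)"
      using bij_betw_perms_comp[OF assms(1)] by (simp only: bij_betw_def)
    show "(\<lambda>\<alpha>. y \<alpha> \<odot>\<^bsub>W\<^esub> \<tau> \<alpha> w) \<in> (\<lambda>\<alpha>. \<alpha> \<circ> \<sigma>) ` perms n \<rightarrow> carrier W"
      using bij_betw_perms_comp[OF assms(1)] assms(2) by (auto simp only: bij_betw_def
          intro!: W.smult_closed closed Pi_I scalars_simps(1)[THEN equalityD2, THEN subsetD])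
  qed
  also have "\<dots> = ga_act n W \<tau> y w"
    using bij_betw_perms_comp[OF assms(1)] by (simp add: ga_act_def bij_betw_def)
  finally show ?thesis by simp
qed

end

locale perm_ract =
  fixes n :: nat and M :: "('k::field, 'm) module" and \<rho> :: "(nat \<Rightarrow> nat) \<Rightarrow> 'm \<Rightarrow> 'm"
  assumes vspace_M: "vspace M"
    and ract_closed: "\<sigma> \<in> perms n \<Longrightarrow> m \<in> carrier M \<Longrightarrow> \<rho> \<sigma> m \<in> carrier M"

text \<open>A right module \<open>M\<close> generated by \<open>m0\<close>, with a right linear section \<open>\<phi>\<close> of the
  surjection \<open>x \<mapsto> m0 x\<close> from the group algebra; so \<open>M\<close> is projective and isomorphic
  to the right ideal generated by the idempotent \<open>\<phi> m0\<close>.\<close>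

locale split_cyclic_module = perm_ract n M \<rho>
  for n :: nat and M :: "('k::field, 'm) module" and \<rho> :: "(nat \<Rightarrow> nat) \<Rightarrow> 'm \<Rightarrow> 'm" +
  fixes \<phi> :: "'m \<Rightarrow> (nat \<Rightarrow> nat) \<Rightarrow> 'k" and m0 :: 'm
  assumes gen_closed: "m0 \<in> carrier M"
    and section_add: "m \<in> carrier M \<Longrightarrow> m' \<in> carrier M \<Longrightarrow> \<phi> (m \<oplus>\<^bsub>M\<^esub> m') = (\<lambda>\<sigma>. \<phi> m \<sigma> + \<phi> m' \<sigma>)"
    and section_smult: "m \<in> carrier M \<Longrightarrow> \<phi> (c \<odot>\<^bsub>M\<^esub> m) = (\<lambda>\<sigma>. c * \<phi> m \<sigma>)"
    and section_ract: "\<sigma> \<in> perms n \<Longrightarrow> m \<in> carrier M \<Longrightarrow> \<alpha> \<in> perms n \<Longrightarrow>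
      \<phi> (\<rho> \<sigma> m) (\<alpha> \<circ> \<sigma>) = \<phi> m \<alpha>"
    and section_gen: "m \<in> carrier M \<Longrightarrow> (\<Oplus>\<^bsub>M\<^esub>\<sigma>\<in>perms n. \<phi> m \<sigma> \<odot>\<^bsub>M\<^esub> \<rho> \<sigma> m0) = m"

locale tensor_pair =
  perm_ract n M \<rho> + perm_action n W \<tau>
  for n :: nat and M :: "('k::field, 'm) module" and \<rho> :: "(nat \<Rightarrow> nat) \<Rightarrow> 'm \<Rightarrow> 'm"
    and W :: "('k, 'w) module" and \<tau> :: "(nat \<Rightarrow> nat) \<Rightarrow> 'w \<Rightarrow> 'w"
begin

sublocale M: module scalars M by (rule vspace_M)

abbreviation "F \<equiv> free_space (carrier M \<times> carrier W)"
abbreviation "R \<equiv> tensor_rel n M \<rho> W \<tau>"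
abbreviation "e m w \<equiv> Poly_Mapping.single (m, w) (1 :: 'k)"
abbreviation "cls m w \<equiv> R +>\<^bsub>F\<^esub> e m w"

sublocale F: module scalars F by (rule vspace_free_space)

definition generators :: "('m \<times> 'w \<Rightarrow>\<^sub>0 'k) set" where
  "generators =
      {e (m \<oplus>\<^bsub>M\<^esub> m') w - e m w - e m' w | m m' w.
          m \<in> carrier M \<and> m' \<in> carrier M \<and> w \<in> carrier W} \<union>
       {e m (w \<oplus>\<^bsub>W\<^esub> w') - e m w - e m w' | m w w'.
          m \<in> carrier M \<and> w \<in> carrier W \<and> w' \<in> carrier W} \<union>
       {e (c \<odot>\<^bsub>M\<^esub> m) w - Poly_Mapping.single (m, w) c | c m w.
          m \<in> carrier M \<and> w \<in> carrier W} \<union>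
       {e m (c \<odot>\<^bsub>W\<^esub> w) - Poly_Mapping.single (m, w) c | c m w.
          m \<in> carrier M \<and> w \<in> carrier W} \<union>
       {e (\<rho> \<sigma> m) w - e m (\<tau> \<sigma> w) | \<sigma> m w.
          \<sigma> \<in> perms n \<and> m \<in> carrier M \<and> w \<in> carrier W}"

lemma tensor_rel_eq: "R = gen_subspace F generators"
  by (simp only: tensor_rel_def Let_def generators_def)

lemma diff_closed: "x \<in> carrier F \<Longrightarrow> y \<in> carrier F \<Longrightarrow> x - y \<in> carrier F"
  by (metis minus_free_space F.M.minus_closed)

lemma e_closed: "m \<in> carrier M \<Longrightarrow> w \<in> carrier W \<Longrightarrow> e m w \<in> carrier F"
  by simp

lemma generators_closed: "generators \<subseteq> carrier F"
  unfolding generators_def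
  by (auto intro!: diff_closed simp: closed ract_closed)

lemma submodule_R: "submodule R scalars F"
  unfolding tensor_rel_eq by (rule submodule_gen_subspace[OF vspace_free_space generators_closed])

text \<open>Universal property of the tensor product: the five assumptions on \<open>f\<close> are
  the five families of relations, so \<open>f\<close> vanishes on the generators and hence on their
  span.\<close>

lemma tensor_rel_kill:
  assumes "vspace V" "linear_map F V f"
    and "\<And>m m' w. m \<in> carrier M \<Longrightarrow> m' \<in> carrier M \<Longrightarrow> w \<in> carrier W \<Longrightarrow>
      f (e (m \<oplus>\<^bsub>M\<^esub> m') w) = f (e m w) \<oplus>\<^bsub>V\<^esub> f (e m' w)"
    and "\<And>m w w'. m \<in> carrier M \<Longrightarrow> w \<in> carrier W \<Longrightarrow> w' \<in> carrier W \<Longrightarrow>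
      f (e m (w \<oplus>\<^bsub>W\<^esub> w')) = f (e m w) \<oplus>\<^bsub>V\<^esub> f (e m w')"
    and "\<And>m w c. m \<in> carrier M \<Longrightarrow> w \<in> carrier W \<Longrightarrow> f (e (c \<odot>\<^bsub>M\<^esub> m) w) = c \<odot>\<^bsub>V\<^esub> f (e m w)"
    and "\<And>m w c. m \<in> carrier M \<Longrightarrow> w \<in> carrier W \<Longrightarrow> f (e m (c \<odot>\<^bsub>W\<^esub> w)) = c \<odot>\<^bsub>V\<^esub> f (e m w)"
    and "\<And>m w \<sigma>. m \<in> carrier M \<Longrightarrow> w \<in> carrier W \<Longrightarrow> \<sigma> \<in> perms n \<Longrightarrow>
      f (e (\<rho> \<sigma> m) w) = f (e m (\<tau> \<sigma> w))"
    and "x \<in> R"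
  shows "f x = \<zero>\<^bsub>V\<^esub>"
proof -
  interpret V: module scalars V by fact
  have minus: "f (x - y) = f x \<ominus>\<^bsub>V\<^esub> f y" if "x \<in> carrier F" "y \<in> carrier F" for x y
    using linear_map_minus[OF assms(2) vspace_free_space assms(1) that] that by (simp add: minus_free_space)
  have single: "f (Poly_Mapping.single (m, w) c) = c \<odot>\<^bsub>V\<^esub> f (e m w)"
    if "m \<in> carrier M" "w \<in> carrier W" for m w c
    using linear_map_smult[OF assms(2), of "e m w" c] that by (simp add: map_times_single)
  have cl: "f (e m w) \<in> carrier V" if "m \<in> carrier M" "w \<in> carrier W" for m w
    using linear_map_closed[OF assms(2) e_closed[OF that]] .
  have z: "u \<oplus>\<^bsub>V\<^esub> v \<ominus>\<^bsub>V\<^esub> u \<ominus>\<^bsub>V\<^esub> v = \<zero>\<^bsub>V\<^esub>" if "u \<in> carrier V" "v \<in> carrier V" for u v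
    using that by (simp add: a_minus_def V.M.a_comm[of u v] V.M.a_assoc V.M.r_neg)
  have z': "u \<ominus>\<^bsub>V\<^esub> u = \<zero>\<^bsub>V\<^esub>" if "u \<in> carrier V" for u
    using that by (simp add: a_minus_def V.M.r_neg)
  have gen: "f y \<in> {\<zero>\<^bsub>V\<^esub>}" if "y \<in> generators" for y
  proof -
    from that[unfolded generators_def] consider
      (1) m m' w where "y = e (m \<oplus>\<^bsub>M\<^esub> m') w - e m w - e m' w" "m \<in> carrier M" "m' \<in> carrier M" "w \<in> carrier W"
    | (2) m w w' where "y = e m (w \<oplus>\<^bsub>W\<^esub> w') - e m w - e m w'" "m \<in> carrier M" "w \<in> carrier W" "w' \<in> carrier W"
    | (3) c m w where "y = e (c \<odot>\<^bsub>M\<^esub> m) w - Poly_Mapping.single (m, w) c" "m \<in> carrier M" "w \<in> carrier W"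
    | (4) c m w where "y = e m (c \<odot>\<^bsub>W\<^esub> w) - Poly_Mapping.single (m, w) c" "m \<in> carrier M" "w \<in> carrier W"
    | (5) \<sigma> m w where "y = e (\<rho> \<sigma> m) w - e m (\<tau> \<sigma> w)" "\<sigma> \<in> perms n" "m \<in> carrier M" "w \<in> carrier W"
      by blast
    then show ?thesis
    proof cases
      case (3 c m w)
      then show ?thesis by (simp add: minus single[of m w c] assms(5) cl z')
    next
      case (4 c m w)
      then show ?thesis by (simp add: minus single[of m w c] assms(6) cl z')
    qed (simp_all add: minus diff_closed closed ract_closed cl z z' assms(3,4,7))
  qed
  have "f x \<in> {\<zero>\<^bsub>V\<^esub>}"
    by (rule linear_map_gen_subspace[OF vspace_free_space assms(1,2) submodule_null[OF assms(1)]
        generators_closed gen assms(8)[unfolded tensor_rel_eq]])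
  then show ?thesis by simp
qed

text \<open>Converse use of the relations: each difference of the two sides is one of the
  generators, so the pairing into the quotient is bilinear and balanced.\<close>

lemma cls_relations:
  assumes "m \<in> carrier M" "w \<in> carrier W"
  shows cls_add_left: "m' \<in> carrier M \<Longrightarrow>
      cls (m \<oplus>\<^bsub>M\<^esub> m') w = cls m w \<oplus>\<^bsub>quot_space F R\<^esub> cls m' w"
    and cls_add_right: "w' \<in> carrier W \<Longrightarrow>
      cls m (w \<oplus>\<^bsub>W\<^esub> w') = cls m w \<oplus>\<^bsub>quot_space F R\<^esub> cls m w'"
    and cls_smult_left: "cls (c \<odot>\<^bsub>M\<^esub> m) w = c \<odot>\<^bsub>quot_space F R\<^esub> cls m w"
    and cls_smult_right: "cls m (c \<odot>\<^bsub>W\<^esub> w) = c \<odot>\<^bsub>quot_space F R\<^esub> cls m w"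
    and cls_ract: "\<sigma> \<in> perms n \<Longrightarrow> cls (\<rho> \<sigma> m) w = cls m (\<tau> \<sigma> w)"
proof -
  note q = vspace_free_space submodule_R
  have eqI: "R +>\<^bsub>F\<^esub> x = R +>\<^bsub>F\<^esub> y" if "x \<in> carrier F" "y \<in> carrier F" "x - y \<in> generators" for x y
    unfolding coset_eq_iff[OF q that(1,2)] minus_free_space[OF that(1,2)]
    unfolding tensor_rel_eq by (rule gen_subspace_incl[OF that(3)])
  have sum: "x + y \<in> carrier F" if "x \<in> carrier F" "y \<in> carrier F" for x y :: "'m \<times> 'w \<Rightarrow>\<^sub>0 'k"
    using F.M.a_closed[OF that] by simp
  show "cls (m \<oplus>\<^bsub>M\<^esub> m') w = cls m w \<oplus>\<^bsub>quot_space F R\<^esub> cls m' w" if "m' \<in> carrier M"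
  proof -
    have "e (m \<oplus>\<^bsub>M\<^esub> m') w - (e m w + e m' w) \<in> generators"
      using assms that unfolding diff_diff_eq[symmetric] generators_def by blast
    then show ?thesis
      using assms that by (simp add: quot_space_add[OF q] eqI sum)
  qed
  show "cls m (w \<oplus>\<^bsub>W\<^esub> w') = cls m w \<oplus>\<^bsub>quot_space F R\<^esub> cls m w'" if "w' \<in> carrier W"
  proof -
    have "e m (w \<oplus>\<^bsub>W\<^esub> w') - (e m w + e m w') \<in> generators"
      using assms that unfolding diff_diff_eq[symmetric] generators_def by blast
    then show ?thesis
      using assms that by (simp add: quot_space_add[OF q] eqI sum)
  qed
  show "cls (c \<odot>\<^bsub>M\<^esub> m) w = c \<odot>\<^bsub>quot_space F R\<^esub> cls m w"
  proof -
    have "e (c \<odot>\<^bsub>M\<^esub> m) w - Poly_Mapping.single (m, w) c \<in> generators"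
      using assms unfolding generators_def by blast
    then show ?thesis
      using assms by (simp add: quot_space_smult[OF q] map_times_single eqI)
  qed
  show "cls m (c \<odot>\<^bsub>W\<^esub> w) = c \<odot>\<^bsub>quot_space F R\<^esub> cls m w"
  proof -
    have "e m (c \<odot>\<^bsub>W\<^esub> w) - Poly_Mapping.single (m, w) c \<in> generators"
      using assms unfolding generators_def by blast
    then show ?thesis
      using assms by (simp add: quot_space_smult[OF q] map_times_single eqI)
  qed
  show "cls (\<rho> \<sigma> m) w = cls m (\<tau> \<sigma> w)" if "\<sigma> \<in> perms n"
  proof -
    have "e (\<rho> \<sigma> m) w - e m (\<tau> \<sigma> w) \<in> generators"
      using assms that unfolding generators_def by blast
    then show ?thesis
      using assms that by (simp add: ract_closed closed eqI)
  qed
qed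

lemma tensor_kS_eq: "tensor_kS n M \<rho> W \<tau> = quot_space F R"
  by (simp add: tensor_kS_def)

lemma vspace_tensor: "vspace (tensor_kS n M \<rho> W \<tau>)"
  unfolding tensor_kS_eq by (rule vspace_quot_space[OF vspace_free_space submodule_R])

end

locale split_tensor = tensor_pair n M \<rho> W \<tau> + split_cyclic_module n M \<rho> \<phi> m0
  for n :: nat and M :: "('k::field, 'm) module" and \<rho> and \<phi> and m0
    and W :: "('k, 'w) module" and \<tau>
begin

text \<open>On pure tensors this is m \<otimes> w \<mapsto> \<phi>(m) w, the map of the free space
  descended to the quotient.\<close>

definition to_W :: "('m \<times> 'w \<Rightarrow>\<^sub>0 'k) set \<Rightarrow> 'w" where
  "to_W X = the_elem (lin_ext W (\<lambda>k. ga_act n W \<tau> (\<phi> (fst k)) (snd k)) ` X)"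

definition of_W :: "'w \<Rightarrow> ('m \<times> 'w \<Rightarrow>\<^sub>0 'k) set" where
  "of_W w = cls m0 w"

lemma linear_L: "linear_map F W (lin_ext W (\<lambda>k. ga_act n W \<tau> (\<phi> (fst k)) (snd k)))"
  by (rule linear_map_lin_ext[OF vspace_W]) (auto simp: ga_act_closed)

lemma L_single: "w \<in> carrier W \<Longrightarrow>
    lin_ext W (\<lambda>k. ga_act n W \<tau> (\<phi> (fst k)) (snd k)) (e m w) = ga_act n W \<tau> (\<phi> m) w"
  by (subst lin_ext_single[OF vspace_W]) (auto simp: ga_act_closed W.smult_one[simplified])

text \<open>Bilinearity comes from linearity of \<phi> and of the action; balancedness is right
  linearity of \<phi>, which \<open>section_ract\<close> expresses in the form that
  \<open>ga_act_perm\<close> takes.\<close>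

lemma L_kill: "x \<in> R \<Longrightarrow> lin_ext W (\<lambda>k. ga_act n W \<tau> (\<phi> (fst k)) (snd k)) x = \<zero>\<^bsub>W\<^esub>"
  by (rule tensor_rel_kill[OF vspace_W linear_L])
    (auto simp: L_single section_add section_smult ga_act_add ga_act_smult ract_closed closed
      linear_map_add[OF linear_ga_act] linear_map_smult[OF linear_ga_act]
      intro!: ga_act_perm section_ract)

lemma linear_to_W: "linear_map (tensor_kS n M \<rho> W \<tau>) W to_W"
  unfolding tensor_kS_eq to_W_def
  by (rule linear_map_the_elem[OF vspace_free_space submodule_R vspace_W linear_L L_kill])

lemma to_W_cls: "m \<in> carrier M \<Longrightarrow> w \<in> carrier W \<Longrightarrow> to_W (cls m w) = ga_act n W \<tau> (\<phi> m) w"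
  unfolding to_W_def
  using the_elem_coset[OF vspace_free_space submodule_R vspace_W linear_L L_kill e_closed] L_single
  by simp

lemma linear_of_W: "linear_map W (tensor_kS n M \<rho> W \<tau>) of_W"
  unfolding tensor_kS_eq of_W_def
  by (rule linear_mapI)
    (auto simp: carrier_quot_space[OF vspace_free_space submodule_R] cls_add_right cls_smult_right
      gen_closed)

lemma to_W_of_W: "w \<in> carrier W \<Longrightarrow> to_W (of_W w) = ga_act n W \<tau> (\<phi> m0) w"
  by (simp add: of_W_def to_W_cls gen_closed)

text \<open>On pure tensors, m0 \<otimes> \<phi>(m) w = m0 \<phi>(m) \<otimes> w = m \<otimes> w:
  scalars and permutations are moved across the tensor sign term by term, and
  \<open>section_gen\<close> evaluates the result. Linearity extends this to all classes.\<close>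

lemma of_W_to_W:
  assumes "X \<in> carrier (tensor_kS n M \<rho> W \<tau>)"
  shows "of_W (to_W X) = X"
proof -
  let ?Q = "quot_space F R"
  note Q = vspace_tensor[unfolded tensor_kS_eq]
  interpret Q: module scalars ?Q by (rule Q)
  note coset = linear_map_coset[OF vspace_free_space submodule_R]
  have cls: "of_W (to_W (cls m w)) = cls m w" if m: "m \<in> carrier M" and w: "w \<in> carrier W" for m w
  proof -
    have lin: "linear_map M ?Q (\<lambda>m. cls m w)"
      by (rule linear_mapI)
        (auto simp: w carrier_quot_space[OF vspace_free_space submodule_R] cls_add_left cls_smult_left)
    have "of_W (to_W (cls m w)) = of_W (\<Oplus>\<^bsub>W\<^esub>\<sigma>\<in>perms n. \<phi> m \<sigma> \<odot>\<^bsub>W\<^esub> \<tau> \<sigma> w)"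
      using m w by (simp add: to_W_cls ga_act_def)
    also have "\<dots> = (\<Oplus>\<^bsub>?Q\<^esub>\<sigma>\<in>perms n. of_W (\<phi> m \<sigma> \<odot>\<^bsub>W\<^esub> \<tau> \<sigma> w))"
      by (rule linear_map_finsum[OF linear_of_W[unfolded tensor_kS_eq] vspace_W Q finite_perms])
        (simp add: closed w)
    also have "\<dots> = (\<Oplus>\<^bsub>?Q\<^esub>\<sigma>\<in>perms n. cls (\<phi> m \<sigma> \<odot>\<^bsub>M\<^esub> \<rho> \<sigma> m0) w)"
      using m w linear_map_closed[OF coset e_closed]
      by (intro Q.M.finsum_cong'[OF refl])
        (auto simp: of_W_def gen_closed closed ract_closed cls_smult_left cls_smult_right cls_ract)
    also have "\<dots> = cls (\<Oplus>\<^bsub>M\<^esub>\<sigma>\<in>perms n. \<phi> m \<sigma> \<odot>\<^bsub>M\<^esub> \<rho> \<sigma> m0) w"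
      by (rule linear_map_finsum[OF lin vspace_M Q finite_perms, symmetric])
        (simp add: ract_closed gen_closed)
    also have "\<dots> = cls m w" by (simp add: section_gen m)
    finally show ?thesis .
  qed
  obtain x where x: "x \<in> carrier F" "X = R +>\<^bsub>F\<^esub> x"
    using assms by (auto simp: tensor_kS_eq carrier_quot_space[OF vspace_free_space submodule_R])
  have "of_W (to_W (R +>\<^bsub>F\<^esub> x)) = R +>\<^bsub>F\<^esub> x"
    by (rule linear_map_free_space_eqI[OF Q linear_map_comp[OF linear_map_comp[OF coset
            linear_to_W[unfolded tensor_kS_eq]] linear_of_W[unfolded tensor_kS_eq]] coset _ x(1)])
      (auto simp: cls)
  then show ?thesis by (simp add: x)
qed

lemma tensor_iso_image:
  "tensor_kS n M \<rho> W \<tau> \<cong>\<^sub>k W\<lparr>carrier := ga_act n W \<tau> (\<phi> m0) ` carrier W\<rparr>"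
  by (rule vs_iso_image[OF linear_to_W linear_map_closed[OF linear_of_W] of_W_to_W to_W_of_W])

end

section \<open>Functoriality of Ext\<close>

text \<open>The linear part of the structure of a bifunctor, on which Hom spaces, cocycles and
  coboundaries depend. It lets quotients and tensor products of bifunctors enter the Ext calculus
  directly.\<close>

locale lin_bifun =
  fixes B :: "('k::field, 'b) bifun"
  assumes vspace_val: "vspace (val B s)"
    and linear_act: "linear_map (val B s) (val B s') (act B s s' \<mu>)"

lemma Hom_space_simps [simp]:
  "carrier (Hom_space T U) = nat_trans T U"
  "\<zero>\<^bsub>Hom_space T U\<^esub> = (\<lambda>s. \<lambda>x\<in>carrier (val T s). \<zero>\<^bsub>val U s\<^esub>)"
  "\<eta> \<oplus>\<^bsub>Hom_space T U\<^esub> \<theta> = (\<lambda>s. \<lambda>x\<in>carrier (val T s). \<eta> s x \<oplus>\<^bsub>val U s\<^esub> \<theta> s x)"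
  "c \<odot>\<^bsub>Hom_space T U\<^esub> \<eta> = (\<lambda>s. \<lambda>x\<in>carrier (val T s). c \<odot>\<^bsub>val U s\<^esub> \<eta> s x)"
  by (simp_all add: Hom_space_def)

lemma nat_trans_linear: "\<eta> \<in> nat_trans T U \<Longrightarrow> linear_map (val T s) (val U s) (\<eta> s)"
  and nat_trans_natural: "\<eta> \<in> nat_trans T U \<Longrightarrow> x \<in> carrier (val T s) \<Longrightarrow>
    \<eta> s' (act T s s' \<mu> x) = act U s s' \<mu> (\<eta> s x)"
  and nat_trans_ext: "\<eta> \<in> nat_trans T U \<Longrightarrow> \<eta> s \<in> extensional (carrier (val T s))"
  unfolding nat_trans_def by (simp_all del: split_paired_All)

lemma nat_trans_closed: "\<eta> \<in> nat_trans T U \<Longrightarrow> x \<in> carrier (val T s) \<Longrightarrow> \<eta> s x \<in> carrier (val U s)"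
  by (rule linear_map_closed[OF nat_trans_linear])

lemma nat_trans_eqI:
  assumes "\<eta> \<in> nat_trans T U" "\<theta> \<in> nat_trans T U"
    and "\<And>s x. x \<in> carrier (val T s) \<Longrightarrow> \<eta> s x = \<theta> s x"
  shows "\<eta> = \<theta>"
  by (rule ext, rule extensionalityI[OF nat_trans_ext[OF assms(1)] nat_trans_ext[OF assms(2)] assms(3)])

text \<open>Natural transformations are extensional by definition, so a family of maps has to be cut
  down to the carriers; naturality survives because the action stays inside the carriers.\<close>

lemma nat_trans_restrictI:
  assumes "lin_bifun T"
    and "\<And>s. linear_map (val T s) (val U s) (\<eta> s)"
    and "\<And>s s' \<mu> x. x \<in> carrier (val T s) \<Longrightarrow> \<eta> s' (act T s s' \<mu> x) = act U s s' \<mu> (\<eta> s x)"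
  shows "(\<lambda>s. restrict (\<eta> s) (carrier (val T s))) \<in> nat_trans T U"
proof -
  interpret T: lin_bifun T by fact
  have "linear_map (val T s) (val U s) (restrict (\<eta> s) (carrier (val T s)))" for s
    by (rule linear_map_cong[OF assms(2) T.vspace_val]) simp
  then show ?thesis
    using assms(3) linear_map_closed[OF T.linear_act]
    by (simp add: nat_trans_def del: split_paired_All)
qed

lemma vspace_Hom_space:
  assumes "lin_bifun T" "lin_bifun U"
  shows "vspace (Hom_space T U)"
proof -
  interpret T: lin_bifun T by fact
  interpret U: lin_bifun U by fact
  interpret Tv: module scalars "val T s" for s by (rule T.vspace_val)
  interpret Uv: module scalars "val U s" for s by (rule U.vspace_val)
  show ?thesis
  proof (rule vspaceI)
    fix \<eta> \<theta> assume "\<eta> \<in> carrier (Hom_space T U)" "\<theta> \<in> carrier (Hom_space T U)"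
    then have n: "\<eta> \<in> nat_trans T U" "\<theta> \<in> nat_trans T U" by simp_all
    show "\<eta> \<oplus>\<^bsub>Hom_space T U\<^esub> \<theta> \<in> carrier (Hom_space T U)"
      unfolding Hom_space_simps
    proof (rule nat_trans_restrictI[OF assms(1)])
      show "linear_map (val T s) (val U s) (\<lambda>x. \<eta> s x \<oplus>\<^bsub>val U s\<^esub> \<theta> s x)" for s
        by (rule linear_mapI) (simp_all add: nat_trans_closed[OF n(1)] nat_trans_closed[OF n(2)]
            linear_map_add[OF nat_trans_linear[OF n(1)]] linear_map_add[OF nat_trans_linear[OF n(2)]]
            linear_map_smult[OF nat_trans_linear[OF n(1)]] linear_map_smult[OF nat_trans_linear[OF n(2)]]
            Uv.M.a_ac Uv.smult_r_distr)
    qed (simp add: nat_trans_natural[OF n(1)] nat_trans_natural[OF n(2)] linear_map_add[OF U.linear_act]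
        nat_trans_closed[OF n(1)] nat_trans_closed[OF n(2)])
  next
    show "\<zero>\<^bsub>Hom_space T U\<^esub> \<in> carrier (Hom_space T U)"
      unfolding Hom_space_simps
      by (rule nat_trans_restrictI[OF assms(1)])
        (auto intro!: linear_mapI simp: linear_map_zero[OF U.linear_act U.vspace_val U.vspace_val]
          Uv.smult_r_null[simplified])
  next
    fix \<eta> c assume "\<eta> \<in> carrier (Hom_space T U)"
    then have n: "\<eta> \<in> nat_trans T U" by simp
    show "c \<odot>\<^bsub>Hom_space T U\<^esub> \<eta> \<in> carrier (Hom_space T U)"
      unfolding Hom_space_simps
    proof (rule nat_trans_restrictI[OF assms(1)])
      show "linear_map (val T s) (val U s) (\<lambda>x. c \<odot>\<^bsub>val U s\<^esub> \<eta> s x)" for s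
        by (rule linear_mapI) (simp_all add: nat_trans_closed[OF n]
            linear_map_add[OF nat_trans_linear[OF n]] linear_map_smult[OF nat_trans_linear[OF n]]
            Uv.smult_r_distr mult.commute flip: Uv.smult_assoc1[simplified])
    qed (simp add: nat_trans_natural[OF n] linear_map_smult[OF U.linear_act] nat_trans_closed[OF n])
    show "((-1) \<odot>\<^bsub>Hom_space T U\<^esub> \<eta>) \<oplus>\<^bsub>Hom_space T U\<^esub> \<eta> = \<zero>\<^bsub>Hom_space T U\<^esub>"
      by (auto simp: fun_eq_iff restrict_def vspace_smult_minus[OF U.vspace_val] nat_trans_closed[OF n]
          Uv.M.l_neg)
  qed (auto simp: fun_eq_iff restrict_def nat_trans_closed Uv.M.a_assoc Uv.M.a_comm Uv.M.a_lcomm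
      Uv.smult_r_distr Uv.smult_l_distr[simplified] Uv.smult_assoc1[simplified]
      Uv.smult_one[simplified] extensional_arb[OF nat_trans_ext])
qed

lemma nt_comp_apply: "x \<in> carrier (val T s) \<Longrightarrow> nt_comp T \<psi> \<eta> s x = \<psi> s (\<eta> s x)"
  by (simp add: nt_comp_def compose_def)

lemma nt_comp_closed:
  assumes "lin_bifun T" "\<eta> \<in> nat_trans T U" "\<psi> \<in> nat_trans U V"
  shows "nt_comp T \<psi> \<eta> \<in> nat_trans T V"
  unfolding nt_comp_def compose_def
  by (rule nat_trans_restrictI[OF assms(1)])
    (auto intro: linear_map_comp[OF nat_trans_linear[OF assms(2)] nat_trans_linear[OF assms(3)]]
      simp: nat_trans_natural[OF assms(2)] nat_trans_natural[OF assms(3)] nat_trans_closed[OF assms(2)])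

lemma nt_comp_assoc:
  assumes "\<eta> \<in> nat_trans T U"
  shows "nt_comp T (nt_comp U \<chi> \<psi>) \<eta> = nt_comp T \<chi> (nt_comp T \<psi> \<eta>)"
  by (auto simp: nt_comp_def compose_def fun_eq_iff restrict_def nat_trans_closed[OF assms])

lemma linear_nt_comp_left:
  assumes "lin_bifun T" "\<psi> \<in> nat_trans U V"
  shows "linear_map (Hom_space T U) (Hom_space T V) (nt_comp T \<psi>)"
proof (rule linear_mapI)
  fix \<eta> \<theta> c assume \<eta>: "\<eta> \<in> carrier (Hom_space T U)"
  then show "nt_comp T \<psi> \<eta> \<in> carrier (Hom_space T V)"
    using nt_comp_closed[OF assms(1) _ assms(2)] by simp
  note lin = linear_map_add[OF nat_trans_linear[OF assms(2)]] linear_map_smult[OF nat_trans_linear[OF assms(2)]]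
  show "nt_comp T \<psi> (c \<odot>\<^bsub>Hom_space T U\<^esub> \<eta>) = c \<odot>\<^bsub>Hom_space T V\<^esub> nt_comp T \<psi> \<eta>"
    using \<eta> by (auto simp: nt_comp_def compose_def fun_eq_iff restrict_def nat_trans_closed lin)
  assume "\<theta> \<in> carrier (Hom_space T U)"
  then show "nt_comp T \<psi> (\<eta> \<oplus>\<^bsub>Hom_space T U\<^esub> \<theta>) = nt_comp T \<psi> \<eta> \<oplus>\<^bsub>Hom_space T V\<^esub> nt_comp T \<psi> \<theta>"
    using \<eta> by (auto simp: nt_comp_def compose_def fun_eq_iff restrict_def nat_trans_closed lin)
qed

lemma linear_nt_comp_right:
  assumes "lin_bifun T" "\<eta> \<in> nat_trans T U"
  shows "linear_map (Hom_space U V) (Hom_space T V) (\<lambda>\<psi>. nt_comp T \<psi> \<eta>)"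
proof (rule linear_mapI)
  fix \<psi> assume "\<psi> \<in> carrier (Hom_space U V)"
  then show "nt_comp T \<psi> \<eta> \<in> carrier (Hom_space T V)"
    using nt_comp_closed[OF assms] by simp
qed (auto simp: fun_eq_iff restrict_def nt_comp_def compose_def nat_trans_closed[OF assms(2)])

text \<open>The identity \<open>d_d\<close> is what places coboundaries among the cocycles; for a
  projective resolution it is one inclusion of exactness.\<close>

locale lin_complex =
  fixes P :: "nat \<Rightarrow> ('k::field, 'c) bifun" and d :: "nat \<Rightarrow> obj \<Rightarrow> 'c \<Rightarrow> 'c"
  assumes lin_bifun_P: "lin_bifun (P i)"
    and d: "d i \<in> nat_trans (P (Suc i)) (P i)"
    and d_d: "x \<in> carrier (val (P (Suc (Suc i))) s) \<Longrightarrow> d i s (d (Suc i) s x) = \<zero>\<^bsub>val (P i) s\<^esub>"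
begin

context
  fixes B :: "('k, 'b) bifun" and i :: nat
  assumes B: "lin_bifun B"
begin

text \<open>Written as the preimage of the zero subspace under precomposition with the differential,
  the set of cocycles falls under \<open>submodule_preimage\<close>.\<close>

lemma cocycles_eq: "cocycles P d B i = {\<eta> \<in> carrier (Hom_space (P i) B).
    nt_comp (P (Suc i)) \<eta> (d i) \<in> {\<zero>\<^bsub>Hom_space (P (Suc i)) B\<^esub>}}"
  by (auto simp: cocycles_def)

lemma submodule_cocycles: "submodule (cocycles P d B i) scalars (Hom_space (P i) B)"
  unfolding cocycles_eq
  by (rule submodule_preimage[OF vspace_Hom_space[OF lin_bifun_P B] vspace_Hom_space[OF lin_bifun_P B]
        linear_nt_comp_right[OF lin_bifun_P d] submodule_null[OF vspace_Hom_space[OF lin_bifun_P B]]])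

lemma vspace_cocycle_space: "vspace (cocycle_space P d B i)"
  unfolding cocycle_space_def
  by (rule vspace_submodule[OF vspace_Hom_space[OF lin_bifun_P B] submodule_cocycles])

end

lemma coboundaries_Suc: "coboundaries P d B (Suc i) =
    (\<lambda>\<eta>. nt_comp (P (Suc i)) \<eta> (d i)) ` carrier (Hom_space (P i) B)"
  by simp

lemma submodule_coboundaries_Hom:
  "lin_bifun B \<Longrightarrow> submodule (coboundaries P d B i) scalars (Hom_space (P i) B)"
proof (cases i)
  case 0
  assume "lin_bifun B"
  from submodule_null[OF vspace_Hom_space[OF lin_bifun_P this]] show ?thesis unfolding 0 coboundaries.simps .
next
  case (Suc j)
  assume B: "lin_bifun B"
  show ?thesis unfolding Suc coboundaries_Suc
    by (rule submodule_image[OF vspace_Hom_space[OF lin_bifun_P B] vspace_Hom_space[OF lin_bifun_P B]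
          linear_nt_comp_right[OF lin_bifun_P d]])
qed

lemma coboundaries_subset:
  assumes B: "lin_bifun B"
  shows "coboundaries P d B i \<subseteq> cocycles P d B i"
proof (cases i)
  case 0
  then show ?thesis using submodule_zero[OF submodule_cocycles[OF B, of 0]] by simp
next
  case (Suc j)
  interpret B: lin_bifun B by fact
  interpret P: lin_bifun "P i" for i by (rule lin_bifun_P)
  have "nt_comp (P (Suc (Suc j))) (nt_comp (P (Suc j)) \<eta> (d j)) (d (Suc j)) =
      \<zero>\<^bsub>Hom_space (P (Suc (Suc j))) B\<^esub>" if \<eta>: "\<eta> \<in> nat_trans (P j) B" for \<eta>
  proof (intro ext)
    fix s x
    show "nt_comp (P (Suc (Suc j))) (nt_comp (P (Suc j)) \<eta> (d j)) (d (Suc j)) s x =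
        \<zero>\<^bsub>Hom_space (P (Suc (Suc j))) B\<^esub> s x"
      using nat_trans_closed[OF d, of x "Suc j" s] d_d[of x j s]
        linear_map_zero[OF nat_trans_linear[OF \<eta>] P.vspace_val B.vspace_val, of s]
      by (simp add: nt_comp_def compose_def)
  qed
  then show ?thesis
    using nt_comp_closed[OF lin_bifun_P d] by (auto simp: Suc cocycles_def)
qed

lemma submodule_coboundaries:
  assumes B: "lin_bifun B"
  shows "submodule (coboundaries P d B i) scalars (cocycle_space P d B i)"
  unfolding cocycle_space_def
  by (rule submodule_restrict_carrier[OF vspace_Hom_space[OF lin_bifun_P B] submodule_cocycles[OF B]
        submodule_coboundaries_Hom[OF B] coboundaries_subset[OF B]])

lemma vspace_Ext: "lin_bifun B \<Longrightarrow> vspace (Ext P d B i)"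
  unfolding Ext_def by (rule vspace_quot_space[OF vspace_cocycle_space submodule_coboundaries])

definition ext_class :: "('k, 'b) bifun \<Rightarrow> nat \<Rightarrow> (obj \<Rightarrow> 'c \<Rightarrow> 'b) \<Rightarrow> (obj \<Rightarrow> 'c \<Rightarrow> 'b) set" where
  "ext_class B i \<eta> = coboundaries P d B i +>\<^bsub>cocycle_space P d B i\<^esub> \<eta>"

lemma carrier_cocycle_space: "carrier (cocycle_space P d B i) = cocycles P d B i"
  by (simp add: cocycle_space_def)

lemma linear_ext_class:
  "lin_bifun B \<Longrightarrow> linear_map (cocycle_space P d B i) (Ext P d B i) (ext_class B i)"
  unfolding Ext_def ext_class_def
  by (rule linear_map_coset[OF vspace_cocycle_space submodule_coboundaries])

lemma carrier_Ext: "lin_bifun B \<Longrightarrow> carrier (Ext P d B i) = ext_class B i ` cocycles P d B i"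
  unfolding Ext_def ext_class_def
  by (simp add: carrier_quot_space[OF vspace_cocycle_space submodule_coboundaries] carrier_cocycle_space)

lemma cocycles_nat_trans: "\<eta> \<in> cocycles P d B i \<Longrightarrow> \<eta> \<in> nat_trans (P i) B"
  by (simp add: cocycles_def)

context
  fixes B :: "('k, 'b) bifun" and B' :: "('k, 'b2) bifun" and \<phi>
  assumes B: "lin_bifun B" and B': "lin_bifun B'" and \<phi>: "\<phi> \<in> nat_trans B B'"
begin

interpretation B: lin_bifun B by (rule B)
interpretation B': lin_bifun B' by (rule B')

lemma nt_comp_zero: "nt_comp (P i) \<phi> \<zero>\<^bsub>Hom_space (P i) B\<^esub> = \<zero>\<^bsub>Hom_space (P i) B'\<^esub>"
  by (rule linear_map_zero[OF linear_nt_comp_left[OF lin_bifun_P \<phi>]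
        vspace_Hom_space[OF lin_bifun_P B] vspace_Hom_space[OF lin_bifun_P B']])

text \<open>Composition with \<phi> on the left commutes with composition with the differential on
  the right, by associativity. So \<phi> induces a chain map between the Hom complexes; this gives
  cocycles here and coboundaries below.\<close>

lemma nt_comp_cocycles: "\<eta> \<in> cocycles P d B i \<Longrightarrow> nt_comp (P i) \<phi> \<eta> \<in> cocycles P d B' i"
  using nt_comp_closed[OF lin_bifun_P _ \<phi>] nt_comp_zero[of "Suc i"] nt_comp_assoc[OF d, of i \<phi> \<eta>]
  by (simp add: cocycles_def)

lemma nt_comp_coboundaries: "\<eta> \<in> coboundaries P d B i \<Longrightarrow> nt_comp (P i) \<phi> \<eta> \<in> coboundaries P d B' i"
proof (cases i)
  case 0
  then show "\<eta> \<in> coboundaries P d B i \<Longrightarrow> ?thesis" using nt_comp_zero[of 0] by simp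
next
  case (Suc j)
  assume "\<eta> \<in> coboundaries P d B i"
  then obtain \<theta> where \<theta>: "\<theta> \<in> nat_trans (P j) B" "\<eta> = nt_comp (P (Suc j)) \<theta> (d j)"
    unfolding Suc by auto
  have "nt_comp (P i) \<phi> \<eta> = nt_comp (P i) (nt_comp (P j) \<phi> \<theta>) (d j)"
    unfolding \<theta>(2) Suc by (rule nt_comp_assoc[OF d, symmetric])
  then show ?thesis
    using nt_comp_closed[OF lin_bifun_P \<theta>(1) \<phi>] unfolding Suc by auto
qed

lemma linear_nt_comp_cocycles:
  "linear_map (cocycle_space P d B i) (cocycle_space P d B' i) (nt_comp (P i) \<phi>)"
  using linear_nt_comp_left[OF lin_bifun_P \<phi>, of i] nt_comp_cocycles[of _ i] cocycles_nat_trans[of _ B i]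
  by (simp add: linear_map_def cocycle_space_def Pi_iff)

lemma linear_Ext_map: "linear_map (Ext P d B i) (Ext P d B' i) (Ext_map P d B' i \<phi>)"
  unfolding Ext_def Ext_map_def
  by (rule linear_map_quot_map[OF vspace_cocycle_space[OF B] submodule_coboundaries[OF B]
        vspace_cocycle_space[OF B'] submodule_coboundaries[OF B'] linear_nt_comp_cocycles
        nt_comp_coboundaries])

lemma Ext_map_class: "\<eta> \<in> cocycles P d B i \<Longrightarrow>
    Ext_map P d B' i \<phi> (ext_class B i \<eta>) = ext_class B' i (nt_comp (P i) \<phi> \<eta>)"
  unfolding ext_class_def Ext_map_def
  by (rule quot_map_coset[OF vspace_cocycle_space[OF B] submodule_coboundaries[OF B]
        vspace_cocycle_space[OF B'] submodule_coboundaries[OF B'] linear_nt_comp_cocycles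
        nt_comp_coboundaries]) (simp_all add: carrier_cocycle_space)

end

lemma Ext_map_comp:
  assumes "lin_bifun B" "lin_bifun B'" "lin_bifun B''" "\<phi> \<in> nat_trans B B'" "\<psi> \<in> nat_trans B' B''"
    and "X \<in> carrier (Ext P d B i)"
  shows "Ext_map P d B'' i \<psi> (Ext_map P d B' i \<phi> X) = Ext_map P d B'' i (nt_comp B \<psi> \<phi>) X"
proof -
  obtain \<eta> where \<eta>: "\<eta> \<in> cocycles P d B i" "X = ext_class B i \<eta>"
    using assms(6) carrier_Ext[OF assms(1)] by auto
  show ?thesis
    using assms \<eta>(1) unfolding \<eta>(2)
    by (simp add: Ext_map_class nt_comp_cocycles nt_comp_closed
        nt_comp_assoc[OF cocycles_nat_trans[OF \<eta>(1)]])
qed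

end

section \<open>Group algebra actions on bifunctors and on their Ext groups\<close>

locale bifun_action = lin_bifun T
  for n :: nat and T :: "('k::field, 'w) bifun" and \<tau> :: "(nat \<Rightarrow> nat) \<Rightarrow> 'w \<Rightarrow> 'w" +
  assumes perm_action: "perm_action n (val T s) \<tau>"
    and natural: "\<sigma> \<in> perms n \<Longrightarrow> w \<in> carrier (val T s) \<Longrightarrow>
      \<tau> \<sigma> (act T s s' \<mu> w) = act T s s' \<mu> (\<tau> \<sigma> w)"
begin

sublocale val: perm_action n "val T s" \<tau> for s by (rule perm_action)

text \<open>Restricted to the carrier in the same way as inside \<open>Ext_perm\<close>, so that the
  two actions on Ext agree by unfolding.\<close>

definition perm_nt :: "(nat \<Rightarrow> nat) \<Rightarrow> obj \<Rightarrow> 'w \<Rightarrow> 'w" where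
  "perm_nt \<sigma> = (\<lambda>s. restrict (\<tau> \<sigma>) (carrier (val T s)))"

definition ga_nt :: "((nat \<Rightarrow> nat) \<Rightarrow> 'k) \<Rightarrow> obj \<Rightarrow> 'w \<Rightarrow> 'w" where
  "ga_nt x = (\<lambda>s. restrict (ga_act n (val T s) \<tau> x) (carrier (val T s)))"

lemma perm_nt: "\<sigma> \<in> perms n \<Longrightarrow> perm_nt \<sigma> \<in> nat_trans T T"
  unfolding perm_nt_def
  by (rule nat_trans_restrictI[OF lin_bifun_axioms val.linear natural])

lemma ga_act_natural:
  assumes "w \<in> carrier (val T s)"
  shows "ga_act n (val T s') \<tau> x (act T s s' \<mu> w) = act T s s' \<mu> (ga_act n (val T s) \<tau> x w)"
proof -
  have "act T s s' \<mu> (ga_act n (val T s) \<tau> x w) =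
      (\<Oplus>\<^bsub>val T s'\<^esub>\<sigma>\<in>perms n. act T s s' \<mu> (x \<sigma> \<odot>\<^bsub>val T s\<^esub> \<tau> \<sigma> w))"
    unfolding ga_act_def
    by (rule linear_map_finsum[OF linear_act vspace_val vspace_val finite_perms]) (simp add: val.closed assms)
  also have "\<dots> = ga_act n (val T s') \<tau> x (act T s s' \<mu> w)"
    unfolding ga_act_def using assms
    by (intro val.W.M.finsum_cong'[OF refl])
      (auto simp: val.closed linear_map_smult[OF linear_act] linear_map_closed[OF linear_act] natural)
  finally show ?thesis by simp
qed

lemma ga_nt: "ga_nt x \<in> nat_trans T T"
  unfolding ga_nt_def
  by (rule nat_trans_restrictI[OF lin_bifun_axioms val.linear_ga_act ga_act_natural])

end

locale bifun_action_complex = bifun_action n T \<tau> + lin_complex P d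
  for n :: nat and T :: "('k::field, 'w) bifun" and \<tau> :: "(nat \<Rightarrow> nat) \<Rightarrow> 'w \<Rightarrow> 'w"
    and P :: "nat \<Rightarrow> ('k, 'c) bifun" and d
begin

lemma perm_action_Ext: "perm_action n (Ext P d T i) (\<lambda>\<sigma>. Ext_map P d T i (perm_nt \<sigma>))"
proof (rule perm_action.intro)
  fix \<sigma> \<pi> X assume a: "\<sigma> \<in> perms n" "\<pi> \<in> perms n" "X \<in> carrier (Ext P d T i)"
  have "nt_comp T (perm_nt \<sigma>) (perm_nt \<pi>) = perm_nt (\<sigma> \<circ> \<pi>)"
    using val.comp[OF a(1,2)] val.closed[OF a(2)]
    by (auto simp: nt_comp_def compose_def perm_nt_def fun_eq_iff restrict_def)
  then show "Ext_map P d T i (perm_nt (\<sigma> \<circ> \<pi>)) X = Ext_map P d T i (perm_nt \<sigma>) (Ext_map P d T i (perm_nt \<pi>) X)"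
    using Ext_map_comp[OF lin_bifun_axioms lin_bifun_axioms lin_bifun_axioms perm_nt[OF a(2)] perm_nt[OF a(1)] a(3)]
    by simp
qed (auto intro: vspace_Ext lin_bifun_axioms linear_Ext_map perm_nt)

sublocale Ext: perm_action n "Ext P d T i" "\<lambda>\<sigma>. Ext_map P d T i (perm_nt \<sigma>)" for i
  by (rule perm_action_Ext)

text \<open>Additivity of Ext in the coefficients: the linear combination of induced maps is induced
  by the linear combination \<open>ga_nt x\<close>. The identity already holds for cocycles, where
  it can be tested pointwise, and passes to classes by linearity.\<close>

lemma ga_act_Ext:
  assumes "X \<in> carrier (Ext P d T i)"
  shows "ga_act n (Ext P d T i) (\<lambda>\<sigma>. Ext_map P d T i (perm_nt \<sigma>)) x X = Ext_map P d T i (ga_nt x) X"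
proof -
  let ?Z = "cocycle_space P d T i"
  note T = lin_bifun_axioms
  interpret Z: module scalars ?Z by (rule vspace_cocycle_space[OF T])
  obtain \<eta> where \<eta>: "\<eta> \<in> cocycles P d T i" "X = ext_class T i \<eta>"
    using assms carrier_Ext[OF T] by auto
  have cl: "nt_comp (P i) (perm_nt \<sigma>) \<eta> \<in> carrier ?Z" if "\<sigma> \<in> perms n" for \<sigma>
    using nt_comp_cocycles[OF T T perm_nt[OF that] \<eta>(1)] by (simp add: carrier_cocycle_space)
  \<comment> \<open>Evaluation at a point is linear, so a finite sum in the cocycle space can be
    computed value by value.\<close>
  have eval: "linear_map ?Z (val T s) (\<lambda>\<theta>. \<theta> s y)" if "y \<in> carrier (val (P i) s)" for s y
    by (rule linear_mapI)
      (use that in \<open>auto simp: cocycle_space_def dest: cocycles_nat_trans nat_trans_closed\<close>)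
  let ?S = "\<Oplus>\<^bsub>?Z\<^esub>\<sigma>\<in>perms n. x \<sigma> \<odot>\<^bsub>?Z\<^esub> nt_comp (P i) (perm_nt \<sigma>) \<eta>"
  have S: "?S = nt_comp (P i) (ga_nt x) \<eta>"
  proof (rule nat_trans_eqI)
    show "?S \<in> nat_trans (P i) T"
      using cl Z.M.finsum_closed[of "\<lambda>\<sigma>. x \<sigma> \<odot>\<^bsub>?Z\<^esub> nt_comp (P i) (perm_nt \<sigma>) \<eta>" "perms n"]
      by (intro cocycles_nat_trans) (auto simp: Pi_iff simp flip: carrier_cocycle_space)
    show "nt_comp (P i) (ga_nt x) \<eta> \<in> nat_trans (P i) T"
      by (rule nt_comp_closed[OF lin_bifun_P cocycles_nat_trans[OF \<eta>(1)] ga_nt])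
    fix s y assume y: "y \<in> carrier (val (P i) s)"
    have \<eta>y: "\<eta> s y \<in> carrier (val T s)" by (rule nat_trans_closed[OF cocycles_nat_trans[OF \<eta>(1)] y])
    have "?S s y = (\<Oplus>\<^bsub>val T s\<^esub>\<sigma>\<in>perms n. (x \<sigma> \<odot>\<^bsub>?Z\<^esub> nt_comp (P i) (perm_nt \<sigma>) \<eta>) s y)"
      by (rule linear_map_finsum[OF eval[OF y] vspace_cocycle_space[OF T] vspace_val finite_perms])
        (simp add: cl)
    also have "\<dots> = ga_act n (val T s) \<tau> x (\<eta> s y)"
      unfolding ga_act_def using y \<eta>y
      by (intro val.W.M.finsum_cong'[OF refl])
        (auto simp: val.closed cocycle_space_def nt_comp_apply perm_nt_def)
    also have "\<dots> = nt_comp (P i) (ga_nt x) \<eta> s y"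
      using y \<eta>y by (simp add: nt_comp_apply ga_nt_def)
    finally show "?S s y = nt_comp (P i) (ga_nt x) \<eta> s y" .
  qed
  have "ga_act n (Ext P d T i) (\<lambda>\<sigma>. Ext_map P d T i (perm_nt \<sigma>)) x X =
      (\<Oplus>\<^bsub>Ext P d T i\<^esub>\<sigma>\<in>perms n. ext_class T i (x \<sigma> \<odot>\<^bsub>?Z\<^esub> nt_comp (P i) (perm_nt \<sigma>) \<eta>))"
    unfolding ga_act_def \<eta>(2)
    using linear_map_closed[OF linear_ext_class[OF T]] cl
    by (intro Ext.W.M.finsum_cong'[OF refl])
      (auto simp: Ext_map_class[OF T T perm_nt \<eta>(1)] linear_map_smult[OF linear_ext_class[OF T]])
  also have "\<dots> = ext_class T i ?S"
    by (rule linear_map_finsum[OF linear_ext_class[OF T] vspace_cocycle_space[OF T] vspace_Ext[OF T]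
          finite_perms, symmetric]) (simp add: cl)
  also have "\<dots> = Ext_map P d T i (ga_nt x) X"
    unfolding S \<eta>(2) by (rule Ext_map_class[OF T T ga_nt \<eta>(1), symmetric])
  finally show ?thesis .
qed

text \<open>The data make \<open>B\<close> the image of the natural endomorphism \<open>ga_nt x\<close> of \<open>T\<close>; naturality
  of \<open>\<iota>\<close> and linearity of the action on \<open>B\<close> are then automatic.\<close>

lemma Ext_retract:
  fixes B :: "('k, 'b) bifun"
  assumes B: "\<And>s. vspace (val B s)"
    and \<iota>: "\<And>s. linear_map (val B s) (val T s) (\<iota> s)"
    and \<pi>: "\<And>s. linear_map (val T s) (val B s) (\<pi> s)"
    and \<pi>_natural: "\<And>s s' \<mu> w. w \<in> carrier (val T s) \<Longrightarrow> \<pi> s' (act T s s' \<mu> w) = act B s s' \<mu> (\<pi> s w)"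
    and \<pi>\<iota>: "\<And>s X. X \<in> carrier (val B s) \<Longrightarrow> \<pi> s (\<iota> s X) = X"
    and \<iota>\<pi>: "\<And>s w. w \<in> carrier (val T s) \<Longrightarrow> \<iota> s (\<pi> s w) = ga_act n (val T s) \<tau> x w"
  shows "Ext P d B i \<cong>\<^sub>k (Ext P d T i)\<lparr>carrier :=
    ga_act n (Ext P d T i) (\<lambda>\<sigma>. Ext_map P d T i (perm_nt \<sigma>)) x ` carrier (Ext P d T i)\<rparr>"
proof -
  note T = lin_bifun_axioms
  note \<iota>_cl = linear_map_closed[OF \<iota>] and \<pi>_cl = linear_map_closed[OF \<pi>] and act_cl = linear_map_closed[OF linear_act]
  \<comment> \<open>Because \<pi> is surjective with section \<iota>, naturality of \<pi> determines
    the action on \<open>B\<close>; its linearity follows from this formula.\<close>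
  have act_B: "act B s s' \<mu> X = \<pi> s' (act T s s' \<mu> (\<iota> s X))" if "X \<in> carrier (val B s)" for s s' \<mu> X
    using \<pi>_natural[OF \<iota>_cl[OF that]] \<pi>\<iota>[OF that] by simp
  interpret B: lin_bifun B
    by (rule lin_bifun.intro, rule B, rule linear_map_cong[OF linear_map_comp[OF linear_map_comp[OF \<iota> linear_act] \<pi>] B act_B])
  have B: "lin_bifun B" by (rule B.lin_bifun_axioms)
  define I where "I = (\<lambda>s. restrict (\<iota> s) (carrier (val B s)))"
  define Q where "Q = (\<lambda>s. restrict (\<pi> s) (carrier (val T s)))"
  have Q: "Q \<in> nat_trans T B"
    unfolding Q_def by (rule nat_trans_restrictI[OF T \<pi> \<pi>_natural])
  \<comment> \<open>Inserting the formula for the action produces \<iota> \<pi>, which is the action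
    of \<open>x\<close>. It commutes with the action of \<open>T\<close> and, applied to a value of
    \<iota>, equals \<iota> \<pi> \<iota> = \<iota>.\<close>
  have "\<iota> s' (act B s s' \<mu> X) = act T s s' \<mu> (\<iota> s X)" if X: "X \<in> carrier (val B s)" for s s' \<mu> X
  proof -
    have "\<iota> s' (act B s s' \<mu> X) = ga_act n (val T s') \<tau> x (act T s s' \<mu> (\<iota> s X))"
      by (simp add: act_B[OF X] \<iota>\<pi> act_cl \<iota>_cl[OF X])
    also have "\<dots> = act T s s' \<mu> (\<iota> s (\<pi> s (\<iota> s X)))"
      by (simp add: ga_act_natural \<iota>\<pi> \<iota>_cl[OF X])
    finally show ?thesis by (simp add: \<pi>\<iota>[OF X])
  qed
  then have I: "I \<in> nat_trans B T"
    unfolding I_def by (intro nat_trans_restrictI[OF B \<iota>])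
  have QI: "nt_comp B Q I = (\<lambda>s. restrict (\<lambda>X. X) (carrier (val B s)))"
    by (auto simp: nt_comp_def compose_def fun_eq_iff restrict_def Q_def I_def \<pi>\<iota> \<iota>_cl)
  have IQ: "nt_comp T I Q = ga_nt x"
    by (auto simp: nt_comp_def compose_def fun_eq_iff restrict_def Q_def I_def ga_nt_def \<iota>\<pi> \<pi>_cl)
  show ?thesis
  proof (rule vs_iso_image[where f = "Ext_map P d T i I" and g = "Ext_map P d B i Q"])
    show "linear_map (Ext P d B i) (Ext P d T i) (Ext_map P d T i I)" by (rule linear_Ext_map[OF B T I])
    show "Ext_map P d B i Q X \<in> carrier (Ext P d B i)" if "X \<in> carrier (Ext P d T i)" for X
      by (rule linear_map_closed[OF linear_Ext_map[OF T B Q] that])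
    show "Ext_map P d T i I (Ext_map P d B i Q X) =
        ga_act n (Ext P d T i) (\<lambda>\<sigma>. Ext_map P d T i (perm_nt \<sigma>)) x X" if "X \<in> carrier (Ext P d T i)" for X
      by (simp add: Ext_map_comp[OF T B T Q I that] IQ ga_act_Ext[OF that])
    show "Ext_map P d B i Q (Ext_map P d T i I Y) = Y" if Y: "Y \<in> carrier (Ext P d B i)" for Y
    proof -
      obtain \<eta> where \<eta>: "\<eta> \<in> cocycles P d B i" "Y = ext_class B i \<eta>"
        using Y carrier_Ext[OF B] by auto
      note nt = nt_comp_closed[OF B I Q]
      have "nt_comp (P i) (nt_comp B Q I) \<eta> = \<eta>"
        by (rule nat_trans_eqI[OF nt_comp_closed[OF lin_bifun_P cocycles_nat_trans[OF \<eta>(1)] nt] cocycles_nat_trans[OF \<eta>(1)]])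
          (simp add: nt_comp_apply QI nat_trans_closed[OF cocycles_nat_trans[OF \<eta>(1)]])
      then show ?thesis
        unfolding Ext_map_comp[OF B T B I Q Y] unfolding \<eta>(2) by (simp add: Ext_map_class[OF B B nt \<eta>(1)])
    qed
  qed
qed

end

context bifun_action_complex
begin

abbreviation "Ext_act i \<equiv> \<lambda>\<sigma>. Ext_map P d T i (perm_nt \<sigma>)"

text \<open>The element \<open>\<phi> m0\<close> is used twice: on the values of \<open>T\<close>,
  where \<open>to_W\<close> and \<open>of_W\<close> form a natural retraction, and on the Ext group
  as a module, where the tensor product is again its image. The two images in Ext are the same
  subspace.\<close>

lemma Ext_tensor:
  fixes M :: "('k, 'm) module"
  assumes "split_cyclic_module n M \<rho> \<phi> m0"
  shows "Ext P d (tensor_kS_bifun n M \<rho> T \<tau>) i \<cong>\<^sub>k tensor_kS n M \<rho> (Ext P d T i) (Ext_act i)"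
proof -
  interpret M: split_cyclic_module n M \<rho> \<phi> m0 by fact
  interpret val: split_tensor n M \<rho> \<phi> m0 "val T s" \<tau> for s by unfold_locales
  interpret Ext: split_tensor n M \<rho> \<phi> m0 "Ext P d T i" "Ext_act i" for i by unfold_locales
  let ?B = "tensor_kS_bifun n M \<rho> T \<tau>"
  have val_B: "val ?B s = tensor_kS n M \<rho> (val T s) \<tau>" for s by (simp add: tensor_kS_bifun_def)
  have act_B: "act ?B s s' \<mu> (val.cls s m w) = val.cls s' m (act T s s' \<mu> w)"
    if m: "m \<in> carrier M" and w: "w \<in> carrier (val T s)" for s s' \<mu> m w
  proof -
    let ?f = "free_map (act T s s' \<mu>) :: ('m \<times> 'w \<Rightarrow>\<^sub>0 'k) \<Rightarrow> _"
    let ?F = "val.F s'" and ?R = "tensor_rel n M \<rho> (val T s') \<tau>"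
    note cl = linear_map_closed[OF linear_act]
    have lin: "linear_map (val.F s) ?F ?f"
      by (rule linear_map_free_map[OF cl])
    note coset = linear_map_coset[OF vspace_free_space val.submodule_R[of s']]
    \<comment> \<open>Membership in the relation space is vanishing of the coset, so the universal
      property is applied to \<open>free_map\<close> followed by the quotient map.\<close>
    have into: "?f x \<in> ?R" if x: "x \<in> tensor_rel n M \<rho> (val T s) \<tau>" for x
    proof -
      interpret F': module scalars ?F by (rule vspace_free_space)
      have "?R +>\<^bsub>?F\<^esub> ?f x = \<zero>\<^bsub>quot_space ?F ?R\<^esub>"
        by (rule val.tensor_rel_kill[OF vspace_quot_space[OF vspace_free_space val.submodule_R]
              linear_map_comp[OF lin coset] _ _ _ _ _ x])
          (simp_all add: free_map_single cl val.cls_add_left val.cls_add_right val.cls_smult_left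
            val.cls_smult_right val.cls_ract linear_map_add[OF linear_act] linear_map_smult[OF linear_act]
            natural)
      moreover have "\<zero>\<^bsub>quot_space ?F ?R\<^esub> = ?R" by (simp add: quot_space_def)
      moreover have "?f x \<in> carrier ?F"
        using linear_map_closed[OF lin submodule_carrier[OF val.submodule_R x]] .
      ultimately show ?thesis using coset_self[OF vspace_free_space val.submodule_R[of s']] by metis
    qed
    have "act ?B s s' \<mu> (val.cls s m w) = ?R +>\<^bsub>?F\<^esub> ?f (val.e m w)"
      by (simp add: tensor_kS_bifun_def)
        (rule quot_map_coset[OF vspace_free_space val.submodule_R vspace_free_space val.submodule_R
          lin into val.e_closed[OF m w]])
    then show ?thesis by (simp add: free_map_single)
  qed
  let ?I = "(Ext P d T i)\<lparr>carrier := ga_act n (Ext P d T i) (Ext_act i) (\<phi> m0) ` carrier (Ext P d T i)\<rparr>"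
  have 1: "Ext P d ?B i \<cong>\<^sub>k ?I"
    by (rule Ext_retract[where \<iota> = val.to_W and \<pi> = val.of_W])
      (simp_all add: val_B val.vspace_tensor val.linear_to_W val.linear_of_W val.of_W_to_W val.to_W_of_W,
        simp add: val.of_W_def act_B M.gen_closed)
  have 2: "?I \<cong>\<^sub>k tensor_kS n M \<rho> (Ext P d T i) (Ext_act i)"
    by (rule vs_iso_sym[OF Ext.tensor_iso_image[of i] Ext.vspace_tensor[of i]])
  show "Ext P d ?B i \<cong>\<^sub>k tensor_kS n M \<rho> (Ext P d T i) (Ext_act i)"
    by (rule vs_iso_trans[OF 1 2])
qed

text \<open>\<open>kill\<close> and \<open>diff\<close> together say that the action of
  \<open>x\<close> is idempotent with kernel \<open>N s\<close>; it therefore identifies the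
  quotient with its image, and the inclusion and the quotient map form a retraction.\<close>

lemma Ext_quot_bifun:
  assumes N: "\<And>s. submodule (N s) scalars (val T s)"
    and kill: "\<And>s w. w \<in> N s \<Longrightarrow> ga_act n (val T s) \<tau> x w = \<zero>\<^bsub>val T s\<^esub>"
    and diff: "\<And>s w. w \<in> carrier (val T s) \<Longrightarrow> w \<ominus>\<^bsub>val T s\<^esub> ga_act n (val T s) \<tau> x w \<in> N s"
  shows "Ext P d (quot_bifun T N) i \<cong>\<^sub>k
    (Ext P d T i)\<lparr>carrier := ga_act n (Ext P d T i) (Ext_act i) x ` carrier (Ext P d T i)\<rparr>"
proof -
  let ?E = "\<lambda>s. ga_act n (val T s) \<tau> x"
  note q = vspace_val N
  have N_iff: "w \<in> N s \<longleftrightarrow> w \<in> carrier (val T s) \<and> ?E s w = \<zero>\<^bsub>val T s\<^esub>" for s w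
  proof
    assume w: "w \<in> carrier (val T s) \<and> ?E s w = \<zero>\<^bsub>val T s\<^esub>"
    then have "w \<ominus>\<^bsub>val T s\<^esub> ?E s w = w" by (simp add: a_minus_def)
    then show "w \<in> N s" using diff w by metis
  qed (use kill submodule_carrier[OF N] in blast)
  \<comment> \<open>Stability of \<open>N\<close> under the action is automatic: it is the kernel of
    a natural endomorphism.\<close>
  have act_N: "act T s s' \<mu> w \<in> N s'" if "w \<in> N s" for s s' \<mu> w
    using that linear_map_closed[OF linear_act] linear_map_zero[OF linear_act vspace_val vspace_val]
    by (simp add: N_iff ga_act_natural)
  show ?thesis
  proof (rule Ext_retract[where \<iota> = "\<lambda>s X. the_elem (?E s ` X)" and \<pi> = "\<lambda>s w. N s +>\<^bsub>val T s\<^esub> w"])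
    have "act (quot_bifun T N) s s' \<mu> (N s +>\<^bsub>val T s\<^esub> w) = N s' +>\<^bsub>val T s'\<^esub> act T s s' \<mu> w"
      if "w \<in> carrier (val T s)" for s s' \<mu> w
      using quot_map_coset[OF q q linear_act act_N that] by (simp add: quot_bifun_def)
    then show "N s' +>\<^bsub>val T s'\<^esub> act T s s' \<mu> w = act (quot_bifun T N) s s' \<mu> (N s +>\<^bsub>val T s\<^esub> w)"
      if "w \<in> carrier (val T s)" for s s' \<mu> w
      using that by simp
    fix s
    have val_B: "val (quot_bifun T N) s = quot_space (val T s) (N s)" by (simp add: quot_bifun_def)
    show "vspace (val (quot_bifun T N) s)"
      unfolding val_B by (rule vspace_quot_space[OF q])
    show "linear_map (val T s) (val (quot_bifun T N) s) (\<lambda>w. N s +>\<^bsub>val T s\<^esub> w)"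
      unfolding val_B by (rule linear_map_coset[OF q])
    show "linear_map (val (quot_bifun T N) s) (val T s) (\<lambda>X. the_elem (?E s ` X))"
      unfolding val_B by (rule linear_map_the_elem[OF q vspace_val val.linear_ga_act kill])
    show E: "the_elem (?E s ` (N s +>\<^bsub>val T s\<^esub> w)) = ?E s w" if "w \<in> carrier (val T s)" for w
      by (rule the_elem_coset[OF q vspace_val val.linear_ga_act kill that])
    fix X assume "X \<in> carrier (val (quot_bifun T N) s)"
    then obtain w where w: "w \<in> carrier (val T s)" "X = N s +>\<^bsub>val T s\<^esub> w"
      by (auto simp: val_B carrier_quot_space[OF q])
    have "N s +>\<^bsub>val T s\<^esub> ?E s w = N s +>\<^bsub>val T s\<^esub> w"
      using diff[OF w(1)] coset_eq_iff[OF q w(1) val.ga_act_closed[OF w(1)], of x] by simp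
    then show "N s +>\<^bsub>val T s\<^esub> the_elem (?E s ` X) = X"
      using w by (simp add: E)
  qed
qed

end

section \<open>Characters and Young ideals\<close>

lemma line_simps [simp]:
  "carrier line = UNIV" "x \<oplus>\<^bsub>line\<^esub> y = x + y" "x \<odot>\<^bsub>line\<^esub> y = x * y" "\<zero>\<^bsub>line\<^esub> = 0"
  by (simp_all add: line_def)

lemma vspace_line: "vspace line"
  by (rule vspaceI) (simp_all add: algebra_simps)

lemma finsum_line:
  fixes g :: "'x \<Rightarrow> 'k::field"
  assumes "finite A" shows "finsum line g A = sum g A"
  using assms
proof (induction rule: finite_induct)
  case empty
  interpret module scalars "line :: ('k, 'k) module" by (rule vspace_line)
  show ?case by simp
next
  case (insert a A)
  interpret module scalars "line :: ('k, 'k) module" by (rule vspace_line)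
  show ?case using insert by simp
qed

text \<open>The condition \<open>square\<close> fits characters with values 1 and -1, the trivial
  one and the sign, and gives a permutation and its inverse the same value. The scalar
  \<open>c\<close> is the inverse of n!.\<close>

locale perm_character =
  fixes n :: nat and \<chi> :: "(nat \<Rightarrow> nat) \<Rightarrow> 'k::field" and c :: 'k
  assumes mult: "\<sigma> \<in> perms n \<Longrightarrow> \<pi> \<in> perms n \<Longrightarrow> \<chi> (\<sigma> \<circ> \<pi>) = \<chi> \<sigma> * \<chi> \<pi>"
    and square: "\<sigma> \<in> perms n \<Longrightarrow> \<chi> \<sigma> * \<chi> \<sigma> = 1"
    and c: "c * of_nat (fact n) = 1"
begin

lemma id_eq: "\<chi> id = 1"
  using mult[of id id] square[of id] by (simp add: permutes_id)

lemma pinv_eq: "\<sigma> \<in> perms n \<Longrightarrow> \<chi> (pinv \<sigma>) = \<chi> \<sigma>"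
  using mult[OF perms_pinv, of \<sigma> \<sigma>] square[of \<sigma>] id_eq
  by (simp add: permutes_inv_o) (metis mult.assoc mult.right_neutral mult_1)

lemma square_left: "\<sigma> \<in> perms n \<Longrightarrow> \<chi> \<sigma> * (\<chi> \<sigma> * x) = x"
  by (simp add: square flip: mult.assoc)

lemma sum_average: "(\<Sum>\<sigma>\<in>perms n. c * x) = x"
  using c by (simp add: card_permutations[OF refl] mult.commute mult.left_commute)

text \<open>The section sends 1 to the character idempotent, with coefficients
  \<open>c * \<chi> \<sigma>\<close>. It acts on the generator by n! summands that all equal
  \<open>c\<close> times the generator, since \<chi>(\<sigma>) occurs squared.\<close>

lemma split_cyclic_line:
  assumes "\<And>\<sigma> x. \<sigma> \<in> perms n \<Longrightarrow> \<rho> \<sigma> x = \<chi> \<sigma> * x"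
  shows "split_cyclic_module n line \<rho> (\<lambda>m \<sigma>. m * (c * \<chi> \<sigma>)) 1"
proof -
  interpret L: module scalars "line :: ('k, 'k) module" by (rule vspace_line)
  show ?thesis
  proof (unfold_locales)
    fix m :: 'k
    have "(\<Sum>\<sigma>\<in>perms n. m * (c * \<chi> \<sigma>) * \<rho> \<sigma> 1) = (\<Sum>\<sigma>\<in>perms n. c * m)"
      by (rule sum.cong[OF refl]) (simp add: assms square algebra_simps square_left)
    then show "(\<Oplus>\<^bsub>line\<^esub>\<sigma>\<in>perms n. m * (c * \<chi> \<sigma>) \<odot>\<^bsub>line\<^esub> \<rho> \<sigma> 1) = m"
      by (simp only: finsum_line[OF finite_perms] line_simps sum_average)
  qed (auto simp: assms mult algebra_simps square_left)
qed

end

text \<open>The character idempotent absorbs a permutation \<pi> on its right at the cost of the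
  factor \<chi>(\<pi>), which equals its own inverse.\<close>

lemma (in perm_action) ga_act_character:
  assumes "perm_character n \<chi> c" "\<pi> \<in> perms n" "w \<in> carrier W"
  shows "ga_act n W \<tau> (\<lambda>\<sigma>. c * \<chi> \<sigma>) (\<tau> \<pi> w) = \<chi> \<pi> \<odot>\<^bsub>W\<^esub> ga_act n W \<tau> (\<lambda>\<sigma>. c * \<chi> \<sigma>) w"
proof -
  interpret perm_character n \<chi> c by fact
  have "ga_act n W \<tau> (\<lambda>\<sigma>. c * \<chi> \<sigma>) (\<tau> \<pi> w) = ga_act n W \<tau> (\<lambda>\<sigma>. \<chi> \<pi> * (c * \<chi> \<sigma>)) w"
    using assms(2) by (intro ga_act_perm[OF assms(2,3), symmetric])
      (simp add: mult square[OF assms(2)] mult.commute mult.left_commute)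
  then show ?thesis by (simp add: ga_act_smult[OF assms(3)])
qed

text \<open>Modulo \<open>N\<close> every \<chi>(\<sigma>) \<sigma> w equals w, so their average is
  w modulo \<open>N\<close> as well.\<close>

lemma (in perm_action) ga_act_character_diff:
  assumes "perm_character n \<chi> c" and N: "submodule N scalars W" and w: "w \<in> carrier W"
    and diff: "\<And>\<sigma>. \<sigma> \<in> perms n \<Longrightarrow> w \<ominus>\<^bsub>W\<^esub> \<chi> \<sigma> \<odot>\<^bsub>W\<^esub> \<tau> \<sigma> w \<in> N"
  shows "w \<ominus>\<^bsub>W\<^esub> ga_act n W \<tau> (\<lambda>\<sigma>. c * \<chi> \<sigma>) w \<in> N"
proof -
  interpret perm_character n \<chi> c by fact
  let ?Q = "quot_space W N"
  note q = vspace_W N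
  interpret Q: module scalars ?Q by (rule vspace_quot_space[OF q])
  note coset = linear_map_coset[OF q]
  note cl = linear_map_closed[OF coset w]
  have smult: "(\<Oplus>\<^bsub>?Q\<^esub>a\<in>A. f a \<odot>\<^bsub>?Q\<^esub> v) = (\<Sum>a\<in>A. f a) \<odot>\<^bsub>?Q\<^esub> v"
    if "finite A" "v \<in> carrier ?Q" for A v f
    using that by (induction A rule: finite_induct)
      (simp_all add: Pi_iff Q.smult_l_distr[simplified] vspace_smult_zero[OF vspace_quot_space[OF q]])
  have "N +>\<^bsub>W\<^esub> ga_act n W \<tau> (\<lambda>\<sigma>. c * \<chi> \<sigma>) w = (\<Oplus>\<^bsub>?Q\<^esub>\<sigma>\<in>perms n. N +>\<^bsub>W\<^esub> ((c * \<chi> \<sigma>) \<odot>\<^bsub>W\<^esub> \<tau> \<sigma> w))"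
    unfolding ga_act_def
    by (rule linear_map_finsum[OF coset vspace_W vspace_quot_space[OF q] finite_perms]) (simp add: closed w)
  also have "\<dots> = (\<Oplus>\<^bsub>?Q\<^esub>\<sigma>\<in>perms n. c \<odot>\<^bsub>?Q\<^esub> (N +>\<^bsub>W\<^esub> w))"
  proof (rule Q.M.finsum_cong'[OF refl])
    fix \<sigma> assume \<sigma>: "\<sigma> \<in> perms n"
    have "N +>\<^bsub>W\<^esub> w = N +>\<^bsub>W\<^esub> (\<chi> \<sigma> \<odot>\<^bsub>W\<^esub> \<tau> \<sigma> w)"
      using diff[OF \<sigma>] closed[OF \<sigma> w] by (simp add: coset_eq_iff[OF q w])
    then show "N +>\<^bsub>W\<^esub> ((c * \<chi> \<sigma>) \<odot>\<^bsub>W\<^esub> \<tau> \<sigma> w) = c \<odot>\<^bsub>?Q\<^esub> (N +>\<^bsub>W\<^esub> w)"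
      using closed[OF \<sigma> w] by (simp add: W.smult_assoc1[simplified] flip: quot_space_smult[OF q])
  qed (use cl in simp)
  also have "\<dots> = (\<Sum>\<sigma>\<in>perms n. c) \<odot>\<^bsub>?Q\<^esub> (N +>\<^bsub>W\<^esub> w)"
    by (rule smult[OF finite_perms cl])
  also have "\<dots> = N +>\<^bsub>W\<^esub> w"
    using sum_average[of 1] Q.smult_one[OF cl] by simp
  finally show ?thesis
    using w ga_act_closed[OF w, of "\<lambda>\<sigma>. c * \<chi> \<sigma>"] by (metis coset_eq_iff[OF q])
qed


subsection \<open>The group algebra\<close>

lemma ga_mult_outside: "\<pi> \<notin> perms n \<Longrightarrow> ga_mult n x y \<pi> = 0"
  by (simp add: ga_mult_def)

lemma ga_mult_apply: "\<pi> \<in> perms n \<Longrightarrow> ga_mult n x y \<pi> = (\<Sum>\<sigma>\<in>perms n. x \<sigma> * y (pinv \<sigma> \<circ> \<pi>))"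
  by (simp add: ga_mult_def)

lemma ga_mult_closed: "ga_mult n x y \<in> carrier (group_algebra n)"
  by (simp add: carrier_fun_space ga_mult_outside)

lemma ga_elem_mult:
  assumes "\<sigma> \<in> perms n" "\<beta> \<in> perms n"
  shows "ga_mult n (ga_elem \<sigma>) y \<beta> = y (pinv \<sigma> \<circ> \<beta>)"
proof -
  have "(\<Sum>\<pi>\<in>perms n. ga_elem \<sigma> \<pi> * y (pinv \<pi> \<circ> \<beta>)) = (\<Sum>\<pi>\<in>perms n. if \<pi> = \<sigma> then y (pinv \<pi> \<circ> \<beta>) else 0)"
    by (rule sum.cong) (auto simp: ga_elem_def)
  then show ?thesis using assms by (simp add: ga_mult_def sum.delta[OF finite_perms])
qed

lemma sum_perms_comp_left:
  assumes "\<rho> \<in> perms n" shows "(\<Sum>\<sigma>\<in>perms n. f (\<rho> \<circ> \<sigma>)) = (\<Sum>\<sigma>\<in>perms n. f \<sigma>)"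
proof (rule sum.reindex_bij_witness[of _ "\<lambda>\<sigma>. pinv \<rho> \<circ> \<sigma>" "\<lambda>\<sigma>. \<rho> \<circ> \<sigma>"])
  fix \<sigma>
  show "pinv \<rho> \<circ> (\<rho> \<circ> \<sigma>) = \<sigma>" "\<rho> \<circ> (pinv \<rho> \<circ> \<sigma>) = \<sigma>"
    using assms by (simp_all add: permutes_inv_o flip: comp_assoc)
qed (use assms in \<open>auto simp: permutes_compose permutes_inv\<close>)

lemma sum_perms_pinv: "(\<Sum>\<sigma>\<in>perms n. f (pinv \<sigma>)) = (\<Sum>\<sigma>\<in>perms n. f \<sigma>)"
  by (rule sum.reindex_bij_witness[of _ pinv pinv]) (auto simp: permutes_inv permutes_inv_inv)

lemma pinv_comp: "\<sigma> \<in> perms n \<Longrightarrow> \<rho> \<in> perms n \<Longrightarrow> pinv (\<sigma> \<circ> \<rho>) = pinv \<rho> \<circ> pinv \<sigma>"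
  by (simp add: o_inv_distrib permutes_bij)

lemma ga_mult_assoc: "ga_mult n (ga_mult n x y) z = ga_mult n x (ga_mult n y z)"
proof
  fix \<pi>
  show "ga_mult n (ga_mult n x y) z \<pi> = ga_mult n x (ga_mult n y z) \<pi>"
  proof (cases "\<pi> \<in> perms n")
    case True
    have "(\<Sum>\<sigma>\<in>perms n. y (pinv \<rho> \<circ> \<sigma>) * z (pinv \<sigma> \<circ> \<pi>)) =
        (\<Sum>\<sigma>\<in>perms n. y \<sigma> * z (pinv \<sigma> \<circ> (pinv \<rho> \<circ> \<pi>)))" if \<rho>: "\<rho> \<in> perms n" for \<rho>
    proof -
      have "(\<Sum>\<sigma>\<in>perms n. y (pinv \<rho> \<circ> \<sigma>) * z (pinv \<sigma> \<circ> \<pi>)) =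
          (\<Sum>\<sigma>\<in>perms n. y (pinv \<rho> \<circ> (\<rho> \<circ> \<sigma>)) * z (pinv (\<rho> \<circ> \<sigma>) \<circ> \<pi>))"
        by (rule sum_perms_comp_left[OF \<rho>, symmetric])
      also have "\<dots> = (\<Sum>\<sigma>\<in>perms n. y \<sigma> * z (pinv \<sigma> \<circ> (pinv \<rho> \<circ> \<pi>)))"
        using \<rho> by (intro sum.cong) (auto simp: pinv_comp permutes_inv_o comp_assoc simp flip: comp_assoc[of "pinv \<rho>" \<rho>])
      finally show ?thesis .
    qed
    then have "(\<Sum>\<rho>\<in>perms n. x \<rho> * (\<Sum>\<sigma>\<in>perms n. y (pinv \<rho> \<circ> \<sigma>) * z (pinv \<sigma> \<circ> \<pi>))) =
        (\<Sum>\<rho>\<in>perms n. x \<rho> * ga_mult n y z (pinv \<rho> \<circ> \<pi>))"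
      using True by (intro sum.cong) (auto simp: ga_mult_def permutes_compose permutes_inv)
    moreover have "(\<Sum>\<sigma>\<in>perms n. (\<Sum>\<rho>\<in>perms n. x \<rho> * y (pinv \<rho> \<circ> \<sigma>)) * z (pinv \<sigma> \<circ> \<pi>)) =
        (\<Sum>\<rho>\<in>perms n. x \<rho> * (\<Sum>\<sigma>\<in>perms n. y (pinv \<rho> \<circ> \<sigma>) * z (pinv \<sigma> \<circ> \<pi>)))"
      unfolding sum_distrib_right sum_distrib_left by (subst sum.swap) (simp add: mult.assoc)
    moreover have "ga_mult n (ga_mult n x y) z \<pi> =
        (\<Sum>\<sigma>\<in>perms n. (\<Sum>\<rho>\<in>perms n. x \<rho> * y (pinv \<rho> \<circ> \<sigma>)) * z (pinv \<sigma> \<circ> \<pi>))"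
      unfolding ga_mult_apply[OF True] by (rule sum.cong) (simp_all add: ga_mult_apply)
    ultimately show ?thesis by (simp only: ga_mult_apply[OF True])
  qed (simp add: ga_mult_outside)
qed

lemma ga_mult_distrib_right: "ga_mult n (\<lambda>\<sigma>. x \<sigma> + y \<sigma>) z = (\<lambda>\<sigma>. ga_mult n x z \<sigma> + ga_mult n y z \<sigma>)"
  and ga_mult_smult_left: "ga_mult n (\<lambda>\<sigma>. a * x \<sigma>) z = (\<lambda>\<sigma>. a * ga_mult n x z \<sigma>)"
  and ga_mult_smult_right: "ga_mult n x (\<lambda>\<sigma>. a * z \<sigma>) = (\<lambda>\<sigma>. a * ga_mult n x z \<sigma>)"
  by (auto simp: ga_mult_def fun_eq_iff algebra_simps sum.distrib sum_distrib_left intro!: sum.cong)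

context
  fixes lam :: "nat list" and t :: "nat \<times> nat \<Rightarrow> nat"
begin

lemma carrier_young_ideal: "carrier (young_ideal lam t) =
    (\<lambda>x. ga_mult (sum_list lam) x (young_c lam t)) ` carrier (group_algebra (sum_list lam))"
  by (simp add: young_ideal_def)

lemma young_ideal_outside: "x \<in> carrier (young_ideal lam t) \<Longrightarrow> \<sigma> \<notin> perms (sum_list lam) \<Longrightarrow> x \<sigma> = 0"
  by (auto simp: carrier_young_ideal ga_mult_outside)

lemma young_ideal_mult: "x \<in> carrier (young_ideal lam t) \<Longrightarrow> ga_mult (sum_list lam) y x \<in> carrier (young_ideal lam t)"
  by (auto simp: carrier_young_ideal ga_mult_closed simp flip: ga_mult_assoc)

lemma submodule_young_ideal: "submodule (carrier (young_ideal lam t)) scalars (group_algebra (sum_list lam))"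
  unfolding carrier_young_ideal
  by (rule submodule_image[OF vspace_fun_space vspace_fun_space])
    (rule linear_mapI, auto simp: ga_mult_closed ga_mult_distrib_right ga_mult_smult_left)

lemma vspace_young_ideal: "vspace (young_ideal lam t)"
  using vspace_submodule[OF vspace_fun_space submodule_young_ideal]
  by (simp add: young_ideal_def)

text \<open>The right action of \<sigma> is left multiplication by its inverse, so the map inverting
  all group elements is right linear into the group algebra. With \<open>e\<close> as generator,
  \<open>section_gen\<close> becomes the sum of x(\<sigma>^-1) \<sigma>^-1 e over all \<sigma>,
  which is x e = x.\<close>

lemma split_cyclic_young_ideal:
  assumes "e \<in> carrier (young_ideal lam t)" "\<And>x. x \<in> carrier (young_ideal lam t) \<Longrightarrow> ga_mult (sum_list lam) x e = x"
  shows "split_cyclic_module (sum_list lam) (young_ideal lam t) (young_ract lam) (\<lambda>x \<sigma>. x (pinv \<sigma>)) e"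
proof -
  have ops: "x \<oplus>\<^bsub>young_ideal lam t\<^esub> y = (\<lambda>\<sigma>. x \<sigma> + y \<sigma>)" "a \<odot>\<^bsub>young_ideal lam t\<^esub> x = (\<lambda>\<sigma>. a * x \<sigma>)" for x y a
    by (simp_all add: young_ideal_def)
  interpret Lm: module scalars "young_ideal lam t" by (rule vspace_young_ideal)
  have cl: "young_ract lam \<sigma> x \<in> carrier (young_ideal lam t)" if "x \<in> carrier (young_ideal lam t)" for \<sigma> x
    using that by (simp add: young_ract_def young_ideal_mult)
  have eval: "linear_map (young_ideal lam t) (line :: ('a, 'a) module) (\<lambda>x. x \<beta>)" for \<beta>
    by (rule linear_mapI) (simp_all add: ops)
  show ?thesis
  proof unfold_locales
    fix \<sigma> \<alpha> x assume "\<sigma> \<in> perms (sum_list lam)" "x \<in> carrier (young_ideal lam t)" "\<alpha> \<in> perms (sum_list lam)"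
    then show "young_ract lam \<sigma> x (pinv (\<alpha> \<circ> \<sigma>)) = x (pinv \<alpha>)"
      by (simp add: young_ract_def ga_elem_mult permutes_inv permutes_compose permutes_inv_inv
          pinv_comp permutes_inv_o flip: comp_assoc)
  next
    fix x :: "(nat \<Rightarrow> nat) \<Rightarrow> 'a" assume x: "x \<in> carrier (young_ideal lam t)"
    let ?S = "\<Oplus>\<^bsub>young_ideal lam t\<^esub>\<sigma>\<in>perms (sum_list lam). x (pinv \<sigma>) \<odot>\<^bsub>young_ideal lam t\<^esub> young_ract lam \<sigma> e"
    have S: "?S \<in> carrier (young_ideal lam t)" by (rule Lm.M.finsum_closed) (simp add: cl assms(1))
    show "?S = x"
    proof
      fix \<beta>
      show "?S \<beta> = x \<beta>"
      proof (cases "\<beta> \<in> perms (sum_list lam)")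
        case True
        have "?S \<beta> = (\<Oplus>\<^bsub>line\<^esub>\<sigma>\<in>perms (sum_list lam). (x (pinv \<sigma>) \<odot>\<^bsub>young_ideal lam t\<^esub> young_ract lam \<sigma> e) \<beta>)"
          by (rule linear_map_finsum[OF eval vspace_young_ideal vspace_line finite_perms]) (simp add: cl assms(1))
        also have "\<dots> = (\<Sum>\<sigma>\<in>perms (sum_list lam). x (pinv \<sigma>) * e (pinv (pinv \<sigma>) \<circ> \<beta>))"
          unfolding finsum_line[OF finite_perms] using True
          by (intro sum.cong) (auto simp: ops young_ract_def ga_elem_mult permutes_inv)
        also have "\<dots> = (\<Sum>\<sigma>\<in>perms (sum_list lam). x \<sigma> * e (pinv \<sigma> \<circ> \<beta>))" by (rule sum_perms_pinv)
        also have "\<dots> = ga_mult (sum_list lam) x e \<beta>" using True by (simp add: ga_mult_def)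
        finally show ?thesis using assms(2)[OF x] by simp
      qed (simp add: young_ideal_outside[OF S] young_ideal_outside[OF x])
    qed
  qed (use assms(1) cl in \<open>auto simp: ops\<close>)
qed

end

section \<open>Right units of Young ideals by averaging over the group\<close>

lemma ga_mult_sum_right: "finite A \<Longrightarrow>
    ga_mult n x (\<lambda>\<sigma>. \<Sum>a\<in>A. z a \<sigma>) = (\<lambda>\<sigma>. \<Sum>a\<in>A. ga_mult n x (z a) \<sigma>)"
proof (induction rule: finite_induct)
  case empty
  then show ?case by (simp add: ga_mult_def fun_eq_iff)
next
  case (insert a A)
  have "ga_mult n x (\<lambda>\<sigma>. y \<sigma> + z \<sigma>) = (\<lambda>\<sigma>. ga_mult n x y \<sigma> + ga_mult n x z \<sigma>)" for y z
    by (auto simp: ga_mult_def fun_eq_iff algebra_simps sum.distrib)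
  then show ?case using insert by simp
qed

lemma ga_elem_comp: "\<sigma> \<in> perms n \<Longrightarrow> \<pi> \<in> perms n \<Longrightarrow> ga_mult n (ga_elem \<sigma>) (ga_elem \<pi>) = ga_elem (\<sigma> \<circ> \<pi>)"
proof
  fix \<beta> assume *: "\<sigma> \<in> perms n" "\<pi> \<in> perms n"
  have "pinv \<sigma> \<circ> \<beta> = \<pi> \<longleftrightarrow> \<beta> = \<sigma> \<circ> \<pi>"
    using * by (metis comp_assoc id_comp mem_Collect_eq permutes_inv_o)
  then show "ga_mult n (ga_elem \<sigma>) (ga_elem \<pi>) \<beta> = (ga_elem (\<sigma> \<circ> \<pi>) \<beta> :: 'a)"
  proof (cases "\<beta> \<in> perms n")
    case True
    show ?thesis unfolding ga_elem_mult[OF *(1) True] using \<open>_ \<longleftrightarrow> _\<close> by (simp add: ga_elem_def)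
  next
    case False
    then show ?thesis using perms_comp[OF *] by (auto simp: ga_mult_outside ga_elem_def)
  qed
qed

lemma ga_mult_expand_left:
  "ga_mult n x y = (\<lambda>\<beta>. \<Sum>\<tau>\<in>perms n. x \<tau> * ga_mult n (ga_elem \<tau>) y \<beta>)"
proof
  fix \<beta> show "ga_mult n x y \<beta> = (\<Sum>\<tau>\<in>perms n. x \<tau> * ga_mult n (ga_elem \<tau>) y \<beta>)"
    by (cases "\<beta> \<in> perms n") (simp_all add: ga_mult_outside ga_mult_apply[of \<beta> n x] ga_elem_mult)
qed

lemma ga_elem_id_mult: "x \<in> carrier (group_algebra n) \<Longrightarrow> ga_mult n (ga_elem id) x = x"
proof
  fix \<beta> assume "x \<in> carrier (group_algebra n)"
  then show "ga_mult n (ga_elem id) x \<beta> = x \<beta>"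
    by (cases "\<beta> \<in> perms n")
      (auto simp: ga_elem_mult ga_mult_outside permutes_id carrier_fun_space inv_id)
qed

text \<open>The product is expanded in the basis of group elements so that a projection known only
  to be linear can be taken through it term by term.\<close>

lemma ga_mult_elem_expand:
  assumes "\<sigma> \<in> perms n" "x \<in> carrier (group_algebra n)"
  shows "(\<lambda>\<beta>. \<Sum>\<tau>\<in>perms n. x \<tau> * ga_elem (\<sigma> \<circ> \<tau>) \<beta>) = ga_mult n (ga_elem \<sigma>) x"
proof -
  have "x = (\<lambda>\<beta>. \<Sum>\<tau>\<in>perms n. x \<tau> * ga_elem \<tau> \<beta>)"
  proof
    fix \<beta>
    have "(\<Sum>\<tau>\<in>perms n. x \<tau> * ga_elem \<tau> \<beta>) = (\<Sum>\<tau>\<in>perms n. if \<tau> = \<beta> then x \<tau> else 0)"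
      by (rule sum.cong) (auto simp: ga_elem_def)
    then show "x \<beta> = (\<Sum>\<tau>\<in>perms n. x \<tau> * ga_elem \<tau> \<beta>)"
      using assms(2) by (auto simp: sum.delta[OF finite_perms] carrier_fun_space)
  qed
  then have "ga_mult n (ga_elem \<sigma>) x = ga_mult n (ga_elem \<sigma>) (\<lambda>\<beta>. \<Sum>\<tau>\<in>perms n. x \<tau> * ga_elem \<tau> \<beta>)"
    by simp
  also have "\<dots> = (\<lambda>\<beta>. \<Sum>\<tau>\<in>perms n. x \<tau> * ga_mult n (ga_elem \<sigma>) (ga_elem \<tau>) \<beta>)"
    by (simp add: ga_mult_sum_right finite_perms ga_mult_smult_right)
  also have "\<dots> = (\<lambda>\<beta>. \<Sum>\<tau>\<in>perms n. x \<tau> * ga_elem (\<sigma> \<circ> \<tau>) \<beta>)"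
    by (intro ext sum.cong) (simp_all add: ga_elem_comp[OF assms(1)])
  finally show ?thesis by simp
qed

lemma sum_fun_apply: "(\<Sum>a\<in>A. f a) x = (\<Sum>a\<in>A. f a x)"
  by (induction A rule: infinite_finite_induct) (simp_all add: zero_fun_def)

text \<open>Maschke: averaging a linear projection \<open>g\<close> onto the left ideal over the group makes it
  equivariant, hence right multiplication by an element \<open>e\<close> of the ideal.\<close>

lemma ex_young_ideal_generator:
  fixes c :: "'k::field"
  assumes c: "c * of_nat (fact (sum_list lam)) = 1"
  shows "\<exists>e\<in>carrier (young_ideal lam t :: ('k, _) module).
    \<forall>x\<in>carrier (young_ideal lam t). ga_mult (sum_list lam) x e = x"
proof -
  let ?N = "sum_list lam" and ?L = "carrier (young_ideal lam t :: ('k, _) module)"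
  let ?s = "\<lambda>(a::'k) (f :: (nat \<Rightarrow> nat) \<Rightarrow> 'k) x. a * f x"
  \<comment> \<open>The ambient space consists of all functions on maps of naturals with pointwise
    operations. Subspaces of an abstract vector space have complements, so the inclusion of the
    ideal gets a linear left inverse \<open>g\<close>, a projection onto the ideal.\<close>
  interpret vs: vector_space ?s
    by unfold_locales (auto simp: fun_eq_iff algebra_simps)
  interpret vp: vector_space_pair ?s ?s ..
  have ga: "?L \<subseteq> carrier (group_algebra ?N)"
    using submodule_carrier[OF submodule_young_ideal] by blast
  have sub: "vs.subspace ?L"
    unfolding vs.subspace_def
    using submodule_zero[OF submodule_young_ideal[of lam t, where 'a = 'k]]
      submodule_add[OF submodule_young_ideal[of lam t, where 'a = 'k]]
      submodule_smult[OF submodule_young_ideal[of lam t, where 'a = 'k]]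
    by (simp add: zero_fun_def plus_fun_def)
  obtain g where g: "range g \<subseteq> ?L" "Vector_Spaces.linear ?s ?s g" "\<And>v. v \<in> ?L \<Longrightarrow> g v = v"
    using vp.linear_exists_left_inverse_on[OF vs.linear_id sub] by (auto simp: id_def)
  interpret g: Vector_Spaces.linear ?s ?s g by (rule g(2))
  have g_sum: "g (\<lambda>\<beta>. \<Sum>\<tau>\<in>perms ?N. x \<tau> * v \<tau> \<beta>) = (\<lambda>\<beta>. \<Sum>\<tau>\<in>perms ?N. x \<tau> * g (v \<tau>) \<beta>)" for x v
  proof -
    have *: "(\<lambda>\<beta>. \<Sum>\<tau>\<in>perms ?N. x \<tau> * w \<tau> \<beta>) = (\<Sum>\<tau>\<in>perms ?N. ?s (x \<tau>) (w \<tau>))" for w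
      by (rule ext) (simp add: sum_fun_apply)
    show ?thesis unfolding * by (simp add: g.sum g.scale)
  qed
  \<comment> \<open>This is G(1) for the averaged projection G(y) = c times the sum of \<sigma>
    g(\<sigma>^-1 y) over all \<sigma>.\<close>
  define e where "e = (\<lambda>\<beta>. c * (\<Sum>\<sigma>\<in>perms ?N. ga_mult ?N (ga_elem \<sigma>) (g (ga_elem (pinv \<sigma>))) \<beta>))"
  have "e = ?s c (\<Sum>\<sigma>\<in>perms ?N. ga_mult ?N (ga_elem \<sigma>) (g (ga_elem (pinv \<sigma>))))"
    by (rule ext) (simp add: e_def sum_fun_apply)
  then have "e \<in> ?L"
    using g(1) by (auto intro!: vs.subspace_scale[OF sub] vs.subspace_sum[OF sub] young_ideal_mult)
  moreover have "ga_mult ?N x e = x" if x: "x \<in> ?L" for x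
  proof -
    have xg: "x \<in> carrier (group_algebra ?N)" using x ga by blast
    \<comment> \<open>Equivariance, \<tau> G(1) = G(\<tau>): the sum is reindexed by left
      translation with \<tau>.\<close>
    have elem: "ga_mult ?N (ga_elem \<tau>) e = (\<lambda>\<beta>. c * (\<Sum>\<sigma>\<in>perms ?N. ga_mult ?N (ga_elem \<sigma>) (g (ga_elem (pinv \<sigma> \<circ> \<tau>))) \<beta>))"
      if \<tau>: "\<tau> \<in> perms ?N" for \<tau>
    proof
      fix \<beta>
      have "(\<Sum>\<sigma>\<in>perms ?N. ga_mult ?N (ga_elem \<tau>) (ga_mult ?N (ga_elem \<sigma>) (g (ga_elem (pinv \<sigma>)))) \<beta>) =
          (\<Sum>\<sigma>\<in>perms ?N. ga_mult ?N (ga_elem (\<tau> \<circ> \<sigma>)) (g (ga_elem (pinv (\<tau> \<circ> \<sigma>) \<circ> \<tau>))) \<beta>)"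
        using \<tau> by (intro sum.cong refl)
          (simp add: ga_elem_comp pinv_comp comp_assoc permutes_inv_o flip: ga_mult_assoc)
      also have "\<dots> = (\<Sum>\<sigma>\<in>perms ?N. ga_mult ?N (ga_elem \<sigma>) (g (ga_elem (pinv \<sigma> \<circ> \<tau>))) \<beta>)"
        by (rule sum_perms_comp_left[OF \<tau>])
      finally show "ga_mult ?N (ga_elem \<tau>) e \<beta> = c * (\<Sum>\<sigma>\<in>perms ?N. ga_mult ?N (ga_elem \<sigma>) (g (ga_elem (pinv \<sigma> \<circ> \<tau>))) \<beta>)"
        by (simp add: e_def ga_mult_smult_right ga_mult_sum_right finite_perms)
    qed
    \<comment> \<open>For fixed \<sigma> the sum over \<tau> reassembles \<sigma> g(\<sigma>^-1 x).
      The ideal is stable under left multiplication, so \<open>g\<close> fixes \<sigma>^-1 x and the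
      value is x.\<close>
    have avg: "(\<Sum>\<tau>\<in>perms ?N. x \<tau> * ga_mult ?N (ga_elem \<sigma>) (g (ga_elem (pinv \<sigma> \<circ> \<tau>))) \<beta>) = x \<beta>"
      if \<sigma>: "\<sigma> \<in> perms ?N" for \<sigma> \<beta>
    proof -
      have "(\<lambda>\<beta>. \<Sum>\<tau>\<in>perms ?N. x \<tau> * ga_mult ?N (ga_elem \<sigma>) (g (ga_elem (pinv \<sigma> \<circ> \<tau>))) \<beta>) =
          ga_mult ?N (ga_elem \<sigma>) (g (\<lambda>\<beta>. \<Sum>\<tau>\<in>perms ?N. x \<tau> * ga_elem (pinv \<sigma> \<circ> \<tau>) \<beta>))"
        by (simp add: g_sum ga_mult_sum_right finite_perms ga_mult_smult_right)
      also have "\<dots> = ga_mult ?N (ga_elem \<sigma>) (g (ga_mult ?N (ga_elem (pinv \<sigma>)) x))"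
        by (simp only: ga_mult_elem_expand[OF perms_pinv[OF \<sigma>] xg])
      also have "\<dots> = ga_mult ?N (ga_elem \<sigma>) (ga_mult ?N (ga_elem (pinv \<sigma>)) x)"
        by (simp add: g(3) young_ideal_mult[OF x])
      also have "\<dots> = x"
        using \<sigma> by (simp add: ga_elem_comp[OF \<sigma> perms_pinv[OF \<sigma>]] permutes_inv_o ga_elem_id_mult[OF xg]
            flip: ga_mult_assoc)
      finally show ?thesis by (rule fun_cong)
    qed
    show ?thesis
    proof
      fix \<beta>
      have "ga_mult ?N x e \<beta> = (\<Sum>\<tau>\<in>perms ?N. x \<tau> * ga_mult ?N (ga_elem \<tau>) e \<beta>)"
        by (subst ga_mult_expand_left) simp
      also have "\<dots> = c * (\<Sum>\<tau>\<in>perms ?N. \<Sum>\<sigma>\<in>perms ?N. x \<tau> * ga_mult ?N (ga_elem \<sigma>) (g (ga_elem (pinv \<sigma> \<circ> \<tau>))) \<beta>)"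
        by (simp add: elem sum_distrib_left mult.left_commute cong: sum.cong_simp)
      also have "\<dots> = c * (\<Sum>\<sigma>\<in>perms ?N. x \<beta>)"
        by (subst sum.swap) (simp add: avg cong: sum.cong_simp)
      also have "\<dots> = x \<beta>"
        using c by (simp add: card_permutations[OF refl] flip: mult.assoc)
      finally show "ga_mult ?N x e \<beta> = x \<beta>" .
    qed
  qed
  ultimately show ?thesis by blast
qed

text \<open>A symmetrizer whose coefficients form a character squares to n! times itself, so
  \<open>c\<close> times it is a right unit on the ideal. The averaging argument leaves its
  \<open>e\<close> undetermined; here the coefficients are needed, to agree with those of the
  section on \<open>line\<close>.\<close>

lemma split_cyclic_young_character:
  fixes \<chi> :: "(nat \<Rightarrow> nat) \<Rightarrow> 'k::field"
  assumes "perm_character (sum_list lam) \<chi> c"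
    and yc: "young_c lam t = (\<lambda>\<sigma>. if \<sigma> \<in> perms (sum_list lam) then \<chi> \<sigma> else 0)"
  obtains e where
    "split_cyclic_module (sum_list lam) (young_ideal lam t) (young_ract lam) (\<lambda>x \<sigma>. x (pinv \<sigma>)) e"
    "\<And>\<sigma>. \<sigma> \<in> perms (sum_list lam) \<Longrightarrow> e (pinv \<sigma>) = c * \<chi> \<sigma>"
proof -
  let ?N = "sum_list lam" and ?y = "young_c lam t :: (nat \<Rightarrow> nat) \<Rightarrow> 'k"
  interpret perm_character ?N \<chi> c by fact
  define e where "e = (\<lambda>\<sigma>. c * ?y \<sigma>)"
  have y_cl: "?y \<in> carrier (group_algebra ?N)" by (simp add: yc carrier_fun_space)
  have yy: "ga_mult ?N ?y ?y = (\<lambda>\<pi>. of_nat (fact ?N) * ?y \<pi>)"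
  proof
    fix \<pi> show "ga_mult ?N ?y ?y \<pi> = of_nat (fact ?N) * ?y \<pi>"
    proof (cases "\<pi> \<in> perms ?N")
      case True
      have "(\<Sum>\<sigma>\<in>perms ?N. ?y \<sigma> * ?y (pinv \<sigma> \<circ> \<pi>)) = (\<Sum>\<sigma>\<in>perms ?N. \<chi> \<pi>)"
        using True
        by (intro sum.cong refl) (simp add: yc permutes_compose permutes_inv mult pinv_eq square_left)
      then show ?thesis using True by (simp add: ga_mult_apply card_permutations[OF refl] yc)
    qed (simp add: ga_mult_outside yc)
  qed
  have "e = ga_mult ?N (\<lambda>\<sigma>. c * ga_elem id \<sigma>) ?y"
    by (simp only: ga_mult_smult_left ga_elem_id_mult[OF y_cl] e_def)
  then have "e \<in> carrier (young_ideal lam t)"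
    by (auto simp: carrier_young_ideal carrier_fun_space ga_elem_def permutes_id)
  moreover have "ga_mult ?N x e = x" if x: "x \<in> carrier (young_ideal lam t)" for x
  proof -
    obtain z where z: "x = ga_mult ?N z ?y" using x by (auto simp: carrier_young_ideal)
    have "ga_mult ?N x e = (\<lambda>\<sigma>. c * (of_nat (fact ?N) * x \<sigma>))"
      by (simp add: e_def ga_mult_smult_right z ga_mult_assoc yy)
    then show ?thesis using c by (simp flip: mult.assoc)
  qed
  ultimately show ?thesis
    by (intro that[OF split_cyclic_young_ideal])
      (auto simp: e_def yc permutes_inv pinv_eq)
qed

text \<open>Every permutation preserves the single row, while columns of length one are preserved by
  the identity alone; hence the column factor is the unit.\<close>

lemma young_c_row:
  assumes "young_tableau [n] t"
  shows "(young_c [n] t :: _ \<Rightarrow> 'k::field) = (\<lambda>\<sigma>. if \<sigma> \<in> perms n then 1 else 0)"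
proof -
  have t: "bij_betw t (cells [n]) {..<n}" using assms by (simp add: young_tableau_def)
  have rows: "t ` {c \<in> cells [n]. fst c = i} = (if i = 0 then {..<n} else {})" for i
  proof -
    have "{c \<in> cells [n]. fst c = i} = (if i = 0 then cells [n] else {})" by (auto simp: cells_def)
    then show ?thesis using t by (simp add: bij_betw_def)
  qed
  have row: "row_perms [n] t = perms n"
    by (simp add: row_perms_def rows permutes_image cong: conj_cong)
  have col: "col_perms [n] t = {id}"
  proof -
    have "\<sigma> = id" if \<sigma>: "\<sigma> \<in> col_perms [n] t" for \<sigma>
    proof
      fix x show "\<sigma> x = id x"
      proof (cases "x < n")
        case True
        then obtain j where j: "j < n" "x = t (0, j)"
          using t by (auto simp: bij_betw_def cells_def image_def set_eq_iff)
        have "{c \<in> cells [n]. snd c = j} = {(0, j)}" using j by (auto simp: cells_def)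
        then show ?thesis using \<sigma> j by (auto simp: col_perms_def dest!: spec[of _ j])
      next
        case False
        then show ?thesis using \<sigma> by (auto simp: col_perms_def permutes_not_in)
      qed
    qed
    moreover have "id \<in> col_perms [n] t" by (auto simp: col_perms_def permutes_id)
    ultimately show ?thesis by blast
  qed
  have b: "young_b [n] t = (ga_elem id :: _ \<Rightarrow> 'k)"
    by (auto simp: young_b_def ga_elem_def col)
  show ?thesis
    unfolding young_c_def b young_a_def row
  proof
    fix \<pi> show "ga_mult (sum_list [n]) (\<lambda>\<sigma>. if \<sigma> \<in> perms n then 1 else 0) (ga_elem id) \<pi> = (if \<pi> \<in> perms n then 1 else (0::'k))"
    proof (cases "\<pi> \<in> perms n")
      case True
      have "(\<Sum>\<sigma>\<in>perms n. ga_elem id (pinv \<sigma> \<circ> \<pi>)) = (\<Sum>\<sigma>\<in>perms n. if \<sigma> = \<pi> then 1 else (0::'k))"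
      proof (rule sum.cong[OF refl])
        fix \<sigma> assume \<sigma>: "\<sigma> \<in> perms n"
        have "pinv \<sigma> \<circ> \<pi> = id \<longleftrightarrow> \<sigma> = \<pi>"
          using \<sigma> by (metis comp_assoc comp_id id_comp mem_Collect_eq permutes_inv_o)
        then show "ga_elem id (pinv \<sigma> \<circ> \<pi>) = (if \<sigma> = \<pi> then 1 else (0::'k))" by (simp add: ga_elem_def)
      qed
      then show ?thesis using True by (simp add: ga_mult_apply sum.delta[OF finite_perms] cong: sum.cong_simp)
    qed (simp add: ga_mult_outside)
  qed
qed

text \<open>The transposed situation: rows of length one make the row factor the unit, and the
  signed sum runs over all permutations.\<close>

lemma young_c_column:
  assumes "young_tableau (replicate n 1) t"
  shows "(young_c (replicate n 1) t :: _ \<Rightarrow> 'k::field) = (\<lambda>\<sigma>. if \<sigma> \<in> perms n then of_int (sign \<sigma>) else 0)"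
proof -
  let ?l = "replicate n (1::nat)"
  have N: "sum_list ?l = n" by (simp add: sum_list_replicate)
  have t: "bij_betw t (cells ?l) {..<n}" using assms unfolding young_tableau_def N .
  have cells: "cells ?l = {(i, 0) | i. i < n}" by (auto simp: cells_def)
  have cols: "t ` {c \<in> cells ?l. snd c = j} = (if j = 0 then {..<n} else {})" for j
  proof -
    have "{c \<in> cells ?l. snd c = j} = (if j = 0 then cells ?l else {})" by (auto simp: cells simp del: One_nat_def)
    then show ?thesis using t by (simp add: bij_betw_def)
  qed
  have col: "col_perms ?l t = perms n"
    unfolding col_perms_def cols N by (simp add: permutes_image cong: conj_cong)
  have row: "row_perms ?l t = {id}"
  proof -
    have "\<sigma> = id" if \<sigma>: "\<sigma> \<in> row_perms ?l t" for \<sigma>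
    proof
      fix x show "\<sigma> x = id x"
      proof (cases "x < n")
        case True
        then obtain i where i: "i < n" "x = t (i, 0)"
          using t by (auto simp: bij_betw_def cells image_def set_eq_iff simp del: One_nat_def)
        have "{c \<in> cells ?l. fst c = i} = {(i, 0)}" using i by (auto simp: cells simp del: One_nat_def)
        then show ?thesis using \<sigma> i by (auto simp: row_perms_def dest!: spec[of _ i])
      next
        case False
        then show ?thesis using \<sigma> unfolding row_perms_def N by (auto simp: permutes_not_in)
      qed
    qed
    moreover have "id \<in> row_perms ?l t" by (auto simp: row_perms_def permutes_id)
    ultimately show ?thesis by blast
  qed
  have a: "young_a ?l t = (ga_elem id :: _ \<Rightarrow> 'k)"
    unfolding young_a_def ga_elem_def row by simp
  show ?thesis
    unfolding young_c_def a young_b_def col N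
    by (rule ga_elem_id_mult) (simp add: carrier_fun_space)
qed

section \<open>Tensor powers of the twisted general linear bifunctor\<close>

abbreviation (input) tens_space :: "nat \<Rightarrow> obj \<Rightarrow> ('k::field, 'k tens) module" where
  "tens_space n s \<equiv> fun_space (tens_idx n s)"

lemma val_gl_tensor: "val (gl_tensor q n) s = tens_space n s"
  by (simp add: gl_tensor_def)

lemma finite_tens_idx: "finite (tens_idx n s)"
  by (simp add: tens_idx_def finite_PiE)

text \<open>A permutation of \<open>{..<n}\<close> fixes all other positions, so
  \<open>I \<circ> \<sigma>\<close> keeps the value \<open>undefined\<close> there and remains an
  extensional index tuple.\<close>

lemma tens_idx_comp_iff:
  assumes "\<sigma> \<in> perms n" shows "I \<circ> \<sigma> \<in> tens_idx n s \<longleftrightarrow> I \<in> tens_idx n s"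
proof -
  have mem: "I \<circ> \<pi> \<in> tens_idx n s" if "\<pi> permutes {..<n}" "I \<in> tens_idx n s" for \<pi> I
    unfolding tens_idx_def
  proof (rule PiE_I)
    fix t assume "t \<in> {..<n}"
    then have "\<pi> t \<in> {..<n}" using permutes_in_image[OF that(1)] by blast
    then show "(I \<circ> \<pi>) t \<in> {..<snd s} \<times> {..<fst s}"
      using PiE_mem[OF that(2)[unfolded tens_idx_def]] by simp
  next
    fix t assume "t \<notin> {..<n}"
    then show "(I \<circ> \<pi>) t = undefined"
      using permutes_not_in[OF that(1)] PiE_arb[OF that(2)[unfolded tens_idx_def]] by simp
  qed
  have "I = I \<circ> \<sigma> \<circ> pinv \<sigma>" using assms by (simp add: comp_assoc permutes_inv_o)
  then show ?thesis using mem[of \<sigma> I] mem[of "pinv \<sigma>" "I \<circ> \<sigma>"] assms by (auto simp: permutes_inv)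
qed

lemma sum_tens_idx_comp:
  assumes "\<sigma> \<in> perms n"
  shows "(\<Sum>K\<in>tens_idx n s. f (K \<circ> \<sigma>)) = (\<Sum>K\<in>tens_idx n s. f K)"
  by (rule sum.reindex_bij_witness[of _ "\<lambda>K. K \<circ> pinv \<sigma>" "\<lambda>K. K \<circ> \<sigma>"])
    (use assms in \<open>auto simp: comp_assoc permutes_inv_o tens_idx_comp_iff perms_pinv simp del: mem_Collect_eq\<close>)

text \<open>The matrix coefficient at index tuples \<open>I\<close>, \<open>K\<close> is a product
  over positions, hence unchanged when both tuples are permuted alike. Naturality follows by
  substituting \<open>K \<circ> \<sigma>\<close> for \<open>K\<close> in the sum.\<close>

lemma bifun_action_gl_tensor:
  "bifun_action n (gl_tensor q n :: ('k::field, 'k tens) bifun) perm_tens"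
proof (rule bifun_action.intro)
  let ?T = "gl_tensor q n :: ('k, 'k tens) bifun"
  have act: "act ?T s s' \<mu> f = (\<lambda>I. if I \<in> tens_idx n s'
        then \<Sum>K\<in>tens_idx n s. Poly_Mapping.lookup (\<Prod>t<n. gl_entry q (I t) (K t)) \<mu> * f K else 0)"
    for s s' \<mu> f by (simp add: gl_tensor_def)
  show "lin_bifun ?T"
  proof (rule lin_bifun.intro)
    show "linear_map (val ?T s) (val ?T s') (act ?T s s' \<mu>)" for s s' \<mu>
      unfolding val_gl_tensor act
      by (rule linear_mapI)
        (auto simp: carrier_fun_space fun_eq_iff algebra_simps sum.distrib sum_distrib_left)
  qed (simp add: val_gl_tensor vspace_fun_space)
  have perm: "perm_tens \<sigma> f \<in> carrier (val ?T s)" if "\<sigma> \<in> perms n" "f \<in> carrier (val ?T s)" for \<sigma> f s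
    using that tens_idx_comp_iff[OF that(1)]
    by (auto simp: val_gl_tensor carrier_fun_space perm_tens_def)
  show "bifun_action_axioms n ?T perm_tens"
  proof (rule bifun_action_axioms.intro)
    show "perm_action n (val ?T s) perm_tens" for s
    proof (rule perm_action.intro)
      show "linear_map (val ?T s) (val ?T s) (perm_tens \<sigma>)" if "\<sigma> \<in> perms n" for \<sigma>
        by (rule linear_mapI) (simp_all add: perm[OF that], simp_all add: val_gl_tensor perm_tens_def)
    qed (simp_all add: val_gl_tensor vspace_fun_space perm_tens_def comp_assoc)
  next
    fix \<sigma> and f :: "'k tens" and s s' \<mu>
    assume \<sigma>: "\<sigma> \<in> perms n"
    have "(\<Sum>K\<in>tens_idx n s. Poly_Mapping.lookup (\<Prod>t<n. gl_entry q (I (\<sigma> t)) (K t)) \<mu> * f K) =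
        (\<Sum>K\<in>tens_idx n s. Poly_Mapping.lookup (\<Prod>t<n. gl_entry q (I t) (K t)) \<mu> * f (K \<circ> \<sigma>))" for I
    proof -
      have "(\<Prod>t<n. gl_entry q (I t) (K t)) = (\<Prod>t<n. gl_entry q (I (\<sigma> t)) (K (\<sigma> t)) :: monomial \<Rightarrow>\<^sub>0 'k)" for K
        using prod.permute[of \<sigma> "{..<n}" "\<lambda>t. gl_entry q (I t) (K t) :: monomial \<Rightarrow>\<^sub>0 'k"] \<sigma>
        by (simp add: comp_def)
      then show ?thesis
        using sum_tens_idx_comp[OF \<sigma>, of "\<lambda>K. Poly_Mapping.lookup (\<Prod>t<n. gl_entry q (I (\<sigma> t)) (K t)) \<mu> * f K" s]
        by simp
    qed
    then show "perm_tens \<sigma> (act ?T s s' \<mu> f) = act ?T s s' \<mu> (perm_tens \<sigma> f)"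
      unfolding perm_tens_def act tens_idx_comp_iff[OF \<sigma>] comp_apply
      by (intro ext) (simp only:)
  qed
qed


subsection \<open>Pure tensors\<close>

lemma pure_tensor_closed: "pure_tensor n s v \<in> carrier (tens_space n s)"
  by (simp add: carrier_fun_space pure_tensor_def)

text \<open>The factor at position t moves to position \<sigma> t, so the new factor at t is the old
  one at \<sigma>^-1 t.\<close>

lemma perm_pure_tensor:
  assumes "\<sigma> \<in> perms n"
  shows "perm_tens \<sigma> (pure_tensor n s v) = pure_tensor n s (v \<circ> pinv \<sigma>)"
proof
  fix I
  have "(\<Prod>t<n. v t (I (\<sigma> t))) = (\<Prod>t<n. v (pinv \<sigma> t) (I t))"
    using prod.permute[of \<sigma> "{..<n}" "\<lambda>t. v (pinv \<sigma> t) (I t)"] assms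
    by (simp add: comp_def permutes_inverses)
  then show "perm_tens \<sigma> (pure_tensor n s v) I = pure_tensor n s (v \<circ> pinv \<sigma>) I"
    using tens_idx_comp_iff[OF assms, of I s] by (simp add: perm_tens_def pure_tensor_def)
qed

text \<open>Needed because the exterior relations ask two factors to agree on the coordinate range
  only, not as functions.\<close>

lemma pure_tensor_cong:
  assumes "\<And>t x. t < n \<Longrightarrow> x \<in> {..<snd s} \<times> {..<fst s} \<Longrightarrow> v t x = v' t x"
  shows "pure_tensor n s v = pure_tensor n s v'"
proof
  fix I
  have "(\<Prod>t<n. v t (I t)) = (\<Prod>t<n. v' t (I t))" if "I \<in> tens_idx n s"
    using that by (intro prod.cong) (auto simp: tens_idx_def PiE_iff intro!: assms)
  then show "pure_tensor n s v I = pure_tensor n s v' I" by (simp add: pure_tensor_def)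
qed

lemma pure_tensor_add:
  assumes "a < n"
  shows "pure_tensor n s (v(a := \<lambda>y. f y + g y)) I =
    pure_tensor n s (v(a := f)) I + pure_tensor n s (v(a := g)) I"
proof -
  have "(\<Prod>t<n. (v(a := h)) t (I t)) = h (I a) * (\<Prod>t\<in>{..<n} - {a}. v t (I t))" for h
    using assms by (subst prod.remove[of _ a]) (auto intro!: prod.cong)
  then show ?thesis by (simp add: pure_tensor_def distrib_right del: fun_upd_apply)
qed

lemma submodule_finsum:
  assumes "vspace M" "submodule N scalars M" "finite A" "\<And>a. a \<in> A \<Longrightarrow> f a \<in> N"
  shows "(\<Oplus>\<^bsub>M\<^esub>a\<in>A. f a) \<in> N"
proof -
  interpret module scalars M by fact
  show ?thesis using assms(3,4)
    by (induction A rule: finite_induct)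
      (auto simp: submodule_zero[OF assms(2)] submodule_add[OF assms(2)] submodule_carrier[OF assms(2)] Pi_iff)
qed

text \<open>Each coordinate vector \<delta> J is itself pure, with the standard basis vector at
  \<open>J t\<close> as its factor at position t; these vectors span the coordinate space.\<close>

lemma pure_tensor_span:
  fixes N :: "'k::field tens set"
  assumes N: "submodule N scalars (tens_space n s)"
    and pure: "\<And>v. pure_tensor n s v \<in> N"
    and w: "w \<in> carrier (tens_space n s)"
  shows "w \<in> N"
proof -
  define \<delta> :: "_ \<Rightarrow> 'k tens" where "\<delta> J = pure_tensor n s (\<lambda>t y. if y = J t then 1 else 0)" for J
  have delta: "\<delta> J I = (if I = J then 1 else 0)" if "J \<in> tens_idx n s" for I J
  proof -
    have prod: "(\<Prod>t<n. if I t = J t then 1 else (0 :: 'k)) = (if I = J then 1 else 0)" if I: "I \<in> tens_idx n s"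
    proof (cases "I = J")
      \<comment> \<open>Distinct extensional tuples already differ at a position below
        \<open>n\<close>, and that position contributes a zero factor.\<close>
      case False
      then obtain t where t: "t < n" "I t \<noteq> J t"
        using PiE_ext[OF I[unfolded tens_idx_def] \<open>J \<in> tens_idx n s\<close>[unfolded tens_idx_def]] by auto
      then have "(\<Prod>t<n. if I t = J t then 1 else (0 :: 'k)) = 0" by (intro prod_zero bexI[of _ t]) auto
      then show ?thesis using False by simp
    qed simp
    show ?thesis
    proof (cases "I \<in> tens_idx n s")
      case True
      then show ?thesis unfolding \<delta>_def pure_tensor_def using prod[OF True] by (simp only: if_True)
    next
      case False
      then show ?thesis using that by (auto simp: \<delta>_def pure_tensor_def)
    qed
  qed
  have "(\<Oplus>\<^bsub>tens_space n s\<^esub>J\<in>tens_idx n s. w J \<odot>\<^bsub>tens_space n s\<^esub> \<delta> J) = w"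
  proof (subst finsum_fun_space[OF finite_tens_idx])
    show "w J \<odot>\<^bsub>tens_space n s\<^esub> \<delta> J \<in> carrier (tens_space n s)" if "J \<in> tens_idx n s" for J
      using submodule_carrier[OF N submodule_smult[OF N pure]] unfolding \<delta>_def .
    show "(\<lambda>I. \<Sum>J\<in>tens_idx n s. (w J \<odot>\<^bsub>tens_space n s\<^esub> \<delta> J) I) = w"
    proof
      fix I
      have "(\<Sum>J\<in>tens_idx n s. w J * \<delta> J I) = (\<Sum>J\<in>tens_idx n s. if J = I then w J else 0)"
        by (rule sum.cong) (auto simp: delta)
      then show "(\<Sum>J\<in>tens_idx n s. (w J \<odot>\<^bsub>tens_space n s\<^esub> \<delta> J) I) = w I"
        using w by (auto simp: sum.delta[OF finite_tens_idx] carrier_fun_space)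
    qed
  qed
  moreover have "(\<Oplus>\<^bsub>tens_space n s\<^esub>J\<in>tens_idx n s. w J \<odot>\<^bsub>tens_space n s\<^esub> \<delta> J) \<in> N"
    by (rule submodule_finsum[OF vspace_fun_space N finite_tens_idx])
      (rule submodule_smult[OF N], simp add: \<delta>_def pure)
  ultimately show ?thesis by simp
qed

lemma minus_fun_space:
  assumes "f \<in> carrier (fun_space X)" "g \<in> carrier (fun_space X)"
  shows "f \<ominus>\<^bsub>fun_space X\<^esub> g = (\<lambda>x. f x - g x)"
proof -
  have "\<ominus>\<^bsub>fun_space X\<^esub> g = (\<lambda>x. - g x)"
    using vspace_smult_minus[OF vspace_fun_space assms(2)] by simp
  then show ?thesis by (simp add: a_minus_def)
qed

text \<open>Neither the coordinate space nor the permutation of factors depends on \<open>q\<close>,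
  so the instance \<open>q = 0\<close> serves.\<close>

lemma perm_action_tens: "perm_action n (tens_space n s) (perm_tens :: _ \<Rightarrow> 'k::field tens \<Rightarrow> _)"
  using bifun_action.perm_action[OF bifun_action_gl_tensor, of n 0 s] by (simp add: val_gl_tensor)


subsection \<open>Symmetric and exterior powers\<close>

text \<open>The relation space inside \<open>Sym_gl\<close>, stated on the coordinate space so that
  \<open>q\<close> disappears; \<open>alt_rel\<close> does the same for
  \<open>Lambda_gl\<close>.\<close>

definition sym_rel :: "nat \<Rightarrow> obj \<Rightarrow> 'k::field tens set" where
  "sym_rel n s = gen_subspace (tens_space n s)
     {\<lambda>I. pure_tensor n s (v \<circ> \<sigma>) I - pure_tensor n s v I | v \<sigma>. \<sigma> \<in> perms n}"

definition alt_rel :: "nat \<Rightarrow> obj \<Rightarrow> 'k::field tens set" where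
  "alt_rel n s = gen_subspace (tens_space n s)
     {pure_tensor n s v | v. \<exists>i j. i < j \<and> j < n \<and>
        (\<forall>x\<in>{..<snd s} \<times> {..<fst s}. v i x = v j x)}"

lemma Sym_gl_eq: "Sym_gl q n = quot_bifun (gl_tensor q n) (sym_rel n)"
  by (simp add: Sym_gl_def sym_rel_def[abs_def] val_gl_tensor)

lemma Lambda_gl_eq: "Lambda_gl q n = quot_bifun (gl_tensor q n) (alt_rel n)"
  by (simp add: Lambda_gl_def alt_rel_def[abs_def] val_gl_tensor)

lemma sym_gens_closed:
  "{\<lambda>I. pure_tensor n s (v \<circ> \<sigma>) I - pure_tensor n s v I | v \<sigma>. \<sigma> \<in> perms n} \<subseteq>
    carrier (tens_space n s)"
  by (auto simp: carrier_fun_space pure_tensor_def)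

lemma alt_gens_closed:
  "{pure_tensor n s v | v. P v} \<subseteq> carrier (tens_space n s)"
  by (auto simp: carrier_fun_space pure_tensor_def)

lemma submodule_sym_rel: "submodule (sym_rel n s) scalars (tens_space n s)"
  unfolding sym_rel_def by (rule submodule_gen_subspace[OF vspace_fun_space sym_gens_closed])

lemma submodule_alt_rel: "submodule (alt_rel n s) scalars (tens_space n s)"
  unfolding alt_rel_def by (rule submodule_gen_subspace[OF vspace_fun_space alt_gens_closed])

context
  fixes n :: nat and s :: obj
begin

interpretation perm_action n "tens_space n s" perm_tens by (rule perm_action_tens)

text \<open>The trivial idempotent absorbs permutations, so it takes equal values on both terms of a
  generator. The coefficient is kept in the form \<open>c * 1\<close> to match the general
  \<open>c * \<chi> \<sigma>\<close>.\<close>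

lemma sym_rel_kill:
  assumes "perm_character n (\<lambda>_. 1) c" "w \<in> sym_rel n s"
  shows "ga_act n (tens_space n s) perm_tens (\<lambda>\<sigma>. c * 1) w = \<zero>\<^bsub>tens_space n s\<^esub>"
proof -
  let ?E = "ga_act n (tens_space n s) perm_tens (\<lambda>\<sigma>. c * 1)"
  have "?E w \<in> {\<zero>\<^bsub>tens_space n s\<^esub>}"
  proof (rule linear_map_gen_subspace[OF vspace_fun_space vspace_fun_space linear_ga_act
        submodule_null[OF vspace_fun_space] sym_gens_closed _ assms(2)[unfolded sym_rel_def]])
    fix y :: "'a tens" assume "y \<in> {\<lambda>I. pure_tensor n s (v \<circ> \<sigma>) I - pure_tensor n s v I | v \<sigma>. \<sigma> \<in> perms n}"
    then obtain v \<sigma> where \<sigma>: "\<sigma> \<in> perms n" and y: "y = (\<lambda>I. pure_tensor n s (v \<circ> \<sigma>) I - pure_tensor n s v I)"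
      by blast
    have "perm_tens (pinv \<sigma>) (pure_tensor n s v) = pure_tensor n s (v \<circ> \<sigma>)"
      using perm_pure_tensor[OF perms_pinv[OF \<sigma>], of s v] \<sigma> by (simp add: permutes_inv_inv)
    then have "?E (pure_tensor n s (v \<circ> \<sigma>)) = ?E (pure_tensor n s v)"
      using ga_act_character[OF assms(1) perms_pinv[OF \<sigma>] pure_tensor_closed[of n s v]] by simp
    moreover have "?E y = ?E (pure_tensor n s (v \<circ> \<sigma>)) \<ominus>\<^bsub>tens_space n s\<^esub> ?E (pure_tensor n s v)"
      using linear_map_minus[OF linear_ga_act vspace_fun_space vspace_fun_space
          pure_tensor_closed[of n s "v \<circ> \<sigma>"] pure_tensor_closed[of n s v]]
      by (simp add: y minus_fun_space pure_tensor_closed)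
    ultimately show "?E y \<in> {\<zero>\<^bsub>tens_space n s\<^esub>}"
      using ga_act_closed[OF pure_tensor_closed[of n s v]] by (simp add: minus_fun_space)
  qed
  then show ?thesis by simp
qed

lemma linear_perm_diff:
  assumes "\<sigma> \<in> perms n"
  shows "linear_map (tens_space n s) (tens_space n s) (\<lambda>w I. w I - a * perm_tens \<sigma> w I)"
proof (rule linear_mapI)
  fix w :: "'a tens" assume w: "w \<in> carrier (tens_space n s)"
  have "perm_tens \<sigma> w \<in> carrier (tens_space n s)" by (rule closed[OF assms w])
  then show "(\<lambda>I. w I - a * perm_tens \<sigma> w I) \<in> carrier (tens_space n s)"
    using w by (simp add: carrier_fun_space)
qed (simp_all add: perm_tens_def fun_eq_iff algebra_simps)

lemma perm_diff_eq:
  "\<sigma> \<in> perms n \<Longrightarrow> w \<in> carrier (tens_space n s) \<Longrightarrow> w \<ominus>\<^bsub>tens_space n s\<^esub> a \<odot>\<^bsub>tens_space n s\<^esub> perm_tens \<sigma> w = (\<lambda>I. w I - a * perm_tens \<sigma> w I)"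
  using closed[of \<sigma> w] W.smult_closed[of a "perm_tens \<sigma> w"] by (simp add: minus_fun_space)

text \<open>The difference is linear in \<open>w\<close>, so it is enough to test pure tensors,
  which span.\<close>

lemma perm_diff_pure:
  assumes N: "submodule N scalars (tens_space n s)" and \<sigma>: "\<sigma> \<in> perms n" and w: "w \<in> carrier (tens_space n s)"
    and pure: "\<And>v. (\<lambda>I. pure_tensor n s v I - a * pure_tensor n s (v \<circ> pinv \<sigma>) I) \<in> N"
  shows "w \<ominus>\<^bsub>tens_space n s\<^esub> a \<odot>\<^bsub>tens_space n s\<^esub> perm_tens \<sigma> w \<in> N"
proof -
  have "w \<in> {w \<in> carrier (tens_space n s). (\<lambda>I. w I - a * perm_tens \<sigma> w I) \<in> N}"
    by (rule pure_tensor_span[OF submodule_preimage[OF vspace_fun_space vspace_fun_space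
          linear_perm_diff[OF \<sigma>] N] _ w])
      (simp add: pure_tensor_closed perm_pure_tensor[OF \<sigma>] pure)
  then show ?thesis unfolding perm_diff_eq[OF \<sigma> w] by blast
qed

lemma sym_rel_diff:
  assumes "perm_character n (\<lambda>_. 1) c" and w: "w \<in> carrier (tens_space n s)"
  shows "w \<ominus>\<^bsub>tens_space n s\<^esub> ga_act n (tens_space n s) perm_tens (\<lambda>\<sigma>. c * 1) w \<in> sym_rel n s"
proof (rule ga_act_character_diff[OF assms(1) submodule_sym_rel w perm_diff_pure[OF submodule_sym_rel _ w]])
  fix \<sigma> and v :: "nat \<Rightarrow> nat \<times> nat \<Rightarrow> 'a" assume \<sigma>: "\<sigma> \<in> perms n"
  have "(\<lambda>I. pure_tensor n s (v \<circ> pinv \<sigma>) I - pure_tensor n s v I) \<in> sym_rel n s"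
    unfolding sym_rel_def by (rule gen_subspace_incl) (use perms_pinv[OF \<sigma>] in blast)
  \<comment> \<open>The generators list the permuted tensor first; the factor -1 restores the order
    of the difference.\<close>
  from submodule_smult[OF submodule_sym_rel this, of "-1"]
  show "(\<lambda>I. pure_tensor n s v I - 1 * pure_tensor n s (v \<circ> pinv \<sigma>) I) \<in> sym_rel n s" by simp
qed

text \<open>Interchanging the two equal factors fixes a generator, while the sign idempotent turns
  the transposition into the factor -1. Its value on the generator is thus its own negative, and 2
  is invertible.\<close>

lemma alt_rel_kill:
  assumes "perm_character n (\<lambda>\<sigma>. of_int (sign \<sigma>)) c" "w \<in> alt_rel n s"
  shows "ga_act n (tens_space n s) perm_tens (\<lambda>\<sigma>. c * of_int (sign \<sigma>)) w = \<zero>\<^bsub>tens_space n s\<^esub>"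
proof -
  let ?E = "ga_act n (tens_space n s) perm_tens (\<lambda>\<sigma>. c * of_int (sign \<sigma>))"
  have "?E w \<in> {\<zero>\<^bsub>tens_space n s\<^esub>}"
  proof (rule linear_map_gen_subspace[OF vspace_fun_space vspace_fun_space linear_ga_act
        submodule_null[OF vspace_fun_space] alt_gens_closed _ assms(2)[unfolded alt_rel_def]])
    fix y :: "'a tens"
    assume "y \<in> {pure_tensor n s v | v. \<exists>i j. i < j \<and> j < n \<and> (\<forall>x\<in>{..<snd s} \<times> {..<fst s}. v i x = v j x)}"
    then obtain v i j where ij: "i < j" "j < n" and eq: "\<forall>x\<in>{..<snd s} \<times> {..<fst s}. v i x = v j x"
      and y: "y = pure_tensor n s v" by blast
    let ?\<pi> = "Transposition.transpose i j"
    have \<pi>: "?\<pi> \<in> perms n" using ij by (simp add: permutes_swap_id)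
    have "perm_tens ?\<pi> y = y"
      unfolding y perm_pure_tensor[OF \<pi>]
      by (rule pure_tensor_cong) (simp add: transpose_def bspec[OF eq])
    then have E: "?E y = (-1) \<odot>\<^bsub>tens_space n s\<^esub> ?E y"
      using ga_act_character[OF assms(1) \<pi> pure_tensor_closed[of n s v]] ij(1)
      by (simp add: y[symmetric] sign_swap_id)
    \<comment> \<open>Two distinct positions force n to be at least 2, so 2 divides n!, which is
      invertible in the field.\<close>
    have "(2 :: nat) dvd fact n" using ij by (intro dvd_fact) auto
    then obtain m where "fact n = 2 * (m :: nat)" by (elim dvdE)
    then have "c * of_nat (2 * m) = 1" using perm_character.c[OF assms(1)] by metis
    then have two: "(2 :: 'a) \<noteq> 0" by auto
    have "?E y I = 0" for I
    proof -
      have "?E y I = - ?E y I" using fun_cong[OF E, of I] by simp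
      then have "2 * ?E y I = 0" by (simp add: algebra_simps add_eq_0_iff)
      then show ?thesis using two by simp
    qed
    then show "?E y \<in> {\<zero>\<^bsub>tens_space n s\<^esub>}" by (simp add: fun_eq_iff)
  qed
  then show ?thesis by simp
qed

text \<open>Polarization: with \<open>u\<close> the sum of the factors at \<open>a\<close> and
  \<open>b\<close>, placing \<open>u\<close> in both slots and expanding leaves the two mixed
  tensors after the diagonal ones are removed. All three tensors with equal slots are
  generators.\<close>

lemma alt_rel_swap:
  assumes "a < b" "b < n"
  shows "(\<lambda>I. pure_tensor n s v I + pure_tensor n s (v \<circ> Transposition.transpose a b) I) \<in> alt_rel n s"
proof -
  define p where "p f g = pure_tensor n s (v(a := f, b := g))" for f g
  have diag: "p f f \<in> alt_rel n s" for f
    unfolding alt_rel_def p_def by (rule gen_subspace_incl) (use assms in force)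
  define u where "u = (\<lambda>y. v a y + v b y)"
  have right: "p f u I = p f (v a) I + p f (v b) I" for f I
    using pure_tensor_add[of b n s "v(a := f)" "v a" "v b" I] assms by (simp add: p_def u_def)
  have left: "p u g I = p (v a) g I + p (v b) g I" for g I
    using pure_tensor_add[of a n s "v(b := g)" "v a" "v b" I] assms
    by (simp add: p_def u_def fun_upd_twist[of b a])
  have "p (v a) (v b) = pure_tensor n s v" by (simp add: p_def)
  moreover have "v \<circ> Transposition.transpose a b = v(a := v b, b := v a)"
    using assms by (auto simp: fun_eq_iff transpose_def)
  then have "pure_tensor n s (v \<circ> Transposition.transpose a b) = p (v b) (v a)"
    by (simp only: p_def)
  ultimately have "(\<lambda>I. pure_tensor n s v I + pure_tensor n s (v \<circ> Transposition.transpose a b) I) =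
      p u u \<oplus>\<^bsub>tens_space n s\<^esub> ((-1) \<odot>\<^bsub>tens_space n s\<^esub> p (v a) (v a)
        \<oplus>\<^bsub>tens_space n s\<^esub> (-1) \<odot>\<^bsub>tens_space n s\<^esub> p (v b) (v b))"
    by (simp add: fun_eq_iff left right)
  also have "\<dots> \<in> alt_rel n s"
    by (intro submodule_add[OF submodule_alt_rel] submodule_smult[OF submodule_alt_rel] diag)
  finally show ?thesis .
qed

text \<open>Induction over products of transpositions \<pi>: the difference for \<pi> \<sigma> is
  the one for \<sigma> plus sign(\<sigma>) times \<sigma> w + \<pi> \<sigma> w, and the last sum is
  a swap relation.\<close>

lemma alt_rel_perm_diff:
  assumes "\<sigma> permutes {..<n}" "w \<in> carrier (tens_space n s)"
  shows "w \<ominus>\<^bsub>tens_space n s\<^esub> of_int (sign \<sigma>) \<odot>\<^bsub>tens_space n s\<^esub> perm_tens \<sigma> w \<in> alt_rel n s"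
  using assms(1) finite_lessThan assms(2)
proof (induction \<sigma> rule: permutes_induct)
  case id
  have "w \<ominus>\<^bsub>tens_space n s\<^esub> of_int (sign id) \<odot>\<^bsub>tens_space n s\<^esub> perm_tens id w = \<zero>\<^bsub>tens_space n s\<^esub>"
    using perm_diff_eq[of id w 1] id by (simp add: perm_tens_def permutes_id)
  then show ?case using submodule_zero[OF submodule_alt_rel] by metis
next
  case (swap a b \<sigma>)
  let ?\<pi> = "Transposition.transpose a b"
  have \<sigma>: "\<sigma> \<in> perms n" and \<pi>: "?\<pi> \<in> perms n" using swap by (auto simp: permutes_swap_id)
  note w = swap.prems
  have w': "perm_tens \<sigma> w \<in> carrier (tens_space n s)" by (rule closed[OF \<sigma> w])
  have sw: "(\<lambda>I. pure_tensor n s v I + pure_tensor n s (v \<circ> ?\<pi>) I) \<in> alt_rel n s" for v :: "nat \<Rightarrow> nat \<times> nat \<Rightarrow> 'a"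
    using alt_rel_swap[of a b v] alt_rel_swap[of b a v] swap(1-3)
    by (cases "a < b") (auto simp: transpose_commute)
  \<comment> \<open>With coefficient -1 the difference is the sum of the tensor and its
    swap.\<close>
  have 1: "perm_tens \<sigma> w \<ominus>\<^bsub>tens_space n s\<^esub> (-1) \<odot>\<^bsub>tens_space n s\<^esub> perm_tens ?\<pi> (perm_tens \<sigma> w) \<in> alt_rel n s"
    by (rule perm_diff_pure[OF submodule_alt_rel \<pi> w']) (simp add: sw)
  have sgn: "sign (?\<pi> \<circ> \<sigma>) = - sign \<sigma>"
    using sign_compose[of ?\<pi> \<sigma>] \<sigma> \<pi> swap(3) permutation_permutes by (auto simp: sign_swap_id)
  have "w \<ominus>\<^bsub>tens_space n s\<^esub> of_int (sign (?\<pi> \<circ> \<sigma>)) \<odot>\<^bsub>tens_space n s\<^esub> perm_tens (?\<pi> \<circ> \<sigma>) w =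
      (w \<ominus>\<^bsub>tens_space n s\<^esub> of_int (sign \<sigma>) \<odot>\<^bsub>tens_space n s\<^esub> perm_tens \<sigma> w) \<oplus>\<^bsub>tens_space n s\<^esub>
      of_int (sign \<sigma>) \<odot>\<^bsub>tens_space n s\<^esub> (perm_tens \<sigma> w \<ominus>\<^bsub>tens_space n s\<^esub> (-1) \<odot>\<^bsub>tens_space n s\<^esub> perm_tens ?\<pi> (perm_tens \<sigma> w))"
    unfolding perm_diff_eq[OF perms_comp[OF \<pi> \<sigma>] w] perm_diff_eq[OF \<sigma> w] perm_diff_eq[OF \<pi> w']
    unfolding sgn comp[OF \<pi> \<sigma> w]
    by (simp add: fun_eq_iff algebra_simps)
  also have "\<dots> \<in> alt_rel n s"
    by (intro submodule_add[OF submodule_alt_rel] submodule_smult[OF submodule_alt_rel] swap.IH w 1)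
  finally show ?case .
qed

lemma alt_rel_diff:
  assumes "perm_character n (\<lambda>\<sigma>. of_int (sign \<sigma>)) c" and w: "w \<in> carrier (tens_space n s)"
  shows "w \<ominus>\<^bsub>tens_space n s\<^esub> ga_act n (tens_space n s) perm_tens (\<lambda>\<sigma>. c * of_int (sign \<sigma>)) w \<in> alt_rel n s"
  by (rule ga_act_character_diff[OF assms(1) submodule_alt_rel w alt_rel_perm_diff[OF _ w]]) simp

end

text \<open>The image depends only on the coefficients of \<open>\<phi> m0\<close> on permutations.
  Young ideals and character lines with the same coefficients \<open>x\<close> thereby meet in one
  subspace.\<close>

lemma (in bifun_action_complex) tensor_Ext_iso_image:
  assumes "split_cyclic_module n M \<rho> \<phi> m0" "\<And>\<sigma>. \<sigma> \<in> perms n \<Longrightarrow> \<phi> m0 \<sigma> = x \<sigma>"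
  shows "tensor_kS n M \<rho> (Ext P d T i) (Ext_act i) \<cong>\<^sub>k
      (Ext P d T i)\<lparr>carrier := ga_act n (Ext P d T i) (Ext_act i) x ` carrier (Ext P d T i)\<rparr>"
    and "vspace (tensor_kS n M \<rho> (Ext P d T i) (Ext_act i))"
proof -
  interpret M: split_cyclic_module n M \<rho> \<phi> m0 by fact
  interpret E: split_tensor n M \<rho> \<phi> m0 "Ext P d T i" "Ext_act i" by unfold_locales
  have "ga_act n (Ext P d T i) (Ext_act i) (\<phi> m0) ` carrier (Ext P d T i) =
      ga_act n (Ext P d T i) (Ext_act i) x ` carrier (Ext P d T i)"
    by (rule image_cong[OF refl Ext.ga_act_cong[OF _ assms(2)]])
  then show "tensor_kS n M \<rho> (Ext P d T i) (Ext_act i) \<cong>\<^sub>k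
      (Ext P d T i)\<lparr>carrier := ga_act n (Ext P d T i) (Ext_act i) x ` carrier (Ext P d T i)\<rparr>"
    using E.tensor_iso_image by simp
  show "vspace (tensor_kS n M \<rho> (Ext P d T i) (Ext_act i))" by (rule E.vspace_tensor)
qed

lemma lin_complex_projective_resolution:
  assumes "projective_resolution P d A" shows "lin_complex P d"
proof (rule lin_complex.intro)
  show "lin_bifun (P i)" for i
  proof -
    have "projective_bifun (P i)" using assms by (simp only: projective_resolution_def)
    then have "strict_poly_bifun (P i)" by (simp only: projective_bifun_def PopP_def)
    then show ?thesis
      by (intro lin_bifun.intro) (simp_all only: strict_poly_bifun_def fd_vspace_def)
  qed
  show "d i \<in> nat_trans (P (Suc i)) (P i)" for i
    using assms unfolding projective_resolution_def by blast
  fix x i s assume "x \<in> carrier (val (P (Suc (Suc i))) s)"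
  then have "d (Suc i) s x \<in> ker (val (P (Suc i)) s) (val (P i) s) (d i s)"
    using assms unfolding projective_resolution_def by blast
  then show "d i s (d (Suc i) s x) = \<zero>\<^bsub>val (P i) s\<^esub>" by (simp add: ker_def)
qed

text \<open>A prime divides n! only if it is at most n; this is how \<open>p > n\<close> makes the
  averages over the group available.\<close>

lemma of_nat_fact_neq_zero:
  assumes "CHAR('k::field) > n" shows "of_nat (fact n) \<noteq> (0 :: 'k)"
proof
  assume "of_nat (fact n) = (0 :: 'k)"
  then have "CHAR('k) dvd fact n" by (simp add: of_nat_eq_0_iff_char_dvd)
  moreover have "prime CHAR('k)" using assms by (intro prime_CHAR_semidom) simp
  ultimately show False using assms by (simp add: prime_dvd_fact_iff)
qed

theorem proposition5p1:
  fixes P :: "nat \<Rightarrow> ('k::field, nat \<Rightarrow> 'k) bifun"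
    and d :: "nat \<Rightarrow> obj \<Rightarrow> (nat \<Rightarrow> 'k) \<Rightarrow> (nat \<Rightarrow> 'k)"
    and p r n :: nat
    and lam :: "nat list" and t :: "nat \<times> nat \<Rightarrow> nat"
  assumes "CHAR('k) = p" and "p > 0" and "p > n"
    and "is_partition lam n" and "young_tableau lam t"
    and "projective_resolution P d (Gamma_gl (n * p ^ r) :: ('k, 'k tens) bifun)"
  shows
    "(\<forall>i. Ext P d (s_bifun lam t (gl_tensor (p ^ r) n) perm_tens) i \<cong>\<^sub>k
           s_mod lam t (Ext P d (gl_tensor (p ^ r) n) i) (Ext_perm P d (p ^ r) n i)) \<and>
     (\<forall>i t1. young_tableau [n] t1 \<longrightarrow>
           Ext P d (Sym_gl (p ^ r) n) i \<cong>\<^sub>k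
             s_mod [n] t1 (Ext P d (gl_tensor (p ^ r) n) i) (Ext_perm P d (p ^ r) n i) \<and>
           s_mod [n] t1 (Ext P d (gl_tensor (p ^ r) n) i) (Ext_perm P d (p ^ r) n i) \<cong>\<^sub>k
             tensor_kS n line triv_ract
               (Ext P d (gl_tensor (p ^ r) n) i) (Ext_perm P d (p ^ r) n i)) \<and>
     (\<forall>i t2. young_tableau (replicate n 1) t2 \<longrightarrow>
           Ext P d (Lambda_gl (p ^ r) n) i \<cong>\<^sub>k
             s_mod (replicate n 1) t2
               (Ext P d (gl_tensor (p ^ r) n) i) (Ext_perm P d (p ^ r) n i) \<and>
           s_mod (replicate n 1) t2
               (Ext P d (gl_tensor (p ^ r) n) i) (Ext_perm P d (p ^ r) n i) \<cong>\<^sub>k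
             tensor_kS n line sgn_ract
               (Ext P d (gl_tensor (p ^ r) n) i) (Ext_perm P d (p ^ r) n i))"
proof (intro conjI allI impI)
  let ?T = "gl_tensor (p ^ r) n :: ('k, 'k tens) bifun"
  interpret action: bifun_action n ?T perm_tens by (rule bifun_action_gl_tensor)
  interpret complex: lin_complex P d by (rule lin_complex_projective_resolution[OF assms(6)])
  interpret bifun_action_complex n ?T perm_tens P d ..
  have Ext_perm: "Ext_perm P d (p ^ r) n i = Ext_act i" for i
    by (rule ext) (simp add: Ext_perm_def action.perm_nt_def)
  define c :: 'k where "c = inverse (of_nat (fact n))"
  have c: "c * of_nat (fact n) = 1"
    using of_nat_fact_neq_zero[where 'k = 'k, of n] assms(1,3) by (simp add: c_def)
  have lam: "sum_list lam = n" using assms(4) by (simp add: is_partition_def)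
  have col: "sum_list (replicate n (1::nat)) = n" by (simp add: sum_list_replicate)
  have triv: "perm_character n (\<lambda>_. 1) c"
    by (rule perm_character.intro) (simp_all add: c)
  have sgn: "perm_character n (\<lambda>\<sigma>. of_int (sign \<sigma>)) c"
  proof (rule perm_character.intro)
    fix \<sigma> \<pi> assume "\<sigma> \<in> perms n" "\<pi> \<in> perms n"
    then have "permutation \<sigma>" "permutation \<pi>" by (auto simp: permutation_permutes)
    then show "of_int (sign (\<sigma> \<circ> \<pi>)) = (of_int (sign \<sigma>) * of_int (sign \<pi>) :: 'k)"
      by (simp add: sign_compose)
  qed (simp_all add: c flip: of_int_mult)
  note image_iso = tensor_Ext_iso_image
  fix i
  show "Ext P d (s_bifun lam t ?T perm_tens) i \<cong>\<^sub>k s_mod lam t (Ext P d ?T i) (Ext_perm P d (p ^ r) n i)"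
  proof -
    \<comment> \<open>For general \<lambda> the existence of a right unit is enough: source and
      target are computed with the same \<open>e\<close>.\<close>
    obtain e :: "_ \<Rightarrow> 'k" where "e \<in> carrier (young_ideal lam t)" "\<forall>x\<in>carrier (young_ideal lam t). ga_mult (sum_list lam) x e = x"
      using ex_young_ideal_generator[of c lam t] c unfolding lam by blast
    then have "split_cyclic_module (sum_list lam) (young_ideal lam t) (young_ract lam) (\<lambda>x \<sigma>. x (pinv \<sigma>)) e"
      by (intro split_cyclic_young_ideal) blast+
    then show ?thesis
      unfolding s_bifun_def s_mod_def Ext_perm lam by (rule Ext_tensor)
  qed
  {
    fix t1 assume t1: "young_tableau [n] t1"
    have sum: "sum_list [n] = n" by simp
    obtain e :: "_ \<Rightarrow> 'k" where e: "split_cyclic_module n (young_ideal [n] t1) (young_ract [n]) (\<lambda>x \<sigma>. x (pinv \<sigma>)) e"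
      "\<And>\<sigma>. \<sigma> \<in> perms n \<Longrightarrow> e (pinv \<sigma>) = c * 1"
      using split_cyclic_young_character[of "[n]" "\<lambda>_. 1" c t1, unfolded sum, OF triv young_c_row[OF t1]] by blast
    \<comment> \<open>The Young ideal of one row and the trivial line both have coefficients
      \<open>c * 1\<close>, so each tensor product is the image of the averaging operator, as is the
      Ext of the symmetric power.\<close>
    note s = image_iso[OF e(1), OF e(2), where i = i]
    have line: "split_cyclic_module n line triv_ract (\<lambda>m \<sigma>. m * (c * 1)) 1"
      by (rule perm_character.split_cyclic_line[OF triv]) (simp add: triv_ract_def)
    note l = image_iso[OF line, OF mult_1, where i = i]
    \<comment> \<open>The symmetric relations are the kernel of averaging:
      \<open>sym_rel_kill\<close> and \<open>sym_rel_diff\<close> are the two conditions on the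
      quotient.\<close>
    have "Ext P d (Sym_gl (p ^ r) n) i \<cong>\<^sub>k (Ext P d ?T i)\<lparr>carrier :=
        ga_act n (Ext P d ?T i) (Ext_act i) (\<lambda>\<sigma>. c * 1) ` carrier (Ext P d ?T i)\<rparr>"
      unfolding Sym_gl_eq
      by (rule Ext_quot_bifun; unfold val_gl_tensor)
        (rule submodule_sym_rel sym_rel_kill[OF triv] sym_rel_diff[OF triv]; assumption?)+
    then show "Ext P d (Sym_gl (p ^ r) n) i \<cong>\<^sub>k s_mod [n] t1 (Ext P d ?T i) (Ext_perm P d (p ^ r) n i)"
      unfolding s_mod_def Ext_perm sum by (rule vs_iso_trans[OF _ vs_iso_sym[OF s]])
    show "s_mod [n] t1 (Ext P d ?T i) (Ext_perm P d (p ^ r) n i) \<cong>\<^sub>k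
        tensor_kS n line triv_ract (Ext P d ?T i) (Ext_perm P d (p ^ r) n i)"
      unfolding s_mod_def Ext_perm sum by (rule vs_iso_trans[OF s(1) vs_iso_sym[OF l]])
  }
  {
    let ?l = "replicate n (1::nat)"
    fix t2 assume t2: "young_tableau ?l t2"
    obtain e :: "_ \<Rightarrow> 'k" where e: "split_cyclic_module n (young_ideal ?l t2) (young_ract ?l) (\<lambda>x \<sigma>. x (pinv \<sigma>)) e"
      "\<And>\<sigma>. \<sigma> \<in> perms n \<Longrightarrow> e (pinv \<sigma>) = c * of_int (sign \<sigma>)"
      using split_cyclic_young_character[of ?l "\<lambda>\<sigma>. of_int (sign \<sigma>)" c t2, unfolded col, OF sgn young_c_column[OF t2]] by blast
    note s = image_iso[OF e(1), OF e(2), where i = i]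
    have line: "split_cyclic_module n line sgn_ract (\<lambda>m \<sigma>. m * (c * of_int (sign \<sigma>))) 1"
      by (rule perm_character.split_cyclic_line[OF sgn]) (simp add: sgn_ract_def)
    note l = image_iso[OF line, OF mult_1, where i = i]
    \<comment> \<open>Likewise the exterior relations are the kernel of signed averaging, the
      operator that \<open>s\<close> and \<open>l\<close> attach to one column and to the sign
      line.\<close>
    have "Ext P d (Lambda_gl (p ^ r) n) i \<cong>\<^sub>k (Ext P d ?T i)\<lparr>carrier :=
        ga_act n (Ext P d ?T i) (Ext_act i) (\<lambda>\<sigma>. c * of_int (sign \<sigma>)) ` carrier (Ext P d ?T i)\<rparr>"
      unfolding Lambda_gl_eq
      by (rule Ext_quot_bifun; unfold val_gl_tensor)
        (rule submodule_alt_rel alt_rel_kill[OF sgn] alt_rel_diff[OF sgn]; assumption?)+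
    then show "Ext P d (Lambda_gl (p ^ r) n) i \<cong>\<^sub>k s_mod ?l t2 (Ext P d ?T i) (Ext_perm P d (p ^ r) n i)"
      unfolding s_mod_def Ext_perm col by (rule vs_iso_trans[OF _ vs_iso_sym[OF s]])
    show "s_mod ?l t2 (Ext P d ?T i) (Ext_perm P d (p ^ r) n i) \<cong>\<^sub>k
        tensor_kS n line sgn_ract (Ext P d ?T i) (Ext_perm P d (p ^ r) n i)"
      unfolding s_mod_def Ext_perm col by (rule vs_iso_trans[OF s(1) vs_iso_sym[OF l]])
  }
qed

end
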